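(* Let $M$ be a taut complex manifold with Kobayashi distance $k_M$, and assume that $k_M\in C^1(M\times M\setminus \mathrm{Diag})$, where $\mathrm{Diag}=\{(z,z): z\in M\}$. Then for any evolution family $(\varphi_{s,t})_{0\le s\le t<+\infty}$ on $M$ there exists a Herglotz vector field $G$ (of order $\infty$) on $M$ such that for all $s\ge 0$ and all $z\in M$ $$\frac{\partial \varphi_{s,t}(z)}{\partial t}=G(\varphi_{s,t}(z),t)\quad \text{for a.e. } t\in[s,+\infty).\qquad(\ast)$$ Moreover, if $H$ is another weak holomorphic vector field on $M$ such that $(\ast)$ holds with $H$ in place of $G$ (for all $s\ge 0$ and $z\in M$), then $G(z,t)=H(z,t)$ for all $z\in M$ and almost every $t\in[0,+\infty)$.
   Context: Complex manifolds are connected, Hausdorff and second countable. $TM$ is the complex tangent bundle of $M$, $\|\cdot\|$ is a fixed Hermitian metric along the fibers of $TM$, and $d_M(\cdot,\cdot)$ is the distance on $M$ induced by $\|\cdot\|$. $k_M$ denotes the Kobayashi (pseudo-)distance of $M$. $M$ is taut if every sequence of holomorphic maps from the unit disc $\mathbb{D}\subset\mathbb{C}$ to $M$ has a subsequence that either converges uniformly on compacta to a holomorphic map $\mathbb{D}\to M$ or is compactly divergent. A weak holomorphic vector field of order $d\in[1,+\infty]$ on $M$ is a map $G:M\times[0,+\infty)\to TM$ with $G(z,t)\in T_zM$ such that: (1) for all $z\in M$, $t\mapsto G(z,t)$ is measurable; (2) for all $t\ge 0$, $z\mapsto G(z,t)$ is holomorphic; (3) for every compact set $K\subset M$ and every $T>0$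 there is a function $C_{K,T}\in L^d([0,T],\mathbb{R}^+)$ with $\|G(z,t)\|\le C_{K,T}(t)$ for all $z\in K$ and almost every $t\in[0,T]$. A weak holomorphic vector field is one of some order $d\in[1,+\infty]$. Assuming $k_M\in C^1(M\times M\setminus\mathrm{Diag})$, a Herglotz vector field (of order $\infty$) on $M$ is a weak holomorphic vector field $G$ of order $\infty$ such that $(dk_M)_{(z,w)}(G(z,t),G(w,t))\le 0$ for almost every $t\in[0,+\infty)$ and all $z,w\in M$ with $z\ne w$. An evolution family on $M$ is a family $(\varphi_{s,t})_{0\le s\le t<+\infty}$ of maps such that: (1) $\varphi_{s,s}=\mathrm{id}_M$ for all $s\ge0$; (2) $\varphi_{s,t}=\varphi_{u,t}\circ\varphi_{s,u}$ for all $0\le s\le u\le t<+\infty$; (3) $\varphi_{s,t}:M\to M$ is holomorphic for all $0\le s\le t<+\infty$; (4) for every $T>0$ and every compact set $K\subset M$ there is a constant $c_{T,K}>0$ such that $\sup_{z\in K}d_M(\varphi_{s,t}(z),\varphi_{s,t'}(z))\le c_{T,K}|t-t'|$ for all $s\geq 0$ and all $t,t'\in[s,T]$. *)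

theory Defs
  imports "HOL-Analysis.Analysis"
begin

section \<open>Calculus on open subsets of coordinate spaces\<close>

text \<open>Both notions below are only used on open sets.\<close>

definition holomorphic_vec_on ::
  "((complex, 'n::finite) vec \<Rightarrow> (complex, 'm::finite) vec) \<Rightarrow> (complex, 'n) vec set \<Rightarrow> bool"
  where "holomorphic_vec_on f S \<longleftrightarrow>
    (\<forall>x\<in>S. \<exists>D. (f has_derivative D) (at x) \<and> (\<forall>a v. D (a *s v) = a *s D v))"

primrec C_k_on ::
  "nat \<Rightarrow> ('e::euclidean_space \<Rightarrow> 'f::real_normed_vector) \<Rightarrow> 'e set \<Rightarrow> bool"
  where
    "C_k_on 0 f S \<longleftrightarrow> continuous_on S f"
  | "C_k_on (Suc k) f S \<longleftrightarrow> (\<forall>x\<in>S. f differentiable (at x)) \<and>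
      (\<forall>v. C_k_on k (\<lambda>x. frechet_derivative f (at x) v) S)"

definition smooth_on :: "('e::euclidean_space \<Rightarrow> 'f::real_normed_vector) \<Rightarrow> 'e set \<Rightarrow> bool"
  where "smooth_on f S \<longleftrightarrow> (\<forall>k. C_k_on k f S)"


section \<open>Complex manifolds\<close>

text \<open>The points of the manifold form a whole type; the topology comes from its type class
  (Hausdorff and second countable in the theorem), the complex structure from an atlas, which
  need not be maximal. A chart is a pair of its domain and its coordinate map; the values of the
  coordinate map outside the domain are irrelevant.\<close>

type_synonym ('a, 'n) chart = "'a set \<times> ('a \<Rightarrow> (complex, 'n) vec)"

definition chart_inv :: "('a, 'n) chart \<Rightarrow> (complex, 'n) vec \<Rightarrow> 'a"
  where "chart_inv c = inv_into (fst c) (snd c)"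

definition transition ::
  "('a, 'n) chart \<Rightarrow> ('a, 'n) chart \<Rightarrow> (complex, 'n) vec \<Rightarrow> (complex, 'n) vec"
  where "transition c c' = (\<lambda>x. snd c' (chart_inv c x))"

definition complex_atlas :: "('a::topological_space, 'n::finite) chart set \<Rightarrow> bool"
  where "complex_atlas A \<longleftrightarrow>
    (\<Union>c\<in>A. fst c) = UNIV \<and>
    (\<forall>c\<in>A. open (fst c) \<and> open (snd c ` fst c) \<and>
       homeomorphism (fst c) (snd c ` fst c) (snd c) (chart_inv c)) \<and>
    (\<forall>c\<in>A. \<forall>c'\<in>A. holomorphic_vec_on (transition c c') (snd c ` (fst c \<inter> fst c')))"

definition complex_manifold ::
  "('a::{t2_space, second_countable_topology}, 'n::finite) chart set \<Rightarrow> bool"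
  where "complex_manifold A \<longleftrightarrow> connected (UNIV :: 'a set) \<and> complex_atlas A"

definition holomorphic_self_map ::
  "('a::topological_space, 'n::finite) chart set \<Rightarrow> ('a \<Rightarrow> 'a) \<Rightarrow> bool"
  where "holomorphic_self_map A f \<longleftrightarrow> continuous_on UNIV f \<and>
    (\<forall>c\<in>A. \<forall>c'\<in>A. holomorphic_vec_on (\<lambda>x. snd c' (f (chart_inv c x)))
       (snd c ` (fst c \<inter> f -` fst c')))"

text \<open>Maps on the unit disc are total functions whose values off the disc are irrelevant.\<close>

definition holomorphic_disc ::
  "('a::topological_space, 'n::finite) chart set \<Rightarrow> (complex \<Rightarrow> 'a) \<Rightarrow> bool"
  where "holomorphic_disc A f \<longleftrightarrow> continuous_on (ball 0 1) f \<and>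
    (\<forall>c\<in>A. \<forall>i. (\<lambda>\<zeta>. snd c (f \<zeta>) $ i) holomorphic_on (ball 0 1 \<inter> f -` fst c))"


section \<open>Tangent vectors and Hermitian metrics\<close>

text \<open>A tangent vector at z is the family of its coordinate vectors in all charts around z,
  related by the derivatives of the transition maps. The coordinates are set to 0 for all other
  arguments, so that equality of tangent vectors is equality of functions.\<close>

type_synonym ('a, 'n) tvector = "('a, 'n) chart \<Rightarrow> (complex, 'n) vec"

definition tangent_space ::
  "('a, 'n::finite) chart set \<Rightarrow> 'a \<Rightarrow> ('a, 'n) tvector set"
  where "tangent_space A z = {v.
    (\<forall>c. \<not> (c \<in> A \<and> z \<in> fst c) \<longrightarrow> v c = 0) \<and>
    (\<forall>c\<in>A. \<forall>c'\<in>A. z \<in> fst c \<and> z \<in> fst c' \<longrightarrow>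
       v c' = frechet_derivative (transition c c') (at (snd c z)) (v c))}"

text \<open>The tangent vector at z whose coordinate vector in the chart c is a.\<close>

definition tvector_of_coords ::
  "('a, 'n::finite) chart set \<Rightarrow> ('a, 'n) chart \<Rightarrow> 'a \<Rightarrow> (complex, 'n) vec \<Rightarrow> ('a, 'n) tvector"
  where "tvector_of_coords A c z a = (\<lambda>c'. if c' \<in> A \<and> z \<in> fst c'
    then frechet_derivative (transition c c') (at (snd c z)) a else 0)"

definition hermitian_metric ::
  "('a, 'n::finite) chart set \<Rightarrow> ('a \<Rightarrow> ('a, 'n) tvector \<Rightarrow> ('a, 'n) tvector \<Rightarrow> complex) \<Rightarrow> bool"
  where "hermitian_metric A h \<longleftrightarrow>
    (\<forall>z. \<forall>u\<in>tangent_space A z. \<forall>v\<in>tangent_space A z. \<forall>w\<in>tangent_space A z. \<forall>a b.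
       h z (\<lambda>c. a *s u c + b *s v c) w = a * h z u w + b * h z v w) \<and>
    (\<forall>z. \<forall>u\<in>tangent_space A z. \<forall>v\<in>tangent_space A z. h z v u = cnj (h z u v)) \<and>
    (\<forall>z. \<forall>u\<in>tangent_space A z. u \<noteq> (\<lambda>c. 0) \<longrightarrow> 0 < Re (h z u u)) \<and>
    (\<forall>c\<in>A. \<forall>a b. smooth_on
       (\<lambda>x. h (chart_inv c x) (tvector_of_coords A c (chart_inv c x) a)
                              (tvector_of_coords A c (chart_inv c x) b))
       (snd c ` fst c))"

definition tnorm ::
  "('a \<Rightarrow> ('a, 'n) tvector \<Rightarrow> ('a, 'n) tvector \<Rightarrow> complex) \<Rightarrow> 'a \<Rightarrow> ('a, 'n) tvector \<Rightarrow> real"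
  where "tnorm h z v = sqrt (Re (h z v v))"


section \<open>Curves and the distance induced by a Hermitian metric\<close>

definition has_velocity ::
  "('a, 'n::finite) chart set \<Rightarrow> (real \<Rightarrow> 'a) \<Rightarrow> ('a, 'n) tvector \<Rightarrow> real \<Rightarrow> real set \<Rightarrow> bool"
  where "has_velocity A \<gamma> v t S \<longleftrightarrow>
    (\<forall>c\<in>A. \<gamma> t \<in> fst c \<longrightarrow>
       ((\<lambda>\<tau>. snd c (\<gamma> \<tau>)) has_vector_derivative v c) (at t within S))"

definition velocity ::
  "('a, 'n::finite) chart set \<Rightarrow> (real \<Rightarrow> 'a) \<Rightarrow> real \<Rightarrow> ('a, 'n) tvector"
  where "velocity A \<gamma> t = (\<lambda>c. if c \<in> A \<and> \<gamma> t \<in> fst c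
    then vector_derivative (\<lambda>\<tau>. snd c (\<gamma> \<tau>)) (at t) else 0)"

definition C1_curve ::
  "('a::topological_space, 'n::finite) chart set \<Rightarrow> (real \<Rightarrow> 'a) \<Rightarrow> real \<Rightarrow> real \<Rightarrow> bool"
  where "C1_curve A \<gamma> a b \<longleftrightarrow> continuous_on {a..b} \<gamma> \<and>
    (\<forall>c\<in>A.
       (\<forall>t\<in>{a..b} \<inter> \<gamma> -` fst c. (\<lambda>\<tau>. snd c (\<gamma> \<tau>)) differentiable (at t within {a..b})) \<and>
       continuous_on ({a..b} \<inter> \<gamma> -` fst c)
         (\<lambda>t. vector_derivative (\<lambda>\<tau>. snd c (\<gamma> \<tau>)) (at t within {a..b})))"

definition piecewise_C1_curve ::
  "('a::topological_space, 'n::finite) chart set \<Rightarrow> (real \<Rightarrow> 'a) \<Rightarrow> bool"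
  where "piecewise_C1_curve A \<gamma> \<longleftrightarrow>
    (\<exists>(m::nat) p. p 0 = 0 \<and> p m = 1 \<and>
       (\<forall>i<m. p i < p (Suc i) \<and> C1_curve A \<gamma> (p i) (p (Suc i))))"

text \<open>The velocity may be meaningless at the finitely many break points, which the integral
  ignores.\<close>

definition curve_length ::
  "('a, 'n::finite) chart set \<Rightarrow> ('a \<Rightarrow> ('a, 'n) tvector \<Rightarrow> ('a, 'n) tvector \<Rightarrow> complex) \<Rightarrow>
    (real \<Rightarrow> 'a) \<Rightarrow> real"
  where "curve_length A h \<gamma> = integral {0..1} (\<lambda>t. tnorm h (\<gamma> t) (velocity A \<gamma> t))"

definition hermitian_dist ::
  "('a::topological_space, 'n::finite) chart set \<Rightarrow>
    ('a \<Rightarrow> ('a, 'n) tvector \<Rightarrow> ('a, 'n) tvector \<Rightarrow> complex) \<Rightarrow> 'a \<Rightarrow> 'a \<Rightarrow> real"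
  where "hermitian_dist A h z w =
    Inf {curve_length A h \<gamma> | \<gamma>. piecewise_C1_curve A \<gamma> \<and> \<gamma> 0 = z \<and> \<gamma> 1 = w}"


section \<open>The Kobayashi pseudo-distance and tautness\<close>

text \<open>Normalised to curvature -4; the notions below do not depend on the normalisation.\<close>

definition poincare_dist :: "complex \<Rightarrow> complex \<Rightarrow> real"
  where "poincare_dist \<zeta> \<omega> = artanh (cmod ((\<zeta> - \<omega>) / (1 - cnj \<omega> * \<zeta>)))"

text \<open>Infimum over chains of holomorphic discs; p lists the successive points of the chain.\<close>

definition kobayashi_dist ::
  "('a::topological_space, 'n::finite) chart set \<Rightarrow> 'a \<Rightarrow> 'a \<Rightarrow> real"
  where "kobayashi_dist A z w =
    Inf {(\<Sum>i<m. poincare_dist (\<zeta> i) (\<omega> i)) | (m::nat) \<zeta> \<omega>.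
      \<exists>p f. p 0 = z \<and> p m = w \<and>
        (\<forall>i<m. holomorphic_disc A (f i) \<and> \<zeta> i \<in> ball 0 1 \<and> \<omega> i \<in> ball 0 1 \<and>
           f i (\<zeta> i) = p i \<and> f i (\<omega> i) = p (Suc i))}"

definition converges_compactly ::
  "('a::topological_space, 'n::finite) chart set \<Rightarrow>
    ('a \<Rightarrow> ('a, 'n) tvector \<Rightarrow> ('a, 'n) tvector \<Rightarrow> complex) \<Rightarrow>
    (nat \<Rightarrow> complex \<Rightarrow> 'a) \<Rightarrow> (complex \<Rightarrow> 'a) \<Rightarrow> bool"
  where "converges_compactly A h f g \<longleftrightarrow>
    (\<forall>K. compact K \<and> K \<subseteq> ball 0 1 \<longrightarrow>
       (\<forall>\<epsilon>>0. \<forall>\<^sub>F n in sequentially. \<forall>\<zeta>\<in>K. hermitian_dist A h (f n \<zeta>) (g \<zeta>) < \<epsilon>))"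

definition compactly_divergent :: "(nat \<Rightarrow> complex \<Rightarrow> 'a::topological_space) \<Rightarrow> bool"
  where "compactly_divergent f \<longleftrightarrow>
    (\<forall>K L. compact K \<and> K \<subseteq> ball 0 1 \<and> compact L \<longrightarrow>
       (\<forall>\<^sub>F n in sequentially. f n ` K \<inter> L = {}))"

definition taut ::
  "('a::topological_space, 'n::finite) chart set \<Rightarrow>
    ('a \<Rightarrow> ('a, 'n) tvector \<Rightarrow> ('a, 'n) tvector \<Rightarrow> complex) \<Rightarrow> bool"
  where "taut A h \<longleftrightarrow>
    (\<forall>f. (\<forall>n. holomorphic_disc A (f n)) \<longrightarrow>
       (\<exists>r::nat \<Rightarrow> nat. strict_mono r \<and>
          ((\<exists>g. holomorphic_disc A g \<and> converges_compactly A h (f \<circ> r) g) \<or>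
           compactly_divergent (f \<circ> r))))"


section \<open>Functions of two points\<close>

definition in_charts ::
  "('a, 'n) chart \<Rightarrow> ('a, 'n) chart \<Rightarrow> ('a \<Rightarrow> 'a \<Rightarrow> real) \<Rightarrow>
    (complex, 'n) vec \<times> (complex, 'n) vec \<Rightarrow> real"
  where "in_charts c c' F = (\<lambda>(x, y). F (chart_inv c x) (chart_inv c' y))"

definition C1_off_diagonal ::
  "('a, 'n::finite) chart set \<Rightarrow> ('a \<Rightarrow> 'a \<Rightarrow> real) \<Rightarrow> bool"
  where "C1_off_diagonal A F \<longleftrightarrow>
    (\<forall>c\<in>A. \<forall>c'\<in>A. C_k_on 1 (in_charts c c' F)
       {(x, y). x \<in> snd c ` fst c \<and> y \<in> snd c' ` fst c' \<and> chart_inv c x \<noteq> chart_inv c' y})"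

definition chart_at :: "('a, 'n) chart set \<Rightarrow> 'a \<Rightarrow> ('a, 'n) chart"
  where "chart_at A z = (SOME c. c \<in> A \<and> z \<in> fst c)"

text \<open>The differential of F at (z, w) applied to (u, v). Wherever F is differentiable the value
  is independent of the choice of charts, by the chain rule.\<close>

definition differential2 ::
  "('a, 'n::finite) chart set \<Rightarrow> ('a \<Rightarrow> 'a \<Rightarrow> real) \<Rightarrow> 'a \<Rightarrow> 'a \<Rightarrow>
    ('a, 'n) tvector \<Rightarrow> ('a, 'n) tvector \<Rightarrow> real"
  where "differential2 A F z w u v =
    (let c = chart_at A z; c' = chart_at A w in
      frechet_derivative (in_charts c c' F) (at (snd c z, snd c' w)) (u c, v c'))"


section \<open>Vector fields and evolution families\<close>

definition Ld_nonneg :: "ennreal \<Rightarrow> real set \<Rightarrow> (real \<Rightarrow> real) \<Rightarrow> bool"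
  where "Ld_nonneg d S C \<longleftrightarrow>
    (\<forall>t\<in>S. 0 \<le> C t) \<and> C \<in> borel_measurable (lebesgue_on S) \<and>
    (if d = \<infinity> then \<exists>B. AE t in lebesgue_on S. C t \<le> B
     else integrable (lebesgue_on S) (\<lambda>t. C t powr enn2real d))"

definition weak_holomorphic_vector_field_of_order ::
  "('a::topological_space, 'n::finite) chart set \<Rightarrow>
    ('a \<Rightarrow> ('a, 'n) tvector \<Rightarrow> ('a, 'n) tvector \<Rightarrow> complex) \<Rightarrow> ennreal \<Rightarrow>
    ('a \<Rightarrow> real \<Rightarrow> ('a, 'n) tvector) \<Rightarrow> bool"
  where "weak_holomorphic_vector_field_of_order A h d G \<longleftrightarrow>
    1 \<le> d \<and>
    (\<forall>z. \<forall>t\<ge>0. G z t \<in> tangent_space A z) \<and>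
    (\<forall>z. \<forall>c\<in>A. z \<in> fst c \<longrightarrow> (\<lambda>t. G z t c) \<in> borel_measurable (lebesgue_on {0..})) \<and>
    (\<forall>t\<ge>0. \<forall>c\<in>A. holomorphic_vec_on (\<lambda>x. G (chart_inv c x) t c) (snd c ` fst c)) \<and>
    (\<forall>K T. compact K \<and> 0 < T \<longrightarrow>
       (\<exists>C. Ld_nonneg d {0..T} C \<and>
          (AE t in lebesgue_on {0..T}. \<forall>z\<in>K. tnorm h z (G z t) \<le> C t)))"

definition weak_holomorphic_vector_field ::
  "('a::topological_space, 'n::finite) chart set \<Rightarrow>
    ('a \<Rightarrow> ('a, 'n) tvector \<Rightarrow> ('a, 'n) tvector \<Rightarrow> complex) \<Rightarrow>
    ('a \<Rightarrow> real \<Rightarrow> ('a, 'n) tvector) \<Rightarrow> bool"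
  where "weak_holomorphic_vector_field A h G \<longleftrightarrow>
    (\<exists>d. weak_holomorphic_vector_field_of_order A h d G)"

definition herglotz_vector_field ::
  "('a::topological_space, 'n::finite) chart set \<Rightarrow>
    ('a \<Rightarrow> ('a, 'n) tvector \<Rightarrow> ('a, 'n) tvector \<Rightarrow> complex) \<Rightarrow>
    ('a \<Rightarrow> real \<Rightarrow> ('a, 'n) tvector) \<Rightarrow> bool"
  where "herglotz_vector_field A h G \<longleftrightarrow>
    weak_holomorphic_vector_field_of_order A h \<infinity> G \<and>
    (AE t in lebesgue_on {0..}. \<forall>z w. z \<noteq> w \<longrightarrow>
       differential2 A (kobayashi_dist A) z w (G z t) (G w t) \<le> 0)"

text \<open>The first two arguments of an evolution family are the times s and t; it is only
  constrained for s between 0 and t.\<close>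

definition evolution_family ::
  "('a::topological_space, 'n::finite) chart set \<Rightarrow>
    ('a \<Rightarrow> ('a, 'n) tvector \<Rightarrow> ('a, 'n) tvector \<Rightarrow> complex) \<Rightarrow>
    (real \<Rightarrow> real \<Rightarrow> 'a \<Rightarrow> 'a) \<Rightarrow> bool"
  where "evolution_family A h \<phi> \<longleftrightarrow>
    (\<forall>s\<ge>0. \<phi> s s = id) \<and>
    (\<forall>s u t. 0 \<le> s \<and> s \<le> u \<and> u \<le> t \<longrightarrow> \<phi> s t = \<phi> u t \<circ> \<phi> s u) \<and>
    (\<forall>s t. 0 \<le> s \<and> s \<le> t \<longrightarrow> holomorphic_self_map A (\<phi> s t)) \<and>
    (\<forall>T K. 0 < T \<and> compact K \<longrightarrow>
       (\<exists>C>0. \<forall>s\<ge>0. \<forall>t\<in>{s..T}. \<forall>t'\<in>{s..T}. \<forall>z\<in>K.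
          hermitian_dist A h (\<phi> s t z) (\<phi> s t' z) \<le> C * \<bar>t - t'\<bar>))"

definition satisfies_loewner_ode ::
  "('a, 'n::finite) chart set \<Rightarrow> (real \<Rightarrow> real \<Rightarrow> 'a \<Rightarrow> 'a) \<Rightarrow>
    ('a \<Rightarrow> real \<Rightarrow> ('a, 'n) tvector) \<Rightarrow> bool"
  where "satisfies_loewner_ode A \<phi> G \<longleftrightarrow>
    (\<forall>s\<ge>0. \<forall>z. AE t in lebesgue_on {s..}.
       has_velocity A (\<lambda>\<tau>. \<phi> s \<tau> z) (G (\<phi> s t z) t) t {s..})"

end

theory Submission
  imports Defs "HOL-Complex_Analysis.Complex_Analysis" "HOL-Real_Asymp.Real_Asymp"
begin

text \<open>The field \<open>G\<close> is forced by the equation: since \<open>\<phi> s (t + \<tau>) = \<phi> t (t + \<tau>) \<circ> \<phi> s t\<close>,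
a trajectory that is differentiable at \<open>t\<close> and sits at \<open>w\<close> at that time has there the velocity
\<open>G w t\<close>, the limit of \<open>(\<phi> t (t + \<tau>) w - w) / \<tau>\<close> as \<open>\<tau>\<close> decreases to 0, computed in a chart. What has to be shown is that for almost
every \<open>t\<close> this limit exists for all \<open>w\<close> at once; a single trajectory only gives it off a null set that
depends on the trajectory, and there are uncountably many of them.

Trajectories are locally Lipschitz in charts, hence almost everywhere differentiable
(\<open>negligible_not_differentiable_of_locally_Lipschitz\<close>, a Vitali covering argument). Call \<open>t\<close> good if all
trajectories that start at a rational time before \<open>t\<close> from a fixed countable dense set are differentiable
at \<open>t\<close>; almost every \<open>t\<close> is good. The positions of these countably many trajectories at time \<open>t\<close> are
still dense, because \<open>\<phi> s t\<close> tends to the identity as \<open>s\<close> increases to \<open>t\<close> (\<open>trajectory_points_dense\<close>). So at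
a good time the difference quotients converge on a dense set. In a chart they are holomorphic and locally
uniformly bounded, the latter by the Lipschitz condition on the family, and Vitali's theorem
(\<open>Vitali_right_limit\<close>) makes them converge everywhere, to a holomorphic limit with the same bound
(\<open>quot_converges\<close>). The field obtained in this way is called \<open>generator\<close>.

The Hermitian distance enters only through \<open>hermitian_dist_controls_chart\<close>: near a point it dominates the
Euclidean distance of a chart, since a curve that leaves a coordinate ball is long and a curve that stays
inside is at least as long as a fixed multiple of its chord.

The Herglotz inequality holds because holomorphic self-maps do not increase the Kobayashi distance
(\<open>kobayashi_dist_contraction\<close>): the distance of \<open>\<phi> t (t + \<tau>) z\<close> and
\<open>\<phi> t (t + \<tau>) w\<close> is largest at \<open>\<tau> = 0\<close>, and its right derivative there is the differential in question. Uniqueness is the density argument once more: at almost every time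
any solution field agrees with \<open>G\<close> at the countably many positions, and both are continuous.\<close>

section \<open>Almost everywhere differentiability of Lipschitz functions\<close>

lemma Vitali_covering_intervals:
  fixes E :: "real set"
  assumes fine: "\<And>x d. x \<in> E \<Longrightarrow> 0 < d \<Longrightarrow> \<exists>y z. y < z \<and> x \<in> {y..z} \<and> z - y < d \<and> P y z"
  obtains C where "countable C" "\<And>y z. (y, z) \<in> C \<Longrightarrow> y < z \<and> P y z"
    "disjoint_family_on (\<lambda>(y, z). {y..z}) C" "negligible (E - (\<Union>(y, z)\<in>C. {y..z}))"
proof -
  define K where "K = {(y, z). y < z \<and> P y z}"
  define mid :: "real \<times> real \<Rightarrow> real" where "mid = (\<lambda>(y, z). (y + z) / 2)"
  define rad :: "real \<times> real \<Rightarrow> real" where "rad = (\<lambda>(y, z). (z - y) / 2)"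
  have cb: "cball (mid i) (rad i) = (case i of (y, z) \<Rightarrow> {y..z})" for i
    by (cases i) (simp add: mid_def rad_def cball_eq_atLeastAtMost field_simps)
  have r: "0 < rad i" if "i \<in> K" for i
    using that by (auto simp: K_def rad_def)
  have S: "\<exists>i. i \<in> K \<and> x \<in> cball (mid i) (rad i) \<and> rad i < d" if "x \<in> E" "0 < d" for x d
  proof -
    from fine[OF that] obtain y z where "y < z \<and> x \<in> {y..z} \<and> z - y < d \<and> P y z"
      by (elim exE) (rule that)
    moreover have "cball (mid (y, z)) (rad (y, z)) = {y..z}" by (simp add: cb)
    ultimately show ?thesis
      using \<open>0 < d\<close> by (intro exI[of _ "(y, z)"]) (simp add: K_def rad_def del: mem_cball)
  qed
  obtain C where C: "countable C" "C \<subseteq> K"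
    "pairwise (\<lambda>i j. disjnt (cball (mid i) (rad i)) (cball (mid j) (rad j))) C"
    "negligible (E - (\<Union>i\<in>C. cball (mid i) (rad i)))"
    by (rule Vitali_covering_theorem_cballs[of K rad E mid]) (use r S in blast)+
  show ?thesis
  proof
    show "disjoint_family_on (\<lambda>(y, z). {y..z}) C"
      using C(3) by (auto simp: disjoint_family_on_def pairwise_def disjnt_def cb)
    show "negligible (E - (\<Union>(y, z)\<in>C. {y..z}))"
      using C(4) unfolding cb .
  qed (use C in \<open>auto simp: K_def\<close>)
qed

lemma emeasure_disjoint_intervals:
  fixes u v :: "real \<times> real \<Rightarrow> real"
  assumes "countable C" "disjoint_family_on (\<lambda>i. {u i..v i}) C" "\<And>i. i \<in> C \<Longrightarrow> u i \<le> v i"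
  shows "emeasure lborel (\<Union>i\<in>C. {u i..v i}) = (\<integral>\<^sup>+i. ennreal (v i - u i) \<partial>count_space C)"
proof -
  have "emeasure lborel (\<Union>i\<in>C. {u i..v i}) = (\<integral>\<^sup>+i. emeasure lborel {u i..v i} \<partial>count_space C)"
    by (rule emeasure_UN_countable) (use assms in auto)
  also have "\<dots> = (\<integral>\<^sup>+i. ennreal (v i - u i) \<partial>count_space C)"
    by (rule nn_integral_cong) (use assms in auto)
  finally show ?thesis .
qed

text \<open>Cover \<open>E\<close> twice: first by disjoint intervals inside \<open>U\<close> on which \<open>g\<close> has slope below \<open>p\<close>, then by disjoint
intervals inside the first ones on which the slope exceeds \<open>q\<close>. The values of \<open>g\<close> on the second family
form disjoint intervals contained in those of the first. This compares \<open>q\<close> times the length of the second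
family with \<open>p\<close> times the length of the first.\<close>

lemma Vitali_slope_step:
  fixes g :: "real \<Rightarrow> real"
  assumes mono: "strict_mono_on {a..b} g" and pq: "0 < p" "p < q"
    and low: "\<And>x d. x \<in> E \<Longrightarrow> 0 < d \<Longrightarrow>
      \<exists>y z. y < z \<and> x \<in> {y..z} \<and> z - y < d \<and> g z - g y < p * (z - y)"
    and up: "\<And>x d. x \<in> E \<Longrightarrow> 0 < d \<Longrightarrow>
      \<exists>y z. y < z \<and> x \<in> {y..z} \<and> z - y < d \<and> q * (z - y) < g z - g y"
    and U: "open U" "E \<subseteq> U" "U \<subseteq> {a<..<b}"
  obtains W where "W \<in> sets borel" "negligible (E - W)"
    "ennreal q * emeasure lborel W \<le> ennreal p * emeasure lborel U"
proof -
  let ?I = "\<lambda>(y, z). {y..z::real}"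
  have small: "\<exists>d>0. \<forall>y z. x \<in> {y..z} \<longrightarrow> z - y < d \<longrightarrow> {y..z} \<subseteq> V" if "open V" "x \<in> V" for x and V :: "real set"
  proof -
    obtain d where d: "d > 0" "ball x d \<subseteq> V"
      using \<open>open V\<close> \<open>x \<in> V\<close> open_contains_ball by blast
    have "{y..z} \<subseteq> ball x d" if "x \<in> {y..z}" "z - y < d" for y z
      using that by (auto simp: dist_real_def)
    with d show ?thesis by blast
  qed
  obtain C where C: "countable C"
    "\<And>y z. (y, z) \<in> C \<Longrightarrow> y < z \<and> {y..z} \<subseteq> U \<and> g z - g y < p * (z - y)"
    "disjoint_family_on ?I C" "negligible (E - (\<Union>(y, z)\<in>C. {y..z}))"
  proof (rule Vitali_covering_intervals[of E "\<lambda>y z. {y..z} \<subseteq> U \<and> g z - g y < p * (z - y)"])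
    fix x d :: real assume "x \<in> E" "0 < d"
    obtain d' where d': "d' > 0" "\<And>y z. x \<in> {y..z} \<Longrightarrow> z - y < d' \<Longrightarrow> {y..z} \<subseteq> U"
      using small[of U x] U \<open>x \<in> E\<close> by blast
    obtain y z where "y < z \<and> x \<in> {y..z} \<and> z - y < min d d' \<and> g z - g y < p * (z - y)"
      using low[OF \<open>x \<in> E\<close>, of "min d d'"] \<open>0 < d\<close> d'(1) by (metis (no_types, lifting) min_less_iff_conj)
    moreover from this have "{y..z} \<subseteq> U" using d'(2)[of y z] by linarith
    ultimately show "\<exists>y z. y < z \<and> x \<in> {y..z} \<and> z - y < d \<and> {y..z} \<subseteq> U \<and> g z - g y < p * (z - y)"
      by (intro exI[of _ y] exI[of _ z]) linarith
  qed (rule that)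
  define E' where "E' = E \<inter> (\<Union>(y, z)\<in>C. {y<..<z})"
  obtain D where D: "countable D"
    "\<And>y z. (y, z) \<in> D \<Longrightarrow> y < z \<and> (\<exists>(y', z')\<in>C. {y..z} \<subseteq> {y'..z'}) \<and> q * (z - y) < g z - g y"
    "disjoint_family_on ?I D" "negligible (E' - (\<Union>(y, z)\<in>D. {y..z}))"
  proof (rule Vitali_covering_intervals[of E' "\<lambda>y z. (\<exists>(y', z')\<in>C. {y..z} \<subseteq> {y'..z'}) \<and> q * (z - y) < g z - g y"])
    fix x d :: real assume "x \<in> E'" "0 < d"
    then obtain y' z' where yz': "(y', z') \<in> C" "x \<in> {y'<..<z'}" and "x \<in> E"
      unfolding E'_def by auto
    obtain d' where d'0: "d' > 0 \<and> (\<forall>y z. x \<in> {y..z} \<longrightarrow> z - y < d' \<longrightarrow> {y..z} \<subseteq> {y'<..<z'})"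
      using small[OF open_greaterThanLessThan yz'(2)] by (elim exE) (rule that)
    then have d': "d' > 0" "\<And>y z. x \<in> {y..z} \<Longrightarrow> z - y < d' \<Longrightarrow> {y..z} \<subseteq> {y'<..<z'}"
      by simp_all
    obtain y z where yz: "y < z \<and> x \<in> {y..z} \<and> z - y < min d d' \<and> q * (z - y) < g z - g y"
      using up[OF \<open>x \<in> E\<close>, of "min d d'"] \<open>0 < d\<close> d'(1) by (metis (no_types, lifting) min_less_iff_conj)
    then have "{y..z} \<subseteq> {y'<..<z'}"
      using d'(2)[of y z] by linarith
    then have "{y..z} \<subseteq> {y'..z'}"
      by (rule order_trans) auto
    then have "\<exists>(y', z')\<in>C. {y..z} \<subseteq> {y'..z'}" using yz' by blast
    with yz show "\<exists>y z. y < z \<and> x \<in> {y..z} \<and> z - y < d \<and> (\<exists>(y', z')\<in>C. {y..z} \<subseteq> {y'..z'}) \<and> q * (z - y) < g z - g y"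
      by (intro exI[of _ y] exI[of _ z]) linarith
  qed (rule that)
  let ?W = "\<Union>i\<in>D. {fst i..snd i}"
  let ?V = "\<Union>i\<in>C. {fst i..snd i}"
  have W_eq: "(\<Union>(y, z)\<in>D. {y..z}) = ?W" and V_eq: "(\<Union>(y, z)\<in>C. {y..z}) = ?V"
    by (auto simp: case_prod_unfold)
  have subab: "{y..z} \<subseteq> {a..b}" if "(y, z) \<in> C" for y z
    using C(2)[OF that] U by (meson greaterThanLessThan_subseteq_atLeastAtMost_iff order.refl order.trans)
  have g_le: "g s \<le> g t" if "s \<in> {a..b}" "t \<in> {a..b}" "s \<le> t" for s t
    using mono that by (metis order_le_less strict_mono_onD)
  have Dab: "fst i \<in> {a..b}" "snd i \<in> {a..b}" "fst i < snd i" if iD: "i \<in> D" for i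
  proof -
    obtain y z where i: "i = (y, z)" by (cases i)
    obtain y' z' where "(y', z') \<in> C" "{y..z} \<subseteq> {y'..z'}" "y < z"
      using D(2)[of y z] iD i by blast
    then have "{y..z} \<subseteq> {a..b}" "y < z" using subab by blast+
    then show "fst i \<in> {a..b}" "snd i \<in> {a..b}" "fst i < snd i"
      using i by auto
  qed
  have Cab: "fst i \<in> {a..b}" "snd i \<in> {a..b}" "fst i < snd i" if "i \<in> C" for i
    using subab[of "fst i" "snd i"] C(2)[of "fst i" "snd i"] that by auto
  have disjg: "disjoint_family_on (\<lambda>i. {g (fst i)..g (snd i)}) F"
    if "disjoint_family_on ?I F"
      and Fab: "\<And>i. i \<in> F \<Longrightarrow> fst i \<in> {a..b} \<and> snd i \<in> {a..b} \<and> fst i < snd i" for F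
    unfolding disjoint_family_on_def
  proof (intro ballI impI)
    fix i j assume ij: "i \<in> F" "j \<in> F" "i \<noteq> j"
    then have "{fst i..snd i} \<inter> {fst j..snd j} = {}"
      using that(1) by (auto simp: disjoint_family_on_def case_prod_unfold)
    then have "snd i < fst j \<or> snd j < fst i"
      using Fab[OF ij(1)] Fab[OF ij(2)] by fastforce
    then show "{g (fst i)..g (snd i)} \<inter> {g (fst j)..g (snd j)} = {}"
      using strict_mono_onD[OF mono, of "snd i" "fst j"] strict_mono_onD[OF mono, of "snd j" "fst i"]
        Fab[OF ij(1)] Fab[OF ij(2)] by auto
  qed
  have gD: "g (fst i) \<le> g (snd i)" if "i \<in> D" for i
    using g_le Dab[OF that] by simp
  have gC: "g (fst i) \<le> g (snd i)" if "i \<in> C" for i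
    using g_le Cab[OF that] by simp
  have disjgD: "disjoint_family_on (\<lambda>i. {g (fst i)..g (snd i)}) D"
    by (rule disjg[OF D(3)]) (use Dab in blast)
  have disjgC: "disjoint_family_on (\<lambda>i. {g (fst i)..g (snd i)}) C"
    by (rule disjg[OF C(3)]) (use Cab in blast)
  have dC: "disjoint_family_on (\<lambda>i. {fst i..snd i}) C" and dD: "disjoint_family_on (\<lambda>i. {fst i..snd i}) D"
    using C(3) D(3) by (simp_all add: case_prod_unfold)
  have "ennreal q * emeasure lborel ?W = ennreal q * (\<integral>\<^sup>+i. ennreal (snd i - fst i) \<partial>count_space D)"
    using emeasure_disjoint_intervals[OF D(1) dD] Dab(3) by (simp add: less_imp_le)
  also have "\<dots> = (\<integral>\<^sup>+i. ennreal q * ennreal (snd i - fst i) \<partial>count_space D)"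
    by (simp add: nn_integral_cmult)
  also have "\<dots> \<le> (\<integral>\<^sup>+i. ennreal (g (snd i) - g (fst i)) \<partial>count_space D)"
  proof (rule nn_integral_mono)
    fix i assume "i \<in> space (count_space D)"
    then have "i \<in> D" by simp
    then show "ennreal q * ennreal (snd i - fst i) \<le> ennreal (g (snd i) - g (fst i))"
      using D(2)[of "fst i" "snd i"] pq by (auto simp flip: ennreal_mult intro!: ennreal_leI)
  qed
  also have "\<dots> = emeasure lborel (\<Union>i\<in>D. {g (fst i)..g (snd i)})"
    by (rule emeasure_disjoint_intervals[OF D(1) disjgD gD, symmetric])
  also have "\<dots> \<le> emeasure lborel (\<Union>i\<in>C. {g (fst i)..g (snd i)})"
  proof (rule emeasure_mono)
    show "(\<Union>i\<in>D. {g (fst i)..g (snd i)}) \<subseteq> (\<Union>i\<in>C. {g (fst i)..g (snd i)})"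
    proof (rule UN_least)
      fix i assume i: "i \<in> D"
      obtain y' z' where yz': "(y', z') \<in> C" "{fst i..snd i} \<subseteq> {y'..z'}"
        using D(2)[of "fst i" "snd i"] i unfolding prod.collapse by blast
      have "y' < z'" using C(2) yz' by blast
      have "y' \<le> fst i" "snd i \<le> z'" using yz'(2) Dab(3)[OF i] by auto
      moreover have "y' \<in> {a..b}" "z' \<in> {a..b}" using subab[OF yz'(1)] \<open>y' < z'\<close> by auto
      ultimately have "g y' \<le> g (fst i)" "g (snd i) \<le> g z'"
        using g_le Dab[OF i] by blast+
      then show "{g (fst i)..g (snd i)} \<subseteq> (\<Union>i\<in>C. {g (fst i)..g (snd i)})"
        by (intro order_trans[OF _ UN_upper[OF yz'(1)]]) simp
    qed
    show "(\<Union>i\<in>C. {g (fst i)..g (snd i)}) \<in> sets lborel"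
      by (rule sets.countable_UN'[OF C(1)]) auto
  qed
  also have "\<dots> = (\<integral>\<^sup>+i. ennreal (g (snd i) - g (fst i)) \<partial>count_space C)"
    by (rule emeasure_disjoint_intervals[OF C(1) disjgC gC])
  also have "\<dots> \<le> (\<integral>\<^sup>+i. ennreal p * ennreal (snd i - fst i) \<partial>count_space C)"
  proof (rule nn_integral_mono)
    fix i assume "i \<in> space (count_space C)"
    then have i: "(fst i, snd i) \<in> C" by simp
    then show "ennreal (g (snd i) - g (fst i)) \<le> ennreal p * ennreal (snd i - fst i)"
      using C(2)[OF i] pq by (auto simp flip: ennreal_mult intro!: ennreal_leI)
  qed
  also have "\<dots> = ennreal p * (\<integral>\<^sup>+i. ennreal (snd i - fst i) \<partial>count_space C)"
    by (simp add: nn_integral_cmult)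
  also have "\<dots> = ennreal p * emeasure lborel ?V"
    using emeasure_disjoint_intervals[OF C(1) dC] Cab(3) by (simp add: less_imp_le)
  also have "\<dots> \<le> ennreal p * emeasure lborel U"
  proof (intro mult_left_mono emeasure_mono)
    show "?V \<subseteq> U"
      by (rule UN_least) (use C(2)[of "fst i" "snd i" for i] in \<open>unfold prod.collapse, blast\<close>)
  qed (use U(1) in auto)
  finally have le: "ennreal q * emeasure lborel ?W \<le> ennreal p * emeasure lborel U" .
  have "E - ?W \<subseteq> (E - ?V) \<union> (fst ` C \<union> snd ` C) \<union> (E' - ?W)"
  proof
    fix x assume x: "x \<in> E - ?W"
    show "x \<in> (E - ?V) \<union> (fst ` C \<union> snd ` C) \<union> (E' - ?W)"
    proof (cases "x \<in> ?V")
      case True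
      then obtain i where "i \<in> C" "fst i \<le> x" "x \<le> snd i" by auto
      then have "x \<in> fst ` C \<union> snd ` C \<or> x \<in> (\<Union>(y, z)\<in>C. {y<..<z})"
        by (cases "x = fst i \<or> x = snd i") (auto simp: case_prod_unfold intro!: bexI[of _ i])
      with x show ?thesis unfolding E'_def by blast
    qed (use x in blast)
  qed
  moreover have "negligible \<dots>"
  proof (intro negligible_Un)
    show "negligible (E - ?V)" "negligible (E' - ?W)" using C(4) D(4) unfolding W_eq V_eq .
    show "negligible (fst ` C)" "negligible (snd ` C)"
      using C(1) by (simp_all add: negligible_iff_null_sets null_sets_completionI countable_imp_null_set_lborel)
  qed
  ultimately have negW: "negligible (E - ?W)" by (rule negligible_subset[rotated])
  have borW: "?W \<in> sets borel"
    by (rule sets.countable_UN'[OF D(1)]) auto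
  show ?thesis by (rule that[OF borW negW le])
qed

text \<open>The step above turns a cover of \<open>E\<close> of measure \<open>u\<close> into one of measure at most \<open>(p / q) u\<close>, so the outer
measure \<open>m\<close> of \<open>E\<close> satisfies \<open>q m \<le> p m\<close> and vanishes. The outer measure is taken as an infimum over measurable
supersets, so that measurability of \<open>E\<close> need not be discussed.\<close>

lemma negligible_slope_gap:
  fixes g :: "real \<Rightarrow> real"
  assumes mono: "strict_mono_on {a..b} g" and pq: "0 < p" "p < q" and E: "E \<subseteq> {a<..<b}"
    and low: "\<And>x d. x \<in> E \<Longrightarrow> 0 < d \<Longrightarrow>
      \<exists>y z. y < z \<and> x \<in> {y..z} \<and> z - y < d \<and> g z - g y < p * (z - y)"
    and up: "\<And>x d. x \<in> E \<Longrightarrow> 0 < d \<Longrightarrow>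
      \<exists>y z. y < z \<and> x \<in> {y..z} \<and> z - y < d \<and> q * (z - y) < g z - g y"
  shows "negligible E"
proof -
  define Ms where "Ms = {measure lebesgue T | T. E \<subseteq> T \<and> T \<in> lmeasurable}"
  define m where "m = Inf Ms"
  have bdd: "bdd_below Ms" by (rule bdd_belowI[of _ 0]) (auto simp: Ms_def)
  have ne: "Ms \<noteq> {}" using E by (auto simp: Ms_def intro!: exI[of _ "{a<..<b}"])
  have key: "q * m \<le> p * (m + e)" if "e > 0" for e
  proof -
    obtain T where T: "E \<subseteq> T" "T \<in> lmeasurable" "measure lebesgue T < m + e / 2"
      using cInf_lessD[OF ne, of "m + e/2"] \<open>e > 0\<close> by (auto simp: m_def Ms_def)
    obtain V where V: "open V" "T \<subseteq> V" "V - T \<in> lmeasurable" "emeasure lebesgue (V - T) < ennreal (e / 2)"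
      using sets_lebesgue_outer_open[of T "e/2"] T(2) \<open>e > 0\<close> by auto
    have VT: "V = T \<union> (V - T)" using V by blast
    have Vl: "V \<in> lmeasurable" using T V by (subst VT) (rule fmeasurable.Un)
    have "measure lebesgue V \<le> measure lebesgue T + measure lebesgue (V - T)"
      using T V by (subst VT) (intro measure_Un_le, auto)
    moreover have "measure lebesgue (V - T) < e / 2"
      using V(3,4) \<open>e > 0\<close> by (simp add: emeasure_eq_measure2 ennreal_less_iff)
    ultimately have mV: "measure lebesgue V < m + e" using T by linarith
    define U where "U = V \<inter> {a<..<b}"
    have U: "open U" "E \<subseteq> U" "U \<subseteq> {a<..<b}" using V T E by (auto simp: U_def)
    have Ul: "U \<in> lmeasurable" using Vl by (auto simp: U_def intro!: fmeasurable.Int)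
    have "measure lebesgue U \<le> measure lebesgue V"
      using Vl Ul by (intro measure_mono_fmeasurable) (auto simp: U_def)
    then have mU: "measure lebesgue U < m + e" using mV by linarith
    obtain W where W: "W \<in> sets borel" "negligible (E - W)"
      "ennreal q * emeasure lborel W \<le> ennreal p * emeasure lborel U"
      using Vitali_slope_step[OF mono pq low up U] by blast
    have eU: "emeasure lborel U = ennreal (measure lebesgue U)"
      using Ul U(1) by (subst emeasure_eq_measure2[symmetric]) auto
    have "ennreal p * emeasure lborel U < top" unfolding eU by (simp add: ennreal_mult_less_top)
    then have "ennreal q * emeasure lborel W < top" using W(3) by (rule order_le_less_trans[rotated])
    then have fin: "emeasure lborel W < top" using pq by (auto simp: ennreal_mult_less_top)
    have eWl: "emeasure lebesgue W = emeasure lborel W" using W(1) by simp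
    have Wl: "W \<in> lmeasurable" by (rule fmeasurableI) (use W(1) fin eWl in auto)
    have eW: "emeasure lborel W = ennreal (measure lebesgue W)"
      using emeasure_eq_measure2[OF Wl] eWl by simp
    have "ennreal (q * measure lebesgue W) \<le> ennreal (p * measure lebesgue U)"
      using W(3) pq unfolding eU eW by (simp add: ennreal_mult)
    then have le: "q * measure lebesgue W \<le> p * measure lebesgue U"
      using pq by (simp add: ennreal_le_iff)
    have N: "E - W \<in> lmeasurable" "E - W \<in> null_sets lebesgue"
      using W(2) by (simp_all add: negligible_iff_measure flip: negligible_iff_null_sets)
    have "W \<union> (E - W) \<in> lmeasurable" using Wl N(1) by (rule fmeasurable.Un)
    moreover have "measure lebesgue (W \<union> (E - W)) = measure lebesgue W"
      using fmeasurableD[OF Wl] N(2) by (rule measure_Un_null_set)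
    moreover have "E \<subseteq> W \<union> (E - W)" by blast
    ultimately have "measure lebesgue W \<in> Ms" unfolding Ms_def mem_Collect_eq
      by (intro exI[of _ "W \<union> (E - W)"] conjI) simp_all
    then have "m \<le> measure lebesgue W"
      unfolding m_def by (intro cInf_lower bdd)
    then have "q * m \<le> q * measure lebesgue W" using pq by simp
    also note le
    also have "p * measure lebesgue U \<le> p * (m + e)" using mU pq by simp
    finally show ?thesis .
  qed
  have "m \<le> 0"
  proof (rule ccontr)
    assume "\<not> m \<le> 0"
    then have e: "0 < (q - p) * m / (2 * p)" using pq by simp
    show False using key[OF e] pq \<open>\<not> m \<le> 0\<close> by (simp add: field_simps)
  qed
  show ?thesis
    unfolding negligible_outer
  proof (intro allI impI)
    fix e :: real assume "0 < e"
    then show "\<exists>T. E \<subseteq> T \<and> T \<in> lmeasurable \<and> measure lebesgue T < e"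
      using cInf_lessD[OF ne, of e] \<open>m \<le> 0\<close> by (auto simp: m_def Ms_def)
  qed
qed


lemma not_convergent_imp_oscillation:
  fixes s :: "'a \<Rightarrow> real"
  assumes F: "F \<noteq> bot" and bdd: "eventually (\<lambda>x. \<bar>s x\<bar> \<le> B) F"
    and div: "\<not> (\<exists>l. (s \<longlongrightarrow> l) F)"
  shows "\<exists>p q. p \<in> \<rat> \<and> q \<in> \<rat> \<and> p < q \<and> frequently (\<lambda>x. s x < p) F \<and> frequently (\<lambda>x. q < s x) F"
proof -
  let ?l = "Liminf F (\<lambda>x. ereal (s x))" and ?u = "Limsup F (\<lambda>x. ereal (s x))"
  have "ereal (- B) \<le> ?l"
    by (rule Liminf_bounded) (use bdd in \<open>auto elim!: eventually_mono\<close>)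
  moreover have "?u \<le> ereal B"
    by (rule Limsup_bounded) (use bdd in \<open>auto elim!: eventually_mono\<close>)
  moreover have lu: "?l \<le> ?u" by (rule Liminf_le_Limsup[OF F])
  ultimately have fin: "\<bar>?l\<bar> \<noteq> \<infinity>" "\<bar>?u\<bar> \<noteq> \<infinity>" by auto
  have "?l \<noteq> ?u"
  proof
    assume "?l = ?u"
    then have "((\<lambda>x. ereal (s x)) \<longlongrightarrow> ?l) F"
      by (simp add: tendsto_iff_Liminf_eq_Limsup[OF F])
    then have "((\<lambda>x. ereal (s x)) \<longlongrightarrow> ereal (real_of_ereal ?l)) F"
      using fin by (simp add: ereal_real)
    then show False using div by (simp add: lim_ereal)
  qed
  then have "real_of_ereal ?l < real_of_ereal ?u"
    using lu fin by (cases ?l; cases ?u) auto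
  then obtain q where q: "q \<in> \<rat>" "real_of_ereal ?l < q" "q < real_of_ereal ?u"
    using Rats_dense_in_real by blast
  then obtain p where p: "p \<in> \<rat>" "real_of_ereal ?l < p" "p < q"
    using Rats_dense_in_real by blast
  have "?l < ereal p" "ereal q < ?u" using p q fin by (cases ?l; cases ?u; auto)+
  moreover have "ereal p \<le> ?l" if "\<not> frequently (\<lambda>x. s x < p) F"
    by (rule Liminf_bounded) (use that in \<open>auto simp: frequently_def not_less\<close>)
  moreover have "?u \<le> ereal q" if "\<not> frequently (\<lambda>x. q < s x) F"
    by (rule Limsup_bounded) (use that in \<open>auto simp: frequently_def not_less\<close>)
  ultimately show ?thesis using p q by (meson leD)
qed

lemma negligible_countable_UN:
  assumes "countable I" "\<And>i. i \<in> I \<Longrightarrow> negligible (S i)"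
  shows "negligible (\<Union>i\<in>I. S i)"
  using assms by (intro negligible_countable_Union) auto

text \<open>Adding a steep linear function makes \<open>f\<close> strictly increasing with slopes between 1 and a constant. If the
slopes at \<open>x\<close> do not converge, they oscillate across a gap between two positive rationals, and there are
only countably many such gaps.\<close>

lemma Lipschitz_real_differentiable_off_negligible:
  fixes f :: "real \<Rightarrow> real"
  assumes lip: "\<And>x y. x \<in> {a..b} \<Longrightarrow> y \<in> {a..b} \<Longrightarrow> \<bar>f x - f y\<bar> \<le> L * \<bar>x - y\<bar>"
  shows "negligible {x \<in> {a<..<b}. \<not> f differentiable (at x)}"
proof -
  \<comment> \<open>With this slope added, all difference quotients lie between 1 and \<open>2 * M\<close>.\<close>
  define M where "M = \<bar>L\<bar> + 1"
  define g where "g = (\<lambda>x. f x + M * x)"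
  have lip': "\<bar>f x - f y\<bar> \<le> (M - 1) * \<bar>x - y\<bar>" if "x \<in> {a..b}" "y \<in> {a..b}" for x y
    using lip[OF that] by (rule order_trans) (simp add: M_def mult_right_mono)
  have glow: "y - x \<le> g y - g x" if "x \<in> {a..b}" "y \<in> {a..b}" "x \<le> y" for x y
    using lip'[OF that(1,2)] that(3) by (simp add: g_def algebra_simps abs_if split: if_splits)
  have gup: "g y - g x \<le> 2 * M * (y - x)" if "x \<in> {a..b}" "y \<in> {a..b}" "x \<le> y" for x y
    using lip'[OF that(1,2)] that(3) by (simp add: g_def algebra_simps abs_if split: if_splits)
  have mono: "strict_mono_on {a..b} g"
  proof (rule strict_mono_onI)
    fix x y assume "x \<in> {a..b}" "y \<in> {a..b}" "x < y"
    then show "g x < g y" using glow[of x y] by simp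
  qed
  define E where "E = (\<lambda>(p, q). {x \<in> {a<..<b}.
      (\<forall>d>0. \<exists>y z. y < z \<and> x \<in> {y..z} \<and> z - y < d \<and> g z - g y < p * (z - y)) \<and>
      (\<forall>d>0. \<exists>y z. y < z \<and> x \<in> {y..z} \<and> z - y < d \<and> q * (z - y) < g z - g y)})"
  have E: "negligible (E (p, q))" if "0 < p" "p < q" for p q
    by (rule negligible_slope_gap[OF mono that]) (auto simp: E_def)
  define Q where "Q = {(p, q). p \<in> \<rat> \<and> q \<in> \<rat> \<and> 0 < p \<and> p < (q::real)}"
  have "countable Q"
    by (rule countable_subset[of _ "\<rat> \<times> \<rat>"]) (auto simp: Q_def countable_rat)
  then have neg: "negligible (\<Union>i\<in>Q. E i)"
    by (rule negligible_countable_UN) (use E in \<open>auto simp: Q_def\<close>)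
  have sub: "x \<in> (\<Union>i\<in>Q. E i)" if x: "x \<in> {a<..<b}" and nd: "\<not> f differentiable (at x)" for x
  proof -
    define s where "s = (\<lambda>h. (g (x + h) - g x) / h)"
    have near: "eventually (\<lambda>h. h \<noteq> 0 \<and> x + h \<in> {a<..<b} \<and> \<bar>h\<bar> < d) (at 0)" if "d > 0" for d
    proof -
      have "eventually (\<lambda>h. dist h 0 < Min {x - a, b - x, d}) (at (0::real))"
        using x that by (subst eventually_at) (auto intro!: exI[of _ "Min {x - a, b - x, d}"])
      moreover have "eventually (\<lambda>h::real. h \<noteq> 0) (at 0)" by (simp add: eventually_at_filter)
      ultimately show ?thesis by eventually_elim auto
    qed
    have s_bounds: "1 \<le> s h" "s h \<le> 2 * M" if "h \<noteq> 0" "x + h \<in> {a<..<b}" for h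
    proof -
      have "1 \<le> s h \<and> s h \<le> 2 * M"
      proof (cases "h > 0")
        case True
        then show ?thesis using glow[of x "x + h"] gup[of x "x + h"] x that
          by (auto simp: s_def field_simps)
      next
        case False
        then show ?thesis using glow[of "x + h" x] gup[of "x + h" x] x that
          by (auto simp: s_def field_simps)
      qed
      then show "1 \<le> s h" "s h \<le> 2 * M" by auto
    qed
    have ndiv: "\<not> (\<exists>l. (s \<longlongrightarrow> l) (at 0))"
    proof
      assume "\<exists>l. (s \<longlongrightarrow> l) (at 0)"
      then obtain l where "(g has_field_derivative l) (at x)"
        by (auto simp: s_def DERIV_def)
      then have "((\<lambda>x. g x - M * x) has_field_derivative (l - M)) (at x)"
        by (auto intro!: derivative_eq_intros)
      then have "(f has_field_derivative (l - M)) (at x)" by (simp add: g_def)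
      then show False using nd real_differentiable_def by blast
    qed
    have bd: "eventually (\<lambda>h. \<bar>s h\<bar> \<le> 2 * M) (at 0)"
      using near[OF zero_less_one]
    proof (rule eventually_mono)
      fix h assume "h \<noteq> 0 \<and> x + h \<in> {a<..<b} \<and> \<bar>h\<bar> < 1"
      then show "\<bar>s h\<bar> \<le> 2 * M" using s_bounds[of h] by linarith
    qed
    obtain p q where pq: "p \<in> \<rat>" "q \<in> \<rat>" "p < q"
      and fp: "frequently (\<lambda>h. s h < p) (at 0)" and fq: "frequently (\<lambda>h. q < s h) (at 0)"
      using not_convergent_imp_oscillation[OF at_neq_bot bd ndiv] by blast
    have ex: "\<exists>h. h \<noteq> 0 \<and> x + h \<in> {a<..<b} \<and> \<bar>h\<bar> < d \<and> P h" if "frequently P (at 0)" "d > 0" for P d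
      using frequently_eventually_frequently[OF that(1) near[OF that(2)]] by (auto dest!: frequently_ex)
    obtain h0 where "h0 \<noteq> 0" "x + h0 \<in> {a<..<b}" "s h0 < p" using ex[OF fp, of 1] by auto
    then have p0: "0 < p" using s_bounds(1)[of h0] by linarith
    have "\<exists>y z. y < z \<and> x \<in> {y..z} \<and> z - y < d \<and> g z - g y < p * (z - y)" if d: "d > 0" for d
    proof -
      obtain h where h: "h \<noteq> 0" "\<bar>h\<bar> < d" "s h < p" using ex[OF fp d] by auto
      show ?thesis
      proof (cases "h > 0")
        case True
        with h show ?thesis by (intro exI[of _ x] exI[of _ "x + h"]) (auto simp: s_def field_simps)
      next
        case False
        with h show ?thesis by (intro exI[of _ "x + h"] exI[of _ x]) (auto simp: s_def field_simps)
      qed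
    qed
    moreover have "\<exists>y z. y < z \<and> x \<in> {y..z} \<and> z - y < d \<and> q * (z - y) < g z - g y" if d: "d > 0" for d
    proof -
      obtain h where h: "h \<noteq> 0" "\<bar>h\<bar> < d" "q < s h" using ex[OF fq d] by auto
      show ?thesis
      proof (cases "h > 0")
        case True
        with h show ?thesis by (intro exI[of _ x] exI[of _ "x + h"]) (auto simp: s_def field_simps)
      next
        case False
        with h show ?thesis by (intro exI[of _ "x + h"] exI[of _ x]) (auto simp: s_def field_simps)
      qed
    qed
    ultimately have "x \<in> E (p, q)" using x by (auto simp: E_def)
    moreover have "(p, q) \<in> Q" using pq p0 by (auto simp: Q_def)
    ultimately show ?thesis by blast
  qed
  show ?thesis by (rule negligible_subset[OF neg]) (use sub in blast)
qed

definition locally_Lipschitz_at :: "(real \<Rightarrow> 'b::real_normed_vector) \<Rightarrow> real \<Rightarrow> bool"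
  where "locally_Lipschitz_at f t \<longleftrightarrow>
    (\<exists>d>0. \<exists>L. \<forall>x\<in>{t - d..t + d}. \<forall>y\<in>{t - d..t + d}. norm (f x - f y) \<le> L * \<bar>x - y\<bar>)"

text \<open>Countably many intervals with rational endpoints and finitely many coordinates reduce the claim to real
Lipschitz functions on a compact interval.\<close>

proposition negligible_not_differentiable_of_locally_Lipschitz:
  fixes f :: "real \<Rightarrow> 'b::euclidean_space"
  shows "negligible {t. locally_Lipschitz_at f t \<and> \<not> f differentiable (at t)}"
proof -
  define Q where "Q = {(a, b). a \<in> \<rat> \<and> b \<in> \<rat> \<and> (\<exists>L. \<forall>x\<in>{a..b::real}. \<forall>y\<in>{a..b}. norm (f x - f y) \<le> L * \<bar>x - y\<bar>)}"
  define N where "N = (\<lambda>((a, b), i). {x \<in> {a<..<b}. \<not> (\<lambda>t. f t \<bullet> i) differentiable (at x)})"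
  have "countable Q"
    by (rule countable_subset[of _ "\<rat> \<times> \<rat>"]) (auto simp: Q_def countable_rat)
  then have "countable (Q \<times> (Basis :: 'b set))" by (simp add: countable_finite)
  then have neg: "negligible (\<Union>j\<in>Q \<times> Basis. N j)"
  proof (rule negligible_countable_UN)
    fix j assume "j \<in> Q \<times> (Basis :: 'b set)"
    then obtain a b i L where j: "j = ((a, b), i)" and i: "i \<in> Basis"
      and L: "\<forall>x\<in>{a..b}. \<forall>y\<in>{a..b}. norm (f x - f y) \<le> L * \<bar>x - y\<bar>"
      by (auto simp: Q_def)
    have "\<bar>f x \<bullet> i - f y \<bullet> i\<bar> \<le> L * \<bar>x - y\<bar>" if "x \<in> {a..b}" "y \<in> {a..b}" for x y
      using L that Basis_le_norm[OF i, of "f x - f y"] by (fastforce simp: inner_diff_left)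
    then show "negligible (N j)"
      unfolding N_def j prod.case by (rule Lipschitz_real_differentiable_off_negligible)
  qed
  show ?thesis
  proof (rule negligible_subset[OF neg], clarify)
    fix t assume "locally_Lipschitz_at f t" and nd: "\<not> f differentiable (at t)"
    then obtain d L where d: "d > 0"
      and L: "\<forall>x\<in>{t - d..t + d}. \<forall>y\<in>{t - d..t + d}. norm (f x - f y) \<le> L * \<bar>x - y\<bar>"
      by (auto simp: locally_Lipschitz_at_def)
    obtain a where a: "a \<in> \<rat>" "t - d < a" "a < t" using Rats_dense_in_real[of "t - d" t] d by auto
    obtain b where b: "b \<in> \<rat>" "t < b" "b < t + d" using Rats_dense_in_real[of t "t + d"] d by auto
    have "(a, b) \<in> Q" unfolding Q_def using a b L by (fastforce intro!: exI[of _ L])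
    moreover obtain i where "i \<in> Basis" "\<not> (\<lambda>t. f t \<bullet> i) differentiable (at t)"
      using nd differentiable_componentwise_within[of f t UNIV] by auto
    ultimately show "t \<in> (\<Union>j\<in>Q \<times> Basis. N j)"
      using a b unfolding N_def by (intro UN_I[of "((a, b), i)"]) auto
  qed
qed


section \<open>Holomorphic maps between complex coordinate spaces\<close>

lemma norm_vector_scalar_mult: "norm (a *s v) = cmod a * norm v" for v :: "(complex, 'n::finite) vec"
  by (simp add: norm_vec_def norm_mult L2_set_right_distrib)

lemma scaleR_eq_vector_scalar_mult: "r *\<^sub>R v = complex_of_real r *s v" for v :: "(complex, 'n::finite) vec"
  unfolding vec_eq_iff vector_scaleR_component vector_smult_component
  by (simp only: scaleR_conv_of_real) simp

lemma bounded_linear_vector_scalar_mult_left: "bounded_linear (\<lambda>a. a *s v)" for v :: "(complex, 'n::finite) vec"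
  unfolding linear_conv_bounded_linear[symmetric]
  by (rule linearI) (simp_all add: vec_eq_iff algebra_simps)

lemma norm_vec_le_card_mult:
  fixes x :: "(complex, 'n::finite) vec"
  assumes "\<And>i. cmod (x $ i) \<le> B"
  shows "norm x \<le> real CARD('n) * B"
proof -
  have "norm x \<le> (\<Sum>i\<in>UNIV. cmod (x $ i))"
    unfolding norm_vec_def by (rule L2_set_le_sum) simp
  also have "\<dots> \<le> real CARD('n) * B"
    using sum_bounded_above[of UNIV "\<lambda>i. cmod (x $ i)" B] assms by simp
  finally show ?thesis .
qed

lemma holomorphic_vec_onE:
  assumes "holomorphic_vec_on f S" "x \<in> S"
  obtains D where "(f has_derivative D) (at x)" "\<And>a v. D (a *s v) = a *s D v"
  using assms unfolding holomorphic_vec_on_def by blast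

lemma holomorphic_vec_on_subset: "holomorphic_vec_on f S \<Longrightarrow> T \<subseteq> S \<Longrightarrow> holomorphic_vec_on f T"
  unfolding holomorphic_vec_on_def by blast

lemma holomorphic_vec_on_cong_open:
  assumes "holomorphic_vec_on f S" "open S" "\<And>x. x \<in> S \<Longrightarrow> f x = g x"
  shows "holomorphic_vec_on g S"
  unfolding holomorphic_vec_on_def
proof
  fix x assume x: "x \<in> S"
  obtain D where "(f has_derivative D) (at x)" "\<And>a v. D (a *s v) = a *s D v"
    using holomorphic_vec_onE[OF assms(1) x] by blast
  then show "\<exists>D. (g has_derivative D) (at x) \<and> (\<forall>a v. D (a *s v) = a *s D v)"
    using has_derivative_transform_within_open[of f D x UNIV S g] assms(2,3) x by blast
qed

lemma holomorphic_vec_on_imp_continuous_on: "holomorphic_vec_on f S \<Longrightarrow> continuous_on S f"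
  unfolding holomorphic_vec_on_def
  by (meson continuous_at_imp_continuous_on has_derivative_continuous)

lemma holomorphic_vec_on_compose:
  assumes "holomorphic_vec_on f S" "holomorphic_vec_on g T" "\<And>x. x \<in> S \<Longrightarrow> f x \<in> T"
  shows "holomorphic_vec_on (\<lambda>x. g (f x)) S"
  unfolding holomorphic_vec_on_def
proof
  fix x assume x: "x \<in> S"
  obtain D where D: "(f has_derivative D) (at x)" "\<And>a v. D (a *s v) = a *s D v"
    using holomorphic_vec_onE[OF assms(1) x] by blast
  obtain D' where D': "(g has_derivative D') (at (f x))" "\<And>a v. D' (a *s v) = a *s D' v"
    using holomorphic_vec_onE[OF assms(2) assms(3)[OF x]] by blast
  show "\<exists>D. ((\<lambda>x. g (f x)) has_derivative D) (at x) \<and> (\<forall>a v. D (a *s v) = a *s D v)"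
    using has_derivative_compose[OF D(1) D'(1)] D(2) D'(2) by (intro exI[of _ "\<lambda>x. D' (D x)"]) simp
qed

lemma holomorphic_vec_on_diff:
  assumes "holomorphic_vec_on f S" "holomorphic_vec_on g S"
  shows "holomorphic_vec_on (\<lambda>x. f x - g x) S"
  unfolding holomorphic_vec_on_def
proof
  fix x assume x: "x \<in> S"
  obtain D where D: "(f has_derivative D) (at x)" "\<And>a v. D (a *s v) = a *s D v"
    using holomorphic_vec_onE[OF assms(1) x] by blast
  obtain D' where D': "(g has_derivative D') (at x)" "\<And>a v. D' (a *s v) = a *s D' v"
    using holomorphic_vec_onE[OF assms(2) x] by blast
  show "\<exists>D. ((\<lambda>x. f x - g x) has_derivative D) (at x) \<and> (\<forall>a v. D (a *s v) = a *s D v)"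
    using has_derivative_diff[OF D(1) D'(1)] D(2) D'(2)
    by (intro exI[of _ "\<lambda>x. D x - D' x"]) (simp add: vec_eq_iff algebra_simps)
qed

lemma holomorphic_vec_on_scaleR:
  assumes "holomorphic_vec_on f S"
  shows "holomorphic_vec_on (\<lambda>x. c *\<^sub>R f x) S"
  unfolding holomorphic_vec_on_def
proof
  fix x assume x: "x \<in> S"
  obtain D where D: "(f has_derivative D) (at x)" "\<And>a v. D (a *s v) = a *s D v"
    using holomorphic_vec_onE[OF assms x] by blast
  show "\<exists>D. ((\<lambda>x. c *\<^sub>R f x) has_derivative D) (at x) \<and> (\<forall>a v. D (a *s v) = a *s D v)"
    using has_derivative_scaleR_right[OF D(1), of c] D(2)
    by (intro exI[of _ "\<lambda>x. c *\<^sub>R D x"]) (simp add: vec_eq_iff algebra_simps)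
qed

lemma holomorphic_vec_on_id: "holomorphic_vec_on (\<lambda>x. x) S"
  unfolding holomorphic_vec_on_def by (intro ballI exI[of _ "\<lambda>x. x"]) simp

lemma holomorphic_vec_on_const: "holomorphic_vec_on (\<lambda>x. c) S"
  unfolding holomorphic_vec_on_def by (intro ballI exI[of _ "\<lambda>x. 0"]) simp

lemma holomorphic_vec_on_has_field_derivative:
  fixes f :: "(complex, 'n::finite) vec \<Rightarrow> (complex, 'm::finite) vec"
  assumes f: "(f has_derivative D) (at (u \<zeta>))" and lin: "\<And>a v. D (a *s v) = a *s D v"
    and u: "(u has_derivative (\<lambda>a. a *s v)) (at \<zeta>)"
  shows "((\<lambda>\<zeta>. f (u \<zeta>) $ i) has_field_derivative (D v $ i)) (at \<zeta>)"
proof -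
  have "((\<lambda>\<zeta>. f (u \<zeta>)) has_derivative (\<lambda>a. D (a *s v))) (at \<zeta>)"
    using has_derivative_compose[OF u f] .
  then have "((\<lambda>\<zeta>. f (u \<zeta>) $ i) has_derivative (\<lambda>a. D (a *s v) $ i)) (at \<zeta>)"
    by (rule bounded_linear.has_derivative[OF bounded_linear_vec_nth])
  then show ?thesis
    by (simp add: has_field_derivative_def lin mult.commute[of _ "D v $ i"])
qed

lemma has_derivative_complex_line:
  "((\<lambda>\<zeta>. p + \<zeta> *s v) has_derivative (\<lambda>a. a *s v)) (at \<zeta> within S)" for v :: "(complex, 'n::finite) vec"
  using has_derivative_add[OF has_derivative_const bounded_linear_imp_has_derivative[OF
      bounded_linear_vector_scalar_mult_left]] by simp

text \<open>Cauchy's inequality on the complex line through \<open>p\<close> in direction \<open>v\<close>, applied to each component. Half the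
radius is used so that the closed disc stays in the ball, whence the factor 2.\<close>

lemma holomorphic_vec_derivative_bound:
  fixes f :: "(complex, 'n::finite) vec \<Rightarrow> (complex, 'm::finite) vec"
  assumes hol: "holomorphic_vec_on f (ball p r)" and r: "0 < r"
    and B: "\<And>x. x \<in> ball p r \<Longrightarrow> norm (f x) \<le> B"
    and D: "(f has_derivative D) (at p)"
  shows "norm (D v) \<le> 2 * real CARD('m) * B / r * norm v"
proof (cases "v = 0")
  case True
  then show ?thesis
    using linear_0[OF bounded_linear.linear[OF has_derivative_bounded_linear[OF D]]] by simp
next
  case False
  define \<rho> where "\<rho> = r / (2 * norm v)"
  have \<rho>: "0 < \<rho>" using r False by (simp add: \<rho>_def)
  have inball: "p + \<zeta> *s v \<in> ball p r" if "\<zeta> \<in> cball 0 \<rho>" for \<zeta>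
  proof -
    have "cmod \<zeta> * norm v \<le> \<rho> * norm v" using that by (intro mult_right_mono) auto
    also have "\<dots> < r" using False r by (simp add: \<rho>_def)
    finally show ?thesis by (simp add: dist_norm norm_vector_scalar_mult)
  qed
  have p: "p \<in> ball p r" using r by simp
  obtain D0 where D0: "(f has_derivative D0) (at p)" "\<And>a v. D0 (a *s v) = a *s D0 v"
    using holomorphic_vec_onE[OF hol p] by blast
  have "D = D0" by (rule has_derivative_unique[OF D D0(1)])
  have "cmod (D v $ i) \<le> 2 * B / r * norm v" for i
  proof -
    let ?g = "\<lambda>\<zeta>. f (p + \<zeta> *s v) $ i"
    have diff: "?g field_differentiable at \<zeta>" if z: "\<zeta> \<in> cball 0 \<rho>" for \<zeta>
    proof -
      obtain D1 where D1: "(f has_derivative D1) (at (p + \<zeta> *s v))" "\<And>a v. D1 (a *s v) = a *s D1 v"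
        using holomorphic_vec_onE[OF hol inball[OF z]] by blast
      show ?thesis
        using holomorphic_vec_on_has_field_derivative[OF D1 has_derivative_complex_line]
        unfolding field_differentiable_def by blast
    qed
    have g0: "(?g has_field_derivative (D v $ i)) (at 0)"
      using holomorphic_vec_on_has_field_derivative[of f D0 "\<lambda>\<zeta>. p + \<zeta> *s v" 0 v i] D0
        has_derivative_complex_line[of p v 0 UNIV] \<open>D = D0\<close> by simp
    have "cmod ((deriv ^^ 1) ?g 0) \<le> fact 1 * B / \<rho> ^ 1"
    proof (rule Cauchy_inequality)
      show "?g holomorphic_on ball 0 \<rho>"
        unfolding holomorphic_on_def using diff by (auto intro: field_differentiable_at_within)
      show "continuous_on (cball 0 \<rho>) ?g"
        by (intro continuous_at_imp_continuous_on ballI field_differentiable_imp_continuous_at diff)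
      show "cmod (?g x) \<le> B" if "cmod (0 - x) = \<rho>" for x
        using B[OF inball, of x] that Finite_Cartesian_Product.norm_nth_le[of "f (p + x *s v)" i] by auto
    qed (rule \<rho>)
    then show ?thesis
      using DERIV_imp_deriv[OF g0] by (simp add: \<rho>_def field_simps)
  qed
  from norm_vec_le_card_mult[of "D v", OF this] show ?thesis by (simp add: field_simps)
qed

lemma holomorphic_vec_Lipschitz:
  fixes f :: "(complex, 'n::finite) vec \<Rightarrow> (complex, 'm::finite) vec"
  assumes hol: "holomorphic_vec_on f (ball p (2 * r))" and r: "0 < r"
    and B: "\<And>x. x \<in> ball p (2 * r) \<Longrightarrow> norm (f x) \<le> B"
    and xy: "x \<in> ball p r" "y \<in> ball p r"
  shows "norm (f x - f y) \<le> 2 * real CARD('m) * B / r * norm (x - y)"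
proof -
  have sub: "ball z r \<subseteq> ball p (2 * r)" if "z \<in> ball p r" for z
  proof
    fix w assume "w \<in> ball z r"
    then show "w \<in> ball p (2 * r)" using that dist_triangle[of p w z] by simp
  qed
  have B0: "0 \<le> B" using B[of p] norm_ge_zero[of "f p"] r order_trans[of 0 "norm (f p)" B] by simp
  have "\<forall>z\<in>ball p r. \<exists>D. (f has_derivative D) (at z within ball p r) \<and>
      onorm D \<le> 2 * real CARD('m) * B / r"
  proof
    fix z assume z: "z \<in> ball p r"
    then have "z \<in> ball p (2 * r)" using r by simp
    then obtain D where D: "(f has_derivative D) (at z)" "\<And>a v. D (a *s v) = a *s D v"
      using holomorphic_vec_onE[OF hol] by blast
    have "norm (D v) \<le> 2 * real CARD('m) * B / r * norm v" for v
      by (rule holomorphic_vec_derivative_bound[OF holomorphic_vec_on_subset[OF hol sub[OF z]] r _ D(1)])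
        (use B sub[OF z] in blast)
    then have "onorm D \<le> 2 * real CARD('m) * B / r" by (rule onorm_bound[rotated])
        (use r B0 in simp)
    with D show "\<exists>D. (f has_derivative D) (at z within ball p r) \<and> onorm D \<le> 2 * real CARD('m) * B / r"
      using has_derivative_at_withinI by blast
  qed
  then obtain D where "\<And>z. z \<in> ball p r \<Longrightarrow> (f has_derivative D z) (at z within ball p r)"
    "\<And>z. z \<in> ball p r \<Longrightarrow> onorm (D z) \<le> 2 * real CARD('m) * B / r" by metis
  from differentiable_bound[OF convex_ball this xy] show ?thesis .
qed

text \<open>By the Cauchy bound applied to differences, uniform convergence of the maps on the larger ball gives uniform
convergence of the derivatives on the smaller one, and complex linearity of the derivative is preserved.\<close>

lemma holomorphic_vec_uniform_limit:
  fixes f :: "nat \<Rightarrow> (complex, 'n::finite) vec \<Rightarrow> (complex, 'm::finite) vec"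
  assumes hol: "\<And>k. holomorphic_vec_on (f k) (ball p (2 * r))" and r: "0 < r"
    and cau: "\<And>e. 0 < e \<Longrightarrow> \<exists>N. \<forall>k\<ge>N. \<forall>l\<ge>N. \<forall>x\<in>ball p (2 * r). norm (f k x - f l x) \<le> e"
    and lim: "\<And>x. x \<in> ball p r \<Longrightarrow> (\<lambda>k. f k x) \<longlonglongrightarrow> g x"
  shows "holomorphic_vec_on g (ball p r)"
proof -
  have sub: "ball z r \<subseteq> ball p (2 * r)" if "z \<in> ball p r" for z
  proof
    fix w assume "w \<in> ball z r"
    then show "w \<in> ball p (2 * r)" using that dist_triangle[of p w z] by simp
  qed
  define K where "K = 2 * real CARD('m) / r"
  have K: "K > 0" using r by (simp add: K_def)
  define f' where "f' = (\<lambda>k x. frechet_derivative (f k) (at x))"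
  have f': "(f k has_derivative f' k x) (at x)" and lin: "f' k x (a *s v) = a *s f' k x v"
    if "x \<in> ball p r" for k x a v
  proof -
    have "x \<in> ball p (2 * r)" using that r by simp
    then obtain D where D: "(f k has_derivative D) (at x)" "\<And>a v. D (a *s v) = a *s D v"
      using holomorphic_vec_onE[OF hol] by blast
    then have "f' k x = D" unfolding f'_def by (metis frechet_derivative_at)
    with D show "(f k has_derivative f' k x) (at x)" "f' k x (a *s v) = a *s f' k x v" by auto
  qed
  have ucau: "\<exists>N. \<forall>k\<ge>N. \<forall>l\<ge>N. \<forall>x\<in>ball p r. \<forall>h. norm (f' k x h - f' l x h) \<le> e * norm h" if "e > 0" for e
  proof -
    obtain N where N: "\<And>k l x. k \<ge> N \<Longrightarrow> l \<ge> N \<Longrightarrow> x \<in> ball p (2 * r) \<Longrightarrow> norm (f k x - f l x) \<le> e / K"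
      using cau[of "e / K"] \<open>e > 0\<close> K by (meson divide_pos_pos)
    have "norm (f' k x h - f' l x h) \<le> e * norm h" if "k \<ge> N" "l \<ge> N" "x \<in> ball p r" for k l x h
    proof -
      have "norm (f' k x h - f' l x h) \<le> 2 * real CARD('m) * (e / K) / r * norm h"
      proof (rule holomorphic_vec_derivative_bound[where f = "\<lambda>x. f k x - f l x" and p = x])
        show "holomorphic_vec_on (\<lambda>x. f k x - f l x) (ball x r)"
          using holomorphic_vec_on_diff[OF hol hol] sub[OF that(3)] by (rule holomorphic_vec_on_subset)
        show "((\<lambda>x. f k x - f l x) has_derivative (\<lambda>h. f' k x h - f' l x h)) (at x)"
          using that(3) by (intro has_derivative_diff f')
      qed (use r N that sub[OF that(3)] in auto)
      then show ?thesis using r by (simp add: K_def)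
    qed
    then show ?thesis by blast
  qed
  define g' where "g' = (\<lambda>x h. lim (\<lambda>k. f' k x h))"
  have g': "(\<lambda>k. f' k x h) \<longlonglongrightarrow> g' x h" if xr: "x \<in> ball p r" for x h
  proof -
    have "Cauchy (\<lambda>k. f' k x h)"
    proof (rule CauchyI)
      fix e :: real assume "e > 0"
      then have "e / (2 * (norm h + 1)) > 0" by (simp add: add_nonneg_pos)
      then obtain N where N: "\<And>k l. k \<ge> N \<Longrightarrow> l \<ge> N \<Longrightarrow> norm (f' k x h - f' l x h) \<le> e / (2 * (norm h + 1)) * norm h"
        using ucau[of "e / (2 * (norm h + 1))"] xr by meson
      have "norm h * e < 2 * (norm h + 1) * e"
        using \<open>e > 0\<close> by (intro mult_strict_right_mono) (simp_all add: add_nonneg_pos algebra_simps)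
      then have "e / (2 * (norm h + 1)) * norm h < e"
        by (simp add: divide_less_eq add_nonneg_pos mult.commute)
      with N show "\<exists>M. \<forall>m\<ge>M. \<forall>n\<ge>M. norm (f' m x h - f' n x h) < e" by (meson le_less_trans)
    qed
    then show ?thesis unfolding g'_def by (simp add: Cauchy_convergent_iff convergent_LIMSEQ_iff)
  qed
  have nle: "\<forall>\<^sub>F k in sequentially. \<forall>x\<in>ball p r. \<forall>h. norm (f' k x h - g' x h) \<le> e * norm h" if "e > 0" for e
  proof -
    obtain N where N: "\<And>k l x h. k \<ge> N \<Longrightarrow> l \<ge> N \<Longrightarrow> x \<in> ball p r \<Longrightarrow> norm (f' k x h - f' l x h) \<le> e * norm h"
      using ucau[OF \<open>e > 0\<close>] by meson
    have "norm (f' k x h - g' x h) \<le> e * norm h" if "k \<ge> N" "x \<in> ball p r" for k x h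
    proof (rule tendsto_upperbound)
      show "(\<lambda>l. norm (f' k x h - f' l x h)) \<longlonglongrightarrow> norm (f' k x h - g' x h)"
        by (intro tendsto_intros g' that)
      show "\<forall>\<^sub>F l in sequentially. norm (f' k x h - f' l x h) \<le> e * norm h"
        using N that eventually_sequentially by blast
    qed simp
    then show ?thesis using eventually_sequentially by blast
  qed
  have p: "p \<in> ball p r" using r by simp
  obtain G where G: "\<forall>x\<in>ball p r. (\<lambda>k. f k x) \<longlonglongrightarrow> G x \<and> (G has_derivative g' x) (at x within ball p r)"
    using has_derivative_sequence[OF convex_ball has_derivative_at_withinI[OF f'] nle p lim[OF p]] by blast
  have Gg: "G x = g x" if "x \<in> ball p r" for x
    using LIMSEQ_unique G lim that by blast
  show ?thesis
    unfolding holomorphic_vec_on_def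
  proof
    fix x assume x: "x \<in> ball p r"
    have "(G has_derivative g' x) (at x)" using G x by (metis at_within_open open_ball)
    then have "(g has_derivative g' x) (at x)"
      by (rule has_derivative_transform_within_open[OF _ open_ball x Gg])
    moreover have "g' x (a *s v) = a *s g' x v" for a v
    proof (rule LIMSEQ_unique)
      show "(\<lambda>k. f' k x (a *s v)) \<longlonglongrightarrow> g' x (a *s v)" by (rule g'[OF x])
      have "(\<lambda>k. a *s f' k x v) \<longlonglongrightarrow> a *s g' x v"
        by (rule vec_tendstoI) (auto intro!: tendsto_intros g' x)
      then show "(\<lambda>k. f' k x (a *s v)) \<longlonglongrightarrow> a *s g' x v" by (simp add: lin[OF x])
    qed
    ultimately show "\<exists>D. (g has_derivative D) (at x) \<and> (\<forall>a v. D (a *s v) = a *s D v)" by blast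
  qed
qed

text \<open>A common Lipschitz constant transfers the Cauchy property from finitely many dense points, whose small
balls cover the compact closed ball, to all points at once.\<close>

lemma uniformly_Cauchy_of_dense:
  fixes f :: "nat \<Rightarrow> 'a::euclidean_space \<Rightarrow> 'b::real_normed_vector"
  assumes lip: "\<And>k x y. x \<in> ball p r \<Longrightarrow> y \<in> ball p r \<Longrightarrow> norm (f k x - f k y) \<le> K * norm (x - y)"
    and dense: "\<And>x e. x \<in> ball p r \<Longrightarrow> 0 < e \<Longrightarrow> \<exists>d. dist x d < e \<and> Cauchy (\<lambda>k. f k d)"
    and r: "0 < r" and e: "0 < e"
  shows "\<exists>N. \<forall>k\<ge>N. \<forall>l\<ge>N. \<forall>x\<in>ball p r. norm (f k x - f l x) \<le> e"
proof -
  \<comment> \<open>Moving by \<open>\<delta>\<close> changes each map by at most \<open>e / 3\<close>.\<close>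
  define \<delta> where "\<delta> = e / (3 * (\<bar>K\<bar> + 1))"
  have \<delta>: "0 < \<delta>" using e by (simp add: \<delta>_def)
  have K\<delta>: "K * t \<le> e / 3" if "0 \<le> t" "t \<le> \<delta>" for t
  proof -
    have "K * t \<le> (\<bar>K\<bar> + 1) * \<delta>" using that by (intro mult_mono) auto
    also have "\<dots> = e / 3" unfolding \<delta>_def using abs_ge_zero[of K] by (simp add: field_simps)
    finally show ?thesis .
  qed
  define Y where "Y = {d \<in> ball p r. Cauchy (\<lambda>k. f k d)}"
  have cov: "cball p r \<subseteq> (\<Union>d\<in>Y. ball d \<delta>)"
  proof
    fix x assume "x \<in> cball p r"
    then have "x \<in> closure (ball p r)" using r by simp
    then obtain y where y: "y \<in> ball p r" "dist y x < \<delta> / 2"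
      using \<delta> by (meson closure_approachable half_gt_zero)
    obtain s where s: "s > 0" "ball y s \<subseteq> ball p r"
      using y open_contains_ball open_ball by blast
    obtain d where d: "dist y d < min (\<delta> / 2) s" "Cauchy (\<lambda>k. f k d)"
      using dense[OF y(1), of "min (\<delta> / 2) s"] s \<delta> by auto
    then have "d \<in> Y" using s by (auto simp: Y_def)
    moreover have "x \<in> ball d \<delta>" using d y dist_triangle[of d x y] by (simp add: dist_commute)
    ultimately show "x \<in> (\<Union>d\<in>Y. ball d \<delta>)" by blast
  qed
  obtain F where F: "F \<subseteq> Y" "finite F" "cball p r \<subseteq> (\<Union>d\<in>F. ball d \<delta>)"
    using compactE_image[OF compact_cball _ cov] by blast
  have "\<exists>N. \<forall>k\<ge>N. \<forall>l\<ge>N. norm (f k d - f l d) < e / 3" if "d \<in> F" for d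
    using that F(1) e CauchyD[of "\<lambda>k. f k d" "e / 3"] by (auto simp: Y_def)
  then obtain N where N: "\<And>d k l. d \<in> F \<Longrightarrow> k \<ge> N d \<Longrightarrow> l \<ge> N d \<Longrightarrow> norm (f k d - f l d) < e / 3" by metis
  define M where "M = Max (insert 0 (N ` F))"
  have M: "N d \<le> M" if "d \<in> F" for d using that F(2) by (simp add: M_def)
  have "norm (f k x - f l x) \<le> e" if "k \<ge> M" "l \<ge> M" "x \<in> ball p r" for k l x
  proof -
    have xr: "x \<in> ball p r" by fact
    obtain d where d: "d \<in> F" "x \<in> ball d \<delta>" using F(3) xr by force
    then have dr: "d \<in> ball p r" using F(1) by (auto simp: Y_def)
    have nd: "norm (x - d) \<le> \<delta>" using d by (simp add: dist_norm norm_minus_commute)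
    have 1: "norm (f j x - f j d) \<le> e / 3" for j
      using lip[OF xr dr, of j] K\<delta>[OF norm_ge_zero nd] by linarith
    have 2: "norm (f k d - f l d) < e / 3" using N[OF d(1)] M[OF d(1)] that by simp
    have "f k x - f l x = (f k x - f k d) + (f k d - f l d) - (f l x - f l d)" by simp
    also have "norm \<dots> \<le> norm (f k x - f k d) + norm (f k d - f l d) + norm (f l x - f l d)"
      by (rule order_trans[OF norm_triangle_ineq4 add_right_mono[OF norm_triangle_ineq]])
    also have "\<dots> \<le> e" using 1[of k] 1[of l] 2 by linarith
    finally show ?thesis .
  qed
  then show ?thesis by blast
qed

text \<open>Vitali's convergence theorem for a one-parameter family as the parameter decreases to 0. The candidate limit
comes from one sequence of parameters; the full limit then follows by comparison with nearby points
of the dense set, where it is known to exist.\<close>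

proposition Vitali_right_limit:
  fixes q :: "real \<Rightarrow> (complex, 'n::finite) vec \<Rightarrow> (complex, 'm::finite) vec"
  assumes R: "0 < R" and \<delta>: "0 < \<delta>"
    and hol: "\<And>h. 0 < h \<Longrightarrow> h < \<delta> \<Longrightarrow> holomorphic_vec_on (q h) (ball p R)"
    and B: "\<And>h x. 0 < h \<Longrightarrow> h < \<delta> \<Longrightarrow> x \<in> ball p R \<Longrightarrow> norm (q h x) \<le> B"
    and dense: "\<And>x e. x \<in> ball p R \<Longrightarrow> 0 < e \<Longrightarrow> \<exists>d l. dist x d < e \<and> ((\<lambda>h. q h d) \<longlongrightarrow> l) (at_right 0)"
  obtains g where "\<And>x. x \<in> ball p (R / 2) \<Longrightarrow> ((\<lambda>h. q h x) \<longlongrightarrow> g x) (at_right 0)"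
    "holomorphic_vec_on g (ball p (R / 4))"
proof -
  define K where "K = 2 * real CARD('m) * B / (R / 2)"
  have lip: "norm (q h x - q h y) \<le> K * norm (x - y)"
    if "0 < h" "h < \<delta>" "x \<in> ball p (R / 2)" "y \<in> ball p (R / 2)" for h x y
    unfolding K_def using holomorphic_vec_Lipschitz[of "q h" p "R / 2" B x y] hol B that R by simp
  have K0: "0 \<le> K"
  proof -
    have "0 \<le> B" using B[of "\<delta> / 2" p] \<delta> R by (simp add: order_trans[OF norm_ge_zero])
    then show ?thesis using R by (simp add: K_def)
  qed
  define h where "h = (\<lambda>k. \<delta> / (real k + 2))"
  have h: "0 < h k" "h k < \<delta>" for k using \<delta> by (auto simp: h_def field_simps add_pos_nonneg)
  have hlim: "filterlim h (at_right 0) sequentially"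
  proof -
    have "h \<longlonglongrightarrow> 0" unfolding h_def by real_asymp
    then show ?thesis
      unfolding filterlim_at using h less_imp_neq[OF h(1)] by (auto intro!: always_eventually)
  qed
  let ?f = "\<lambda>k. q (h k)"
  have cauD: "Cauchy (\<lambda>k. ?f k d)" if "((\<lambda>h. q h d) \<longlongrightarrow> l) (at_right 0)" for d l
    using filterlim_compose[OF that hlim] by (rule LIMSEQ_imp_Cauchy)
  have sub: "ball p (R / 2) \<subseteq> ball p R" using R by (intro subset_ball) simp
  have ucau: "\<exists>N. \<forall>k\<ge>N. \<forall>l\<ge>N. \<forall>x\<in>ball p (R / 2). norm (?f k x - ?f l x) \<le> e" if "e > 0" for e
  proof (rule uniformly_Cauchy_of_dense[where K = K])
    fix x e assume "x \<in> ball p (R / 2)" "0 < (e::real)"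
    then show "\<exists>d. dist x d < e \<and> Cauchy (\<lambda>k. ?f k d)"
      using dense[of x e] cauD sub by blast
  qed (use lip h R that in auto)
  define g where "g = (\<lambda>x. lim (\<lambda>k. ?f k x))"
  have g: "(\<lambda>k. ?f k x) \<longlonglongrightarrow> g x" if x: "x \<in> ball p (R / 2)" for x
  proof -
    have "Cauchy (\<lambda>k. ?f k x)"
    proof (rule CauchyI)
      fix e :: real assume "e > 0"
      then obtain N where "\<forall>k\<ge>N. \<forall>l\<ge>N. \<forall>x\<in>ball p (R / 2). norm (?f k x - ?f l x) \<le> e / 2"
        using ucau[of "e / 2"] by auto
      then show "\<exists>M. \<forall>m\<ge>M. \<forall>n\<ge>M. norm (?f m x - ?f n x) < e"
        using x \<open>e > 0\<close> by (intro exI[of _ N]) force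
    qed
    then show ?thesis unfolding g_def by (simp add: Cauchy_convergent_iff convergent_LIMSEQ_iff)
  qed
  have glip: "norm (g x - g y) \<le> K * norm (x - y)" if "x \<in> ball p (R / 2)" "y \<in> ball p (R / 2)" for x y
    by (rule tendsto_upperbound[OF tendsto_norm[OF tendsto_diff[OF g[OF that(1)] g[OF that(2)]]]])
      (use lip h that in auto)
  have 1: "((\<lambda>h. q h x) \<longlongrightarrow> g x) (at_right 0)" if x: "x \<in> ball p (R / 2)" for x
  proof (rule tendstoI)
    fix e :: real assume e: "e > 0"
    obtain s where s: "s > 0" "ball x s \<subseteq> ball p (R / 2)"
      using x open_contains_ball open_ball by blast
    define \<epsilon> where "\<epsilon> = min s (e / (3 * (K + 1)))"
    have \<epsilon>: "\<epsilon> > 0" using s e K0 by (simp add: \<epsilon>_def)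
    obtain d l where d: "dist x d < \<epsilon>" "((\<lambda>h. q h d) \<longlongrightarrow> l) (at_right 0)"
      using dense[of x \<epsilon>] x sub \<epsilon> by blast
    have dr: "d \<in> ball p (R / 2)" using d s by (auto simp: \<epsilon>_def)
    have "g d = l" using LIMSEQ_unique[OF g[OF dr] filterlim_compose[OF d(2) hlim]] .
    have "K * norm (x - d) \<le> K * (e / (3 * (K + 1)))"
      using d K0 by (intro mult_left_mono) (auto simp: \<epsilon>_def dist_norm)
    also have "\<dots> \<le> e / 3" using K0 e by (simp add: field_simps)
    finally have Ke: "K * norm (x - d) \<le> e / 3" .
    have "eventually (\<lambda>h. dist (q h d) (g d) < e / 3) (at_right 0)"
      using tendstoD[OF d(2), of "e / 3"] e \<open>g d = l\<close> by simp
    moreover have "eventually (\<lambda>h. 0 < h \<and> h < \<delta>) (at_right 0)"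
      using \<delta> eventually_at_right_less eventually_at_right_field by blast
    ultimately show "eventually (\<lambda>h. dist (q h x) (g x) < e) (at_right 0)"
    proof eventually_elim
      case (elim h)
      have "dist (q h x) (q h d) \<le> e / 3"
        using lip[of h x d] elim x dr Ke by (simp add: dist_norm)
      moreover have "dist (g d) (g x) \<le> e / 3"
        using glip[OF x dr] Ke by (simp add: dist_norm norm_minus_commute)
      moreover have "dist (q h x) (g x) \<le> dist (q h x) (q h d) + dist (q h d) (g d) + dist (g d) (g x)"
        by (meson dist_triangle add_right_mono order_trans)
      ultimately show ?case using elim by linarith
    qed
  qed
  have 2: "holomorphic_vec_on g (ball p (R / 4))"
  proof (rule holomorphic_vec_uniform_limit[where f = ?f])
    show "holomorphic_vec_on (?f k) (ball p (2 * (R / 4)))" for k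
      using holomorphic_vec_on_subset[OF hol[OF h] sub] by simp
    show "\<exists>N. \<forall>k\<ge>N. \<forall>l\<ge>N. \<forall>x\<in>ball p (2 * (R / 4)). norm (?f k x - ?f l x) \<le> e" if "0 < e" for e
      using ucau[OF that] by simp
  qed (use R g in auto)
  show ?thesis using that 1 2 by blast
qed


text \<open>The difference of \<open>f\<close> and its translate by \<open>w\<close> is holomorphic and bounded by a multiple of \<open>norm w\<close>, so by
the Cauchy bound its derivative is too.\<close>

lemma holomorphic_vec_derivative_continuous_on:
  fixes f :: "(complex, 'n::finite) vec \<Rightarrow> (complex, 'm::finite) vec"
  assumes hol: "holomorphic_vec_on f S" and S: "open S"
  shows "continuous_on S (\<lambda>x. frechet_derivative f (at x) v)"
proof (rule continuous_at_imp_continuous_on, rule ballI)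
  fix p assume p: "p \<in> S"
  have cont: "continuous_on S f" by (rule holomorphic_vec_on_imp_continuous_on[OF hol])
  obtain R1 where R1: "R1 > 0" "ball p R1 \<subseteq> S" using S p open_contains_ball by blast
  have "isCont f p" using cont S p continuous_on_eq_continuous_at by blast
  then obtain R2 where R2: "R2 > 0" "\<And>x. dist x p < R2 \<Longrightarrow> dist (f x) (f p) < 1"
    unfolding continuous_at_eps_delta by (meson zero_less_one)
  define r where "r = min R1 R2 / 4"
  have r: "r > 0" "4 * r \<le> R1" "4 * r \<le> R2" using R1 R2 by (auto simp: r_def)
  define B where "B = norm (f p) + 1"
  have sub: "ball p (4 * r) \<subseteq> S" using R1 r by (meson subset_ball order_trans)
  have B: "norm (f x) \<le> B" if "x \<in> ball p (4 * r)" for x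
  proof -
    have "dist (f x) (f p) < 1" using that r by (intro R2) (simp add: dist_commute)
    then show ?thesis using norm_triangle_sub[of "f x" "f p"] by (simp add: B_def dist_norm)
  qed
  define K where "K = 2 * real CARD('m) * B / (2 * r)"
  have lip: "norm (f x - f y) \<le> K * norm (x - y)" if "x \<in> ball p (2 * r)" "y \<in> ball p (2 * r)" for x y
    unfolding K_def
    by (rule holomorphic_vec_Lipschitz[of f p]) (use r B that holomorphic_vec_on_subset[OF hol sub] in auto)
  define M where "M = 2 * real CARD('m) * K / r * norm v"
  have der: "(f has_derivative frechet_derivative f (at x)) (at x)" if "x \<in> S" for x
    using holomorphic_vec_onE[OF hol that] by (metis frechet_derivative_at)
  have near: "norm (frechet_derivative f (at (p + w)) v - frechet_derivative f (at p) v) \<le> M * norm w"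
    if w: "norm w < r" for w
  proof -
    have pS: "p \<in> S" "p + w \<in> S" using w r sub by (auto intro!: subsetD[OF sub] simp: dist_norm)
    have shift: "((\<lambda>x. f (x + w)) has_derivative frechet_derivative f (at (p + w))) (at p)"
    proof (rule has_derivative_compose[of "\<lambda>x. x + w" "\<lambda>x. x" p UNIV f])
      show "((\<lambda>x. x + w) has_derivative (\<lambda>x. x)) (at p)" by (auto intro!: derivative_eq_intros)
    qed (rule der[OF pS(2)])
    have in2: "x + w \<in> ball p (2 * r)" "x \<in> ball p (2 * r)" if "x \<in> ball p r" for x
      using that w r(1) norm_triangle_ineq4[of "p - x" w] by (simp_all add: dist_norm diff_diff_eq)
    have in4: "ball p (2 * r) \<subseteq> S" using order_trans[OF subset_ball sub] r(1) by simp
    have "norm (frechet_derivative f (at (p + w)) v - frechet_derivative f (at p) v)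
        \<le> 2 * real CARD('m) * (K * norm w) / r * norm v"
    proof (rule holomorphic_vec_derivative_bound[where f = "\<lambda>x. f (x + w) - f x" and p = p])
      have "holomorphic_vec_on (\<lambda>x. x + w) (ball p r)"
        unfolding holomorphic_vec_on_def by (intro ballI exI[of _ "\<lambda>x. x"]) (auto intro!: derivative_eq_intros)
      then have "holomorphic_vec_on (\<lambda>x. f (x + w)) (ball p r)"
        using in2(1) in4 by (intro holomorphic_vec_on_compose[OF _ hol]) auto
      moreover have "holomorphic_vec_on f (ball p r)"
        using in2(2) in4 by (intro holomorphic_vec_on_subset[OF hol]) auto
      ultimately show "holomorphic_vec_on (\<lambda>x. f (x + w) - f x) (ball p r)"
        by (rule holomorphic_vec_on_diff)
      show "norm (f (x + w) - f x) \<le> K * norm w" if "x \<in> ball p r" for x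
        using lip[OF in2[OF that]] by simp
      show "((\<lambda>x. f (x + w) - f x) has_derivative
          (\<lambda>v. frechet_derivative f (at (p + w)) v - frechet_derivative f (at p) v)) (at p)"
        by (rule has_derivative_diff[OF shift der[OF pS(1)]])
    qed (rule r(1))
    then show ?thesis by (simp add: M_def mult_ac)
  qed
  have "((\<lambda>w. frechet_derivative f (at (p + w)) v) \<longlongrightarrow> frechet_derivative f (at p) v) (at 0)"
  proof (rule Lim_null[THEN iffD2], rule Lim_null_comparison)
    show "\<forall>\<^sub>F w in at 0. norm (frechet_derivative f (at (p + w)) v - frechet_derivative f (at p) v) \<le> M * norm w"
      using r(1) near by (auto simp: eventually_at dist_norm intro!: exI[of _ r])
    show "((\<lambda>w. M * norm w) \<longlongrightarrow> 0) (at 0)" by (auto intro!: tendsto_eq_intros)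
  qed
  then show "isCont (\<lambda>x. frechet_derivative f (at x) v) p"
    unfolding isCont_iff by simp
qed

text \<open>One-sided derivatives appear both as velocities, to which the chain rule applies, and as limits of
difference quotients, to which Vitali's theorem applies.\<close>

lemma has_vector_derivative_right_iff:
  "(f has_vector_derivative v) (at t within {t..}) \<longleftrightarrow>
    ((\<lambda>h. (1 / h) *\<^sub>R (f (t + h) - f t)) \<longlongrightarrow> v) (at_right 0)"
proof -
  have "(f has_vector_derivative v) (at t within {t..}) \<longleftrightarrow>
      ((\<lambda>y. (1 / norm (y - t)) *\<^sub>R (f y - (f t + (y - t) *\<^sub>R v))) \<longlongrightarrow> 0) (at_right t)"
    by (simp add: has_vector_derivative_def has_derivative_within at_within_Ici_at_right
        bounded_linear_scaleR_left)
  also have "\<dots> \<longleftrightarrow>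
      ((\<lambda>h. (1 / norm h) *\<^sub>R (f (h + t) - (f t + h *\<^sub>R v))) \<longlongrightarrow> 0) (at_right 0)"
    by (subst filterlim_at_right_to_0) simp
  also have "\<dots> \<longleftrightarrow> ((\<lambda>h. (1 / h) *\<^sub>R (f (t + h) - f t) - v) \<longlongrightarrow> 0) (at_right 0)"
    by (rule filterlim_cong)
      (auto simp: eventually_at_filter algebra_simps)
  also have "\<dots> \<longleftrightarrow> ((\<lambda>h. (1 / h) *\<^sub>R (f (t + h) - f t)) \<longlongrightarrow> v) (at_right 0)"
    by (rule Lim_null[symmetric])
  finally show ?thesis .
qed

section \<open>Charts and tangent vectors\<close>

locale complex_mfd =
  fixes A :: "('a::{t2_space, second_countable_topology}, 'n::finite) chart set"
  assumes mfd: "complex_manifold A"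
begin

abbreviation im :: "('a, 'n) chart \<Rightarrow> (complex, 'n) vec set" where "im c \<equiv> snd c ` fst c"

lemma
  assumes "c \<in> A"
  shows open_chart: "open (fst c)" and open_im: "open (im c)"
    and chart_homeo: "homeomorphism (fst c) (im c) (snd c) (chart_inv c)"
  using mfd assms by (auto simp: complex_manifold_def complex_atlas_def)

lemma connected_mfd: "connected (UNIV :: 'a set)"
  using mfd by (simp add: complex_manifold_def)

lemma ex_chart: obtains c where "c \<in> A" "z \<in> fst c"
proof -
  have "z \<in> (\<Union>c\<in>A. fst c)" using mfd by (simp add: complex_manifold_def complex_atlas_def)
  then show ?thesis using that by blast
qed

lemma
  assumes "c \<in> A"
  shows chart_inv_left: "z \<in> fst c \<Longrightarrow> chart_inv c (snd c z) = z"
    and chart_inv_right: "x \<in> im c \<Longrightarrow> snd c (chart_inv c x) = x"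
    and chart_inv_in: "x \<in> im c \<Longrightarrow> chart_inv c x \<in> fst c"
    and continuous_chart: "continuous_on (fst c) (snd c)"
    and continuous_chart_inv: "continuous_on (im c) (chart_inv c)"
  using chart_homeo[OF assms] by (auto simp: homeomorphism_def)

lemma chart_inv_image_eq:
  assumes "c \<in> A" "U \<subseteq> im c"
  shows "chart_inv c ` U = fst c \<inter> snd c -` U"
proof
  show "chart_inv c ` U \<subseteq> fst c \<inter> snd c -` U"
  proof (rule image_subsetI)
    fix x assume x: "x \<in> U"
    then have "x \<in> im c" using assms(2) by blast
    with x show "chart_inv c x \<in> fst c \<inter> snd c -` U"
      using chart_inv_in[OF assms(1)] chart_inv_right[OF assms(1)] by simp
  qed
  show "fst c \<inter> snd c -` U \<subseteq> chart_inv c ` U"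
    using chart_inv_left[OF assms(1)] by (auto intro!: image_eqI)
qed

lemma open_chart_inv_image:
  assumes "c \<in> A" "U \<subseteq> im c" "open U"
  shows "open (chart_inv c ` U)"
  unfolding chart_inv_image_eq[OF assms(1,2)]
  using continuous_on_open_vimage[OF open_chart[OF assms(1)]] continuous_chart[OF assms(1)] assms(3)
  by (metis inf_commute)

lemma compact_chart_inv_image:
  assumes "c \<in> A" "K \<subseteq> im c" "compact K"
  shows "compact (chart_inv c ` K)"
  using continuous_on_subset[OF continuous_chart_inv[OF assms(1)] assms(2)] assms(3)
  by (rule compact_continuous_image)

lemma open_chart_image:
  assumes "c \<in> A" "open U"
  shows "open (snd c ` (fst c \<inter> U))"
proof -
  have "snd c ` (fst c \<inter> U) = im c \<inter> chart_inv c -` U"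
    using chart_inv_left[OF assms(1)] by (force intro!: image_eqI)
  then show ?thesis
    using continuous_on_open_vimage[OF open_im[OF assms(1)]] continuous_chart_inv[OF assms(1)] assms(2)
    by (metis inf_commute)
qed

lemma ex_chart_cball:
  assumes "open U" "z \<in> U"
  obtains c r where "c \<in> A" "z \<in> fst c" "0 < r" "cball (snd c z) r \<subseteq> im c"
    "chart_inv c ` cball (snd c z) r \<subseteq> U"
proof -
  obtain c where c: "c \<in> A" "z \<in> fst c" by (rule ex_chart)
  have "open (snd c ` (fst c \<inter> U))" "snd c z \<in> snd c ` (fst c \<inter> U)"
    using open_chart_image[OF c(1) assms(1)] c(2) assms(2) by auto
  then obtain r where r: "r > 0" "cball (snd c z) r \<subseteq> snd c ` (fst c \<inter> U)"
    using open_contains_cball by blast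
  have "chart_inv c ` cball (snd c z) r \<subseteq> U"
    using r(2) chart_inv_left[OF c(1)] by fastforce
  then show ?thesis using that c r by blast
qed

lemma transition_chart: "c \<in> A \<Longrightarrow> z \<in> fst c \<Longrightarrow> transition c c' (snd c z) = snd c' z"
  by (simp add: transition_def chart_inv_left)

lemma open_overlap: "c \<in> A \<Longrightarrow> c' \<in> A \<Longrightarrow> open (snd c ` (fst c \<inter> fst c'))"
  using open_chart_image open_chart by blast

lemma transition_holomorphic:
  "c \<in> A \<Longrightarrow> c' \<in> A \<Longrightarrow> holomorphic_vec_on (transition c c') (snd c ` (fst c \<inter> fst c'))"
  using mfd by (auto simp: complex_manifold_def complex_atlas_def)

definition dtrans :: "('a, 'n) chart \<Rightarrow> ('a, 'n) chart \<Rightarrow> 'a \<Rightarrow> (complex, 'n) vec \<Rightarrow> (complex, 'n) vec"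
  where "dtrans c c' z = frechet_derivative (transition c c') (at (snd c z))"

lemma
  assumes "c \<in> A" "c' \<in> A" "z \<in> fst c" "z \<in> fst c'"
  shows transition_derivative: "(transition c c' has_derivative dtrans c c' z) (at (snd c z))"
    and dtrans_scale: "dtrans c c' z (a *s v) = a *s dtrans c c' z v"
    and dtrans_add: "dtrans c c' z (v + w) = dtrans c c' z v + dtrans c c' z w"
    and dtrans_zero: "dtrans c c' z 0 = 0"
proof -
  have "snd c z \<in> snd c ` (fst c \<inter> fst c')" using assms by blast
  then obtain D where D: "(transition c c' has_derivative D) (at (snd c z))" "\<And>a v. D (a *s v) = a *s D v"
    using holomorphic_vec_onE[OF transition_holomorphic[OF assms(1,2)]] by blast
  then have eq: "dtrans c c' z = D" unfolding dtrans_def by (metis frechet_derivative_at)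
  show 1: "(transition c c' has_derivative dtrans c c' z) (at (snd c z))"
    and "dtrans c c' z (a *s v) = a *s dtrans c c' z v"
    using D eq by auto
  have "linear (dtrans c c' z)" using has_derivative_bounded_linear[OF 1] bounded_linear.linear by blast
  then show "dtrans c c' z (v + w) = dtrans c c' z v + dtrans c c' z w" "dtrans c c' z 0 = 0"
    by (auto simp: linear_add linear_0)
qed

lemma dtrans_refl:
  assumes "c \<in> A" "z \<in> fst c"
  shows "dtrans c c z v = v"
proof -
  have "(transition c c has_derivative (\<lambda>v. v)) (at (snd c z))"
    by (rule has_derivative_transform_within_open[of "\<lambda>x. x" _ _ _ "im c"])
      (use assms open_im chart_inv_right in \<open>auto simp: transition_def intro!: derivative_eq_intros\<close>)
  then show ?thesis
    using has_derivative_unique[OF transition_derivative[OF assms(1,1,2,2)]] by (metis)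
qed

lemma dtrans_trans:
  assumes "c \<in> A" "c' \<in> A" "c'' \<in> A" "z \<in> fst c" "z \<in> fst c'" "z \<in> fst c''"
  shows "dtrans c' c'' z (dtrans c c' z v) = dtrans c c'' z v"
proof -
  have "(transition c c'' has_derivative (\<lambda>v. dtrans c' c'' z (dtrans c c' z v))) (at (snd c z))"
  proof (rule has_derivative_transform_within_open)
    show "((\<lambda>x. transition c' c'' (transition c c' x)) has_derivative
        (\<lambda>v. dtrans c' c'' z (dtrans c c' z v))) (at (snd c z))"
      by (rule has_derivative_compose[OF transition_derivative])
        (use assms transition_derivative transition_chart in auto)
    show "open (snd c ` (fst c \<inter> fst c'))" using open_overlap assms by blast
    show "snd c z \<in> snd c ` (fst c \<inter> fst c')" using assms by blast
    show "transition c' c'' (transition c c' x) = transition c c'' x"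
      if "x \<in> snd c ` (fst c \<inter> fst c')" for x
      using that assms by (auto simp: transition_chart)
  qed
  from has_derivative_unique[OF transition_derivative this] assms show ?thesis by metis
qed

lemma velocity_change_of_chart:
  assumes "c \<in> A" "c' \<in> A" "\<gamma> t \<in> fst c" "\<gamma> t \<in> fst c'"
    and "t \<in> S" and ev: "eventually (\<lambda>\<tau>. \<gamma> \<tau> \<in> fst c) (at t within S)"
    and der: "((\<lambda>\<tau>. snd c (\<gamma> \<tau>)) has_vector_derivative v) (at t within S)"
  shows "((\<lambda>\<tau>. snd c' (\<gamma> \<tau>)) has_vector_derivative dtrans c c' (\<gamma> t) v) (at t within S)"
proof -
  have "((\<lambda>\<tau>. transition c c' (snd c (\<gamma> \<tau>))) has_derivative (\<lambda>r. dtrans c c' (\<gamma> t) (r *\<^sub>R v))) (at t within S)"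
    using der transition_derivative[OF assms(1-4)] unfolding has_vector_derivative_def
    by (rule has_derivative_compose)
  moreover have "dtrans c c' (\<gamma> t) (r *\<^sub>R v) = r *\<^sub>R dtrans c c' (\<gamma> t) v" for r
    unfolding scaleR_eq_vector_scalar_mult by (rule dtrans_scale[OF assms(1-4)])
  ultimately have 1: "((\<lambda>\<tau>. transition c c' (snd c (\<gamma> \<tau>))) has_derivative (\<lambda>r. r *\<^sub>R dtrans c c' (\<gamma> t) v)) (at t within S)"
    by simp
  show ?thesis
    unfolding has_vector_derivative_def
  proof (rule has_derivative_transform_eventually[OF 1])
    show "\<forall>\<^sub>F \<tau> in at t within S. transition c c' (snd c (\<gamma> \<tau>)) = snd c' (\<gamma> \<tau>)"
      using ev by (rule eventually_mono) (rule transition_chart[OF assms(1)])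
  qed (use transition_chart[OF assms(1,3)] \<open>t \<in> S\<close> in auto)
qed

lemma tvector_of_coords_eq:
  "tvector_of_coords A c z a = (\<lambda>c'. if c' \<in> A \<and> z \<in> fst c' then dtrans c c' z a else 0)"
  unfolding tvector_of_coords_def dtrans_def ..

lemma tangent_space_iff:
  "v \<in> tangent_space A z \<longleftrightarrow> (\<forall>c. \<not> (c \<in> A \<and> z \<in> fst c) \<longrightarrow> v c = 0) \<and>
    (\<forall>c\<in>A. \<forall>c'\<in>A. z \<in> fst c \<and> z \<in> fst c' \<longrightarrow> v c' = dtrans c c' z (v c))"
  by (simp add: tangent_space_def dtrans_def)

lemma tvector_of_coords_in_tangent_space:
  "c \<in> A \<Longrightarrow> z \<in> fst c \<Longrightarrow> tvector_of_coords A c z a \<in> tangent_space A z"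
  unfolding tangent_space_iff tvector_of_coords_eq by (simp add: dtrans_trans)

lemma tvector_of_coords_self: "c \<in> A \<Longrightarrow> z \<in> fst c \<Longrightarrow> tvector_of_coords A c z a c = a"
  by (simp add: tvector_of_coords_eq dtrans_refl)

lemma tangent_space_eq_tvector_of_coords:
  assumes "v \<in> tangent_space A z" "c \<in> A" "z \<in> fst c"
  shows "v = tvector_of_coords A c z (v c)"
proof
  fix c'
  show "v c' = tvector_of_coords A c z (v c) c'"
  proof (cases "c' \<in> A \<and> z \<in> fst c'")
    case True
    then have "v c' = dtrans c c' z (v c)" using assms unfolding tangent_space_iff by blast
    with True show ?thesis by (simp add: tvector_of_coords_eq)
  next
    case False
    then have "v c' = 0" using assms unfolding tangent_space_iff by blast
    with False show ?thesis unfolding tvector_of_coords_eq by (simp only: if_False)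
  qed
qed

lemma tvector_of_coords_lin:
  assumes "c \<in> A" "z \<in> fst c"
  shows "tvector_of_coords A c z (\<alpha> *s a + \<beta> *s b) =
    (\<lambda>c'. \<alpha> *s tvector_of_coords A c z a c' + \<beta> *s tvector_of_coords A c z b c')"
  using assms unfolding tvector_of_coords_eq by (intro ext) (simp add: dtrans_add dtrans_scale)

lemma zero_in_tangent_space: "(\<lambda>c. 0) \<in> tangent_space A z"
  unfolding tangent_space_iff by (simp add: dtrans_zero)

end

section \<open>The Hermitian norm in a chart\<close>

locale hermitian_mfd = complex_mfd A
  for A :: "('a::{t2_space, second_countable_topology}, 'n::finite) chart set" +
  fixes h :: "'a \<Rightarrow> ('a, 'n) tvector \<Rightarrow> ('a, 'n) tvector \<Rightarrow> complex"
  assumes met: "hermitian_metric A h"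
begin

definition hform :: "('a, 'n) chart \<Rightarrow> (complex, 'n) vec \<Rightarrow> (complex, 'n) vec \<Rightarrow> (complex, 'n) vec \<Rightarrow> complex"
  where "hform c x a b =
    h (chart_inv c x) (tvector_of_coords A c (chart_inv c x) a) (tvector_of_coords A c (chart_inv c x) b)"

definition cnorm :: "('a, 'n) chart \<Rightarrow> (complex, 'n) vec \<Rightarrow> (complex, 'n) vec \<Rightarrow> real"
  where "cnorm c x a = sqrt (Re (hform c x a a))"

lemma tnorm_eq_cnorm:
  assumes "v \<in> tangent_space A z" "c \<in> A" "z \<in> fst c"
  shows "tnorm h z v = cnorm c (snd c z) (v c)"
  unfolding tnorm_def cnorm_def hform_def chart_inv_left[OF assms(2,3)]
    tangent_space_eq_tvector_of_coords[OF assms, symmetric] ..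

context
  fixes c :: "('a, 'n) chart" and x :: "(complex, 'n) vec"
  assumes c: "c \<in> A" and x: "x \<in> im c"
begin

lemma hform_lin: "hform c x (\<alpha> *s a + \<beta> *s b) w = \<alpha> * hform c x a w + \<beta> * hform c x b w"
  unfolding hform_def tvector_of_coords_lin[OF c chart_inv_in[OF c x]]
  using met tvector_of_coords_in_tangent_space[OF c chart_inv_in[OF c x]]
  unfolding hermitian_metric_def by blast

lemma hform_cnj: "hform c x b a = cnj (hform c x a b)"
  unfolding hform_def
  using met tvector_of_coords_in_tangent_space[OF c chart_inv_in[OF c x]]
  unfolding hermitian_metric_def by blast

lemma hform_pos: assumes "a \<noteq> 0" shows "0 < Re (hform c x a a)"
proof -
  have "tvector_of_coords A c (chart_inv c x) a \<noteq> (\<lambda>c. 0)"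
    using tvector_of_coords_self[OF c chart_inv_in[OF c x], of a] assms by (metis)
  then show ?thesis
    unfolding hform_def
    using met tvector_of_coords_in_tangent_space[OF c chart_inv_in[OF c x], of a]
    unfolding hermitian_metric_def by blast
qed

lemma hform_zero: "hform c x 0 w = 0"
  using hform_lin[of 0 0 0 0 w] by simp

lemma hform_sum: "finite I \<Longrightarrow> hform c x (\<Sum>i\<in>I. \<alpha> i *s b i) w = (\<Sum>i\<in>I. \<alpha> i * hform c x (b i) w)"
proof (induction I rule: finite_induct)
  case (insert i I)
  then show ?case using hform_lin[of "\<alpha> i" "b i" 1 "\<Sum>i\<in>I. \<alpha> i *s b i" w] by simp
qed (simp add: hform_zero)

text \<open>Sesquilinearity is available only for tangent vectors at one point. Expanding in the standard basis reduces
joint continuity in base point and vector to the continuity of finitely many coefficients.\<close>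

lemma hform_expand:
  "hform c x a a = (\<Sum>i\<in>UNIV. a $ i * cnj (\<Sum>j\<in>UNIV. a $ j * hform c x (axis j 1) (axis i 1)))"
proof -
  have exp: "hform c x a w = (\<Sum>i\<in>UNIV. a $ i * hform c x (axis i 1) w)" for w
    using hform_sum[of UNIV "\<lambda>i. a $ i" "\<lambda>i. axis i 1" w] basis_expansion[of a] by simp
  show ?thesis
    by (subst exp, subst hform_cnj, subst exp) simp
qed

lemma hform_scale: "hform c x (\<alpha> *s a) (\<alpha> *s a) = complex_of_real ((cmod \<alpha>)\<^sup>2) * hform c x a a"
proof -
  have l: "hform c x (\<alpha> *s a) w = \<alpha> * hform c x a w" for a w
    using hform_lin[of \<alpha> a 0 a w] by simp
  have "hform c x (\<alpha> *s a) (\<alpha> *s a) = \<alpha> * cnj (\<alpha> * hform c x a a)"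
    by (subst l, subst hform_cnj, subst l) simp
  also have "\<dots> = \<alpha> * cnj \<alpha> * hform c x a a"
    using hform_cnj[of a a] by simp
  also have "\<alpha> * cnj \<alpha> = complex_of_real ((cmod \<alpha>)\<^sup>2)" by (rule complex_norm_square[symmetric])
  finally show ?thesis .
qed

lemma cnorm_scaleR: "cnorm c x (s *\<^sub>R a) = \<bar>s\<bar> * cnorm c x a"
  unfolding cnorm_def scaleR_eq_vector_scalar_mult hform_scale
  by (simp add: real_sqrt_mult)

end

lemma continuous_on_hform_axis: "c \<in> A \<Longrightarrow> continuous_on (im c) (\<lambda>x. hform c x a b)"
proof -
  assume "c \<in> A"
  then have "smooth_on (\<lambda>x. hform c x a b) (im c)"
    using met unfolding hermitian_metric_def hform_def by blast
  then have "C_k_on 0 (\<lambda>x. hform c x a b) (im c)" unfolding smooth_on_def by blast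
  then show ?thesis by simp
qed

lemma continuous_on_cnorm:
  assumes c: "c \<in> A" and f: "continuous_on S f" "f ` S \<subseteq> im c" and g: "continuous_on S g"
  shows "continuous_on S (\<lambda>t. cnorm c (f t) (g t))"
proof -
  have "continuous_on S (\<lambda>t. hform c (f t) a b)" for a b
    using continuous_on_compose2[OF continuous_on_hform_axis[OF c] f(1) f(2)] .
  then have "continuous_on S (\<lambda>t. \<Sum>i\<in>UNIV. g t $ i * cnj (\<Sum>j\<in>UNIV. g t $ j * hform c (f t) (axis j 1) (axis i 1)))"
    by (intro continuous_intros g)
  moreover have "(\<Sum>i\<in>UNIV. g t $ i * cnj (\<Sum>j\<in>UNIV. g t $ j * hform c (f t) (axis j 1) (axis i 1))) = hform c (f t) (g t) (g t)"
    if "t \<in> S" for t using hform_expand[OF c, of "f t" "g t"] f(2) that by auto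
  ultimately have "continuous_on S (\<lambda>t. hform c (f t) (g t) (g t))"
    by (simp cong: continuous_on_cong)
  then show ?thesis unfolding cnorm_def by (intro continuous_intros)
qed

lemma cnorm_nonneg: "c \<in> A \<Longrightarrow> x \<in> im c \<Longrightarrow> 0 \<le> cnorm c x a"
  using hform_pos[of c x a] hform_zero[of c x] by (cases "a = 0") (auto simp: cnorm_def)

text \<open>By homogeneity it suffices to bound the continuous positive function \<open>cnorm c\<close> on the product of \<open>K\<close> with
the unit sphere, which is compact.\<close>

lemma cnorm_bounds:
  assumes c: "c \<in> A" and K: "compact K" "K \<subseteq> im c"
  obtains m M where "0 < m" "0 < M" "\<And>x a. x \<in> K \<Longrightarrow> m * norm a \<le> cnorm c x a"
    "\<And>x a. x \<in> K \<Longrightarrow> cnorm c x a \<le> M * norm a"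
proof (cases "K = {}")
  case True
  then show ?thesis using that[of 1 1] by simp
next
  case False
  let ?S = "sphere (0 :: (complex, 'n) vec) 1"
  let ?f = "\<lambda>(x, a). cnorm c x a"
  have cpt: "compact (K \<times> ?S)" using K by (intro compact_Times) auto
  have "?S \<noteq> {}" by simp
  then have ne: "K \<times> ?S \<noteq> {}" using False by simp
  have cont: "continuous_on (K \<times> ?S) ?f"
    unfolding case_prod_unfold
    by (rule continuous_on_cnorm[OF c]) (use K in \<open>auto intro!: continuous_intros\<close>)
  obtain p where p: "p \<in> K \<times> ?S" "\<And>q. q \<in> K \<times> ?S \<Longrightarrow> ?f p \<le> ?f q"
    using continuous_attains_inf[OF cpt ne cont] by blast
  obtain P where P: "P \<in> K \<times> ?S" "\<And>q. q \<in> K \<times> ?S \<Longrightarrow> ?f q \<le> ?f P"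
    using continuous_attains_sup[OF cpt ne cont] by blast
  have pos: "0 < ?f p" if "p \<in> K \<times> ?S" for p
  proof -
    have "fst p \<in> im c" "snd p \<noteq> 0" using that K by auto
    from hform_pos[OF c this] show ?thesis by (simp add: cnorm_def case_prod_unfold)
  qed
  have scale: "cnorm c x a = norm a * cnorm c x ((1 / norm a) *\<^sub>R a)" if "x \<in> K" "a \<noteq> 0" for x a
    using cnorm_scaleR[OF c, of x "1 / norm a" a] that K by auto
  have zero: "cnorm c x 0 = 0" if "x \<in> K" for x
    using cnorm_scaleR[OF c, of x 0 0] that K by auto
  show ?thesis
  proof (rule that[of "?f p" "?f P"])
    fix x a assume x: "x \<in> K"
    have "?f p * norm a \<le> cnorm c x a \<and> cnorm c x a \<le> ?f P * norm a"
    proof (cases "a = 0")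
      case False
      then have "(x, (1 / norm a) *\<^sub>R a) \<in> K \<times> ?S" using x by simp
      from p(2)[OF this] P(2)[OF this] show ?thesis
        unfolding scale[OF x False] by (simp add: mult.commute[of _ "norm a"] mult_left_mono del: scaleR_scaleR)
    qed (simp add: zero[OF x])
    then show "?f p * norm a \<le> cnorm c x a" "cnorm c x a \<le> ?f P * norm a" by auto
  qed (use pos p P in auto)
qed

end


section \<open>Curves and the distance of a Hermitian metric\<close>

context complex_mfd
begin

lemma C1_curveI:
  assumes ab: "a < b" and cont: "continuous_on {a..b} \<gamma>"
    and V: "\<And>c. c \<in> A \<Longrightarrow> \<exists>V. (\<forall>t\<in>{a..b} \<inter> \<gamma> -` fst c.
        ((\<lambda>\<tau>. snd c (\<gamma> \<tau>)) has_vector_derivative V t) (at t within {a..b})) \<and>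
        continuous_on ({a..b} \<inter> \<gamma> -` fst c) V"
  shows "C1_curve A \<gamma> a b"
  unfolding C1_curve_def
proof (intro conjI ballI)
  fix c assume "c \<in> A"
  then obtain V where V: "\<forall>t\<in>{a..b} \<inter> \<gamma> -` fst c.
      ((\<lambda>\<tau>. snd c (\<gamma> \<tau>)) has_vector_derivative V t) (at t within {a..b})"
    "continuous_on ({a..b} \<inter> \<gamma> -` fst c) V" using V by blast
  show "(\<lambda>\<tau>. snd c (\<gamma> \<tau>)) differentiable (at t within {a..b})" if "t \<in> {a..b} \<inter> \<gamma> -` fst c" for t
    using V(1) that by (blast intro: differentiableI_vector)
  have "vector_derivative (\<lambda>\<tau>. snd c (\<gamma> \<tau>)) (at t within {a..b}) = V t" if "t \<in> {a..b} \<inter> \<gamma> -` fst c" for t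
    using vector_derivative_within_closed_interval[OF ab] V(1) that by blast
  then show "continuous_on ({a..b} \<inter> \<gamma> -` fst c) (\<lambda>t. vector_derivative (\<lambda>\<tau>. snd c (\<gamma> \<tau>)) (at t within {a..b}))"
    by (intro continuous_on_eq[OF V(2)]) (rule sym)
qed (rule cont)

lemma
  assumes "C1_curve A \<gamma> a b"
  shows C1_curve_continuous: "continuous_on {a..b} \<gamma>"
    and C1_curve_derivative: "c \<in> A \<Longrightarrow> t \<in> {a..b} \<Longrightarrow> \<gamma> t \<in> fst c \<Longrightarrow>
      ((\<lambda>\<tau>. snd c (\<gamma> \<tau>)) has_vector_derivative
        vector_derivative (\<lambda>\<tau>. snd c (\<gamma> \<tau>)) (at t within {a..b})) (at t within {a..b})"
    and C1_curve_continuous_derivative: "c \<in> A \<Longrightarrow> continuous_on ({a..b} \<inter> \<gamma> -` fst c)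
      (\<lambda>t. vector_derivative (\<lambda>\<tau>. snd c (\<gamma> \<tau>)) (at t within {a..b}))"
  using assms unfolding C1_curve_def vector_derivative_works[symmetric] by auto

lemma C1_curve_cong:
  assumes "C1_curve A \<gamma> a b" "a < b" and eq: "\<And>t. t \<in> {a..b} \<Longrightarrow> \<gamma>' t = \<gamma> t"
  shows "C1_curve A \<gamma>' a b"
proof (rule C1_curveI[OF assms(2)])
  show "continuous_on {a..b} \<gamma>'"
    using C1_curve_continuous[OF assms(1)] by (rule continuous_on_eq) (rule eq[symmetric])
  fix c assume c: "c \<in> A"
  let ?V = "\<lambda>t. vector_derivative (\<lambda>\<tau>. snd c (\<gamma> \<tau>)) (at t within {a..b})"
  have S: "{a..b} \<inter> \<gamma>' -` fst c = {a..b} \<inter> \<gamma> -` fst c" using eq by auto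
  have V: "((\<lambda>\<tau>. snd c (\<gamma>' \<tau>)) has_vector_derivative ?V t) (at t within {a..b})"
    if "t \<in> {a..b} \<inter> \<gamma> -` fst c" for t
    by (rule has_vector_derivative_transform[OF _ _ C1_curve_derivative[OF assms(1) c]]) (use that eq in auto)
  show "\<exists>V. (\<forall>t\<in>{a..b} \<inter> \<gamma>' -` fst c.
        ((\<lambda>\<tau>. snd c (\<gamma>' \<tau>)) has_vector_derivative V t) (at t within {a..b})) \<and>
        continuous_on ({a..b} \<inter> \<gamma>' -` fst c) V"
    unfolding S by (intro exI[of _ ?V] conjI ballI V C1_curve_continuous_derivative[OF assms(1) c])
qed

lemma C1_curve_rescale:
  assumes C: "C1_curve A \<gamma> (k * a) (k * b)" and k: "0 < k" and ab: "a < b"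
  shows "C1_curve A (\<lambda>t. \<gamma> (k * t)) a b"
proof (rule C1_curveI[OF ab])
  have im_eq: "(\<lambda>t. k * t) ` {a..b} = {k * a..k * b}"
    using k ab by (simp add: image_mult_atLeastAtMost)
  have m: "k * t \<in> {k * a..k * b}" if "t \<in> {a..b}" for t using that k by auto
  show "continuous_on {a..b} (\<lambda>t. \<gamma> (k * t))"
    by (rule continuous_on_compose2[OF C1_curve_continuous[OF C]]) (use m in \<open>auto intro!: continuous_intros\<close>)
  fix c assume c: "c \<in> A"
  let ?V = "\<lambda>t. vector_derivative (\<lambda>\<tau>. snd c (\<gamma> \<tau>)) (at t within {k * a..k * b})"
  have 1: "((\<lambda>\<tau>. snd c (\<gamma> (k * \<tau>))) has_vector_derivative k *\<^sub>R ?V (k * t)) (at t within {a..b})"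
    if "t \<in> {a..b}" "\<gamma> (k * t) \<in> fst c" for t
  proof -
    have "((\<lambda>t. k * t) has_vector_derivative k) (at t within {a..b})"
      by (auto intro!: derivative_eq_intros simp: has_real_derivative_iff_has_vector_derivative[symmetric])
    from vector_diff_chain_within[OF this, of "\<lambda>\<tau>. snd c (\<gamma> \<tau>)" "?V (k * t)"]
    show ?thesis
      using C1_curve_derivative[OF C c m[OF that(1)] that(2)] unfolding im_eq by (simp add: o_def)
  qed
  have 2: "continuous_on ({a..b} \<inter> (\<lambda>t. \<gamma> (k * t)) -` fst c) (\<lambda>t. k *\<^sub>R ?V (k * t))"
    by (intro continuous_on_scaleR continuous_on_const
        continuous_on_compose2[OF C1_curve_continuous_derivative[OF C c]])
      (use m in \<open>auto intro!: continuous_intros\<close>)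
  show "\<exists>V. (\<forall>t\<in>{a..b} \<inter> (\<lambda>t. \<gamma> (k * t)) -` fst c.
        ((\<lambda>\<tau>. snd c (\<gamma> (k * \<tau>))) has_vector_derivative V t) (at t within {a..b})) \<and>
        continuous_on ({a..b} \<inter> (\<lambda>t. \<gamma> (k * t)) -` fst c) V"
    by (intro exI[of _ "\<lambda>t. k *\<^sub>R ?V (k * t)"] conjI ballI 1 2) auto
qed

lemma C1_curve_segment:
  assumes c: "c \<in> A" and B: "ball x0 r \<subseteq> im c" and y: "y1 \<in> ball x0 r" "y2 \<in> ball x0 r"
  shows "C1_curve A (\<lambda>t. chart_inv c (y1 + (t - a) *\<^sub>R (y2 - y1))) a (a + 1)"
proof (rule C1_curveI)
  let ?L = "\<lambda>t. y1 + (t - a) *\<^sub>R (y2 - y1)"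
  have L: "?L t \<in> im c" if "t \<in> {a..a + 1}" for t
  proof -
    have "?L t = (1 - (t - a)) *\<^sub>R y1 + (t - a) *\<^sub>R y2" by (simp add: algebra_simps)
    also have "\<dots> \<in> ball x0 r" using that y by (intro convexD[OF convex_ball]) auto
    finally show ?thesis using B by blast
  qed
  have cL: "continuous_on T ?L" for T by (intro continuous_intros)
  show "continuous_on {a..a + 1} (\<lambda>t. chart_inv c (?L t))"
    by (rule continuous_on_compose2[OF continuous_chart_inv[OF c] cL]) (use L in auto)
  fix c' assume c': "c' \<in> A"
  let ?O = "snd c ` (fst c \<inter> fst c')"
  let ?V = "\<lambda>t. frechet_derivative (transition c c') (at (?L t)) (y2 - y1)"
  have LO: "?L t \<in> ?O" if "t \<in> {a..a + 1} \<inter> (\<lambda>t. chart_inv c (?L t)) -` fst c'" for t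
    using that L[of t] chart_inv_in[OF c] chart_inv_right[OF c] by (intro image_eqI[of _ _ "chart_inv c (?L t)"]) auto
  have V: "((\<lambda>\<tau>. snd c' (chart_inv c (?L \<tau>))) has_vector_derivative ?V t) (at t within {a..a + 1})"
    if t: "t \<in> {a..a + 1} \<inter> (\<lambda>t. chart_inv c (?L t)) -` fst c'" for t
  proof -
    obtain D where D: "(transition c c' has_derivative D) (at (?L t))" "\<And>a v. D (a *s v) = a *s D v"
      using holomorphic_vec_onE[OF transition_holomorphic[OF c c'] LO[OF t]] by blast
    have eq: "frechet_derivative (transition c c') (at (?L t)) = D"
      using frechet_derivative_at[OF D(1)] by simp
    have "(?L has_derivative (\<lambda>r. r *\<^sub>R (y2 - y1))) (at t within {a..a + 1})"
      by (auto intro!: derivative_eq_intros)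
    from has_derivative_compose[OF this D(1)]
    show ?thesis
      unfolding has_vector_derivative_def eq
      unfolding transition_def
        scaleR_eq_vector_scalar_mult[of _ "y2 - y1"] scaleR_eq_vector_scalar_mult[of _ "D (y2 - y1)"] D(2) .
  qed
  have V': "continuous_on ({a..a + 1} \<inter> (\<lambda>t. chart_inv c (?L t)) -` fst c') ?V"
    by (rule continuous_on_compose2[OF holomorphic_vec_derivative_continuous_on[OF
          transition_holomorphic[OF c c'] open_overlap[OF c c']] cL]) (use LO in blast)
  show "\<exists>V. (\<forall>t\<in>{a..a + 1} \<inter> (\<lambda>t. chart_inv c (?L t)) -` fst c'.
        ((\<lambda>\<tau>. snd c' (chart_inv c (?L \<tau>))) has_vector_derivative V t) (at t within {a..a + 1})) \<and>
        continuous_on ({a..a + 1} \<inter> (\<lambda>t. chart_inv c (?L t)) -` fst c') V"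
    by (intro exI[of _ ?V] conjI ballI V V')
qed simp

text \<open>Reachability by \<open>n\<close> smooth arcs, arc number \<open>i\<close> being run through in the time from \<open>i\<close> to \<open>i + 1\<close>; with unit steps
an arc can be appended without reparametrising the previous ones.\<close>

definition reach :: "nat \<Rightarrow> 'a \<Rightarrow> 'a \<Rightarrow> bool"
  where "reach n z w \<longleftrightarrow> (\<exists>\<gamma>. \<gamma> 0 = z \<and> \<gamma> (real n) = w \<and>
    (\<forall>i<n. C1_curve A \<gamma> (real i) (real i + 1)))"

lemma reach_Suc:
  assumes R: "reach n z (chart_inv c y1)" and c: "c \<in> A" and B: "ball x0 r \<subseteq> im c"
    and y: "y1 \<in> ball x0 r" "y2 \<in> ball x0 r"
  shows "reach (Suc n) z (chart_inv c y2)"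
proof -
  obtain \<gamma> where \<gamma>: "\<gamma> 0 = z" "\<gamma> (real n) = chart_inv c y1"
    "\<And>i. i < n \<Longrightarrow> C1_curve A \<gamma> (real i) (real i + 1)"
    using R by (auto simp: reach_def)
  define \<sigma> where "\<sigma> = (\<lambda>t. chart_inv c (y1 + (t - real n) *\<^sub>R (y2 - y1)))"
  define \<gamma>' where "\<gamma>' = (\<lambda>t. if t \<le> real n then \<gamma> t else \<sigma> t)"
  have "C1_curve A \<gamma>' (real i) (real i + 1)" if "i < Suc n" for i
  proof (cases "i = n")
    case True
    have "C1_curve A \<sigma> (real n) (real n + 1)"
      unfolding \<sigma>_def by (rule C1_curve_segment[OF c B y])
    then show ?thesis
      unfolding True by (rule C1_curve_cong) (auto simp: \<gamma>'_def \<gamma>(2) \<sigma>_def)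
  next
    case False
    then have "i < n" using that by simp
    then show ?thesis
      by (intro C1_curve_cong[OF \<gamma>(3)]) (auto simp: \<gamma>'_def)
  qed
  then show ?thesis
    unfolding reach_def using \<gamma>(1) by (intro exI[of _ \<gamma>']) (auto simp: \<gamma>'_def \<sigma>_def)
qed

text \<open>Connectedness as an induction principle: a property that can be moved between any two points of a coordinate
ball holds everywhere once it holds somewhere. It yields both the curves and the chains of discs that make
the infima in the two distances range over nonempty sets.\<close>

lemma connected_mfd_induct:
  assumes "P z" and step: "\<And>c x0 r y1 y2. c \<in> A \<Longrightarrow> 0 < r \<Longrightarrow> ball x0 r \<subseteq> im c \<Longrightarrow>
    y1 \<in> ball x0 r \<Longrightarrow> y2 \<in> ball x0 r \<Longrightarrow> P (chart_inv c y1) \<Longrightarrow> P (chart_inv c y2)"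
  shows "P w"
proof (rule connected_induction_simple[OF connected_mfd, of z w P])
  fix a :: 'a
  obtain c r where c: "c \<in> A" "a \<in> fst c" "0 < r" "cball (snd c a) r \<subseteq> im c"
    by (rule ex_chart_cball[of UNIV a]) simp_all
  then have sub: "ball (snd c a) r \<subseteq> im c" using ball_subset_cball by blast
  let ?T = "chart_inv c ` ball (snd c a) r"
  have "a \<in> ?T" using chart_inv_left[OF c(1,2)] c(3) by (intro image_eqI[of _ _ "snd c a"]) auto
  moreover have "open ?T" by (rule open_chart_inv_image[OF c(1) sub open_ball])
  moreover have "\<forall>x\<in>?T. \<forall>y\<in>?T. P x \<longrightarrow> P y" using step[OF c(1,3) sub] by blast
  ultimately show "\<exists>T. openin (top_of_set UNIV) T \<and> a \<in> T \<and> (\<forall>x\<in>T. \<forall>y\<in>T. P x \<longrightarrow> P y)"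
    by (intro exI[of _ ?T]) auto
qed (use assms(1) in auto)

lemma ex_piecewise_C1_curve: "\<exists>\<gamma>. piecewise_C1_curve A \<gamma> \<and> \<gamma> 0 = z \<and> \<gamma> 1 = w"
proof -
  have "\<exists>n>0. reach n z w"
  proof (rule connected_mfd_induct[of "\<lambda>w. \<exists>n>0. reach n z w"])
    obtain c r where c: "c \<in> A" "z \<in> fst c" "0 < r" "cball (snd c z) r \<subseteq> im c"
      by (rule ex_chart_cball[of UNIV z]) simp_all
    have "reach 0 z z" by (auto simp: reach_def)
    then have "reach (Suc 0) z (chart_inv c (snd c z))"
      using reach_Suc[of 0 z c "snd c z" "snd c z" r "snd c z"] c chart_inv_left[OF c(1,2)] ball_subset_cball
      by fastforce
    then show "\<exists>n>0. reach n z z" using chart_inv_left[OF c(1,2)] by auto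
  next
    fix c x0 r y1 y2
    assume "c \<in> A" "0 < r" "ball x0 r \<subseteq> im c" "y1 \<in> ball x0 r" "y2 \<in> ball x0 r"
      "\<exists>n>0. reach n z (chart_inv c y1)"
    then show "\<exists>n>0. reach n z (chart_inv c y2)" using reach_Suc by blast
  qed
  then obtain n \<gamma> where n: "n > 0" and \<gamma>: "\<gamma> 0 = z" "\<gamma> (real n) = w"
    "\<And>i. i < n \<Longrightarrow> C1_curve A \<gamma> (real i) (real i + 1)"
    by (auto simp: reach_def)
  have "C1_curve A (\<lambda>t. \<gamma> (real n * t)) (real i / real n) (real (Suc i) / real n)" if "i < n" for i
    by (rule C1_curve_rescale) (use \<gamma>(3)[OF that] n in \<open>auto simp: divide_strict_right_mono add.commute\<close>)
  then have "piecewise_C1_curve A (\<lambda>t. \<gamma> (real n * t))"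
    unfolding piecewise_C1_curve_def using n
    by (intro exI[of _ n] exI[of _ "\<lambda>i. real i / real n"]) (auto simp: divide_strict_right_mono)
  then show ?thesis using \<gamma> by (intro exI[of _ "\<lambda>t. \<gamma> (real n * t)"]) auto
qed

lemma C1_curve_velocity:
  assumes "C1_curve A \<gamma> a b" "t \<in> {a<..<b}"
  shows "velocity A \<gamma> t = (\<lambda>c. if c \<in> A \<and> \<gamma> t \<in> fst c
      then vector_derivative (\<lambda>\<tau>. snd c (\<gamma> \<tau>)) (at t within {a..b}) else 0)"
    and "c \<in> A \<Longrightarrow> \<gamma> t \<in> fst c \<Longrightarrow> ((\<lambda>\<tau>. snd c (\<gamma> \<tau>)) has_vector_derivative velocity A \<gamma> t c) (at t)"
proof -
  have at: "at t within {a..b} = at t" using assms(2) by (simp add: at_within_Icc_at)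
  show 1: "velocity A \<gamma> t = (\<lambda>c. if c \<in> A \<and> \<gamma> t \<in> fst c
      then vector_derivative (\<lambda>\<tau>. snd c (\<gamma> \<tau>)) (at t within {a..b}) else 0)"
    unfolding velocity_def at ..
  assume "c \<in> A" "\<gamma> t \<in> fst c"
  then show "((\<lambda>\<tau>. snd c (\<gamma> \<tau>)) has_vector_derivative velocity A \<gamma> t c) (at t)"
    using C1_curve_derivative[OF assms(1), of c t] assms(2) unfolding 1 at by simp
qed

lemma tangent_spaceI:
  assumes "\<And>c. \<not> (c \<in> A \<and> z \<in> fst c) \<Longrightarrow> v c = 0"
    and "\<And>c c'. c \<in> A \<Longrightarrow> c' \<in> A \<Longrightarrow> z \<in> fst c \<Longrightarrow> z \<in> fst c' \<Longrightarrow> v c' = dtrans c c' z (v c)"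
  shows "v \<in> tangent_space A z"
  unfolding tangent_space_iff using assms by blast

text \<open>The one-sided derivatives at the end points are included, so that the speed extends continuously to the
closed interval.\<close>

lemma C1_curve_velocity_in_tangent_space:
  assumes C: "C1_curve A \<gamma> a b" and ab: "a < b" and t: "t \<in> {a..b}"
  shows "(\<lambda>c. if c \<in> A \<and> \<gamma> t \<in> fst c
      then vector_derivative (\<lambda>\<tau>. snd c (\<gamma> \<tau>)) (at t within {a..b}) else 0) \<in> tangent_space A (\<gamma> t)"
proof -
  have key: "vector_derivative (\<lambda>\<tau>. snd c' (\<gamma> \<tau>)) (at t within {a..b}) =
      dtrans c c' (\<gamma> t) (vector_derivative (\<lambda>\<tau>. snd c (\<gamma> \<tau>)) (at t within {a..b}))"
    if c: "c \<in> A" "c' \<in> A" "\<gamma> t \<in> fst c" "\<gamma> t \<in> fst c'" for c c'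
  proof (rule vector_derivative_within_closed_interval[OF ab t], rule velocity_change_of_chart[of c c' \<gamma> t, OF c t])
    have "(\<gamma> \<longlongrightarrow> \<gamma> t) (at t within {a..b})"
      using C1_curve_continuous[OF C] t by (simp add: continuous_on_def)
    then show "\<forall>\<^sub>F \<tau> in at t within {a..b}. \<gamma> \<tau> \<in> fst c"
      using open_chart[OF c(1)] c(3) by (rule topological_tendstoD)
  qed (rule C1_curve_derivative[OF C c(1) t c(3)])
  show ?thesis
  proof (rule tangent_spaceI)
    fix c c' assume c: "c \<in> A" "c' \<in> A" "\<gamma> t \<in> fst c" "\<gamma> t \<in> fst c'"
    show "(if c' \<in> A \<and> \<gamma> t \<in> fst c' then vector_derivative (\<lambda>\<tau>. snd c' (\<gamma> \<tau>)) (at t within {a..b}) else 0) =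
      dtrans c c' (\<gamma> t) (if c \<in> A \<and> \<gamma> t \<in> fst c
        then vector_derivative (\<lambda>\<tau>. snd c (\<gamma> \<tau>)) (at t within {a..b}) else 0)"
      unfolding key[OF c] by (simp only: c simp_thms if_True)
  qed (simp only: if_False)
qed

end

context hermitian_mfd
begin

abbreviation speed :: "(real \<Rightarrow> 'a) \<Rightarrow> real \<Rightarrow> real"
  where "speed \<gamma> t \<equiv> tnorm h (\<gamma> t) (velocity A \<gamma> t)"

lemma speed_eq_cnorm:
  assumes "C1_curve A \<gamma> a b" "t \<in> {a<..<b}" "c \<in> A" "\<gamma> t \<in> fst c"
  shows "speed \<gamma> t = cnorm c (snd c (\<gamma> t)) (velocity A \<gamma> t c)"
  using C1_curve_velocity_in_tangent_space[OF assms(1), of t] assms(2-)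
  by (intro tnorm_eq_cnorm) (auto simp: C1_curve_velocity(1)[OF assms(1,2)])

text \<open>The length is a gauge integral, which takes the value 0 when the integrand fails to be integrable; lower bounds for lengths
therefore depend on this lemma.\<close>

lemma speed_integrable_C1:
  assumes C: "C1_curve A \<gamma> a b" and ab: "a < b"
  shows "speed \<gamma> integrable_on {a..b}"
proof -
  define W where "W = (\<lambda>t c. if c \<in> A \<and> \<gamma> t \<in> fst c
      then vector_derivative (\<lambda>\<tau>. snd c (\<gamma> \<tau>)) (at t within {a..b}) else 0)"
  have "continuous_on {a..b} (\<lambda>t. tnorm h (\<gamma> t) (W t))"
    unfolding continuous_on_eq_continuous_within
  proof
    fix t0 assume t0: "t0 \<in> {a..b}"
    obtain c where c: "c \<in> A" "\<gamma> t0 \<in> fst c" by (rule ex_chart)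
    let ?T = "{a..b} \<inter> \<gamma> -` fst c"
    have eq: "tnorm h (\<gamma> t) (W t) = cnorm c (snd c (\<gamma> t))
        (vector_derivative (\<lambda>\<tau>. snd c (\<gamma> \<tau>)) (at t within {a..b}))" if "t \<in> ?T" for t
      using tnorm_eq_cnorm[of "W t" "\<gamma> t" c] C1_curve_velocity_in_tangent_space[OF C ab, of t] that c
      unfolding W_def by simp
    have "continuous_on ?T (\<lambda>t. cnorm c (snd c (\<gamma> t))
        (vector_derivative (\<lambda>\<tau>. snd c (\<gamma> \<tau>)) (at t within {a..b})))"
    proof (rule continuous_on_cnorm[OF c(1)])
      show "continuous_on ?T (\<lambda>t. snd c (\<gamma> t))"
        by (rule continuous_on_compose2[OF continuous_chart[OF c(1)]])
          (use continuous_on_subset[OF C1_curve_continuous[OF C]] in auto)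
    qed (use C1_curve_continuous_derivative[OF C c(1)] in auto)
    then have "continuous_on ?T (\<lambda>t. tnorm h (\<gamma> t) (W t))" by (rule continuous_on_eq) (rule eq[symmetric])
    then have cT: "continuous (at t0 within ?T) (\<lambda>t. tnorm h (\<gamma> t) (W t))"
      using t0 c by (auto simp: continuous_on_eq_continuous_within)
    have "openin (top_of_set {a..b}) ?T"
      by (rule continuous_openin_preimage_gen[OF C1_curve_continuous[OF C] open_chart[OF c(1)]])
    then obtain U where U: "open U" "?T = {a..b} \<inter> U" by (auto simp: openin_open)
    have "at t0 within ?T = at t0 within {a..b}"
    proof (rule at_within_nhd)
      show "t0 \<in> U" using U(2) t0 c(2) by blast
      show "?T \<inter> U - {t0} = {a..b} \<inter> U - {t0}" unfolding U(2) by blast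
    qed (rule U(1))
    with cT show "continuous (at t0 within {a..b}) (\<lambda>t. tnorm h (\<gamma> t) (W t))" by simp
  qed
  then have "(\<lambda>t. tnorm h (\<gamma> t) (W t)) integrable_on {a..b}" by (rule integrable_continuous_real)
  then show ?thesis
    by (rule integrable_spike_finite[of "{a, b}", rotated 2])
      (auto simp: W_def C1_curve_velocity(1)[OF C])
qed

text \<open>All that is needed of a piecewise smooth curve: away from a finite set \<open>P\<close> every parameter is interior to a
smooth arc.\<close>

lemma piecewise_C1_curveE:
  assumes "piecewise_C1_curve A \<gamma>"
  obtains P where "finite P" "continuous_on {0..1} \<gamma>" "speed \<gamma> integrable_on {0..1}"
    "\<And>t. t \<in> {0..1} - P \<Longrightarrow> \<exists>a b. t \<in> {a<..<b} \<and> C1_curve A \<gamma> a b"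
proof -
  obtain m :: nat and p where p: "p 0 = 0" "p m = 1"
    and step: "\<And>i. i < m \<Longrightarrow> p i < p (Suc i)" "\<And>i. i < m \<Longrightarrow> C1_curve A \<gamma> (p i) (p (Suc i))"
    using assms unfolding piecewise_C1_curve_def by blast
  have "k \<le> m \<Longrightarrow> 0 \<le> p k \<and> continuous_on {0..p k} \<gamma> \<and> speed \<gamma> integrable_on {0..p k} \<and>
      (\<forall>t\<in>{0..p k} - p ` {..k}. \<exists>a b. t \<in> {a<..<b} \<and> C1_curve A \<gamma> a b)" for k
  proof (induction k)
    case 0
    have "speed \<gamma> integrable_on {0..0}" using integrable_on_refl[of "speed \<gamma>" 0] by simp
    then show ?case using p(1) by simp
  next
    case (Suc k)
    then have IH: "0 \<le> p k" "continuous_on {0..p k} \<gamma>" "speed \<gamma> integrable_on {0..p k}"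
      "\<forall>t\<in>{0..p k} - p ` {..k}. \<exists>a b. t \<in> {a<..<b} \<and> C1_curve A \<gamma> a b" by auto
    have k: "p k < p (Suc k)" "C1_curve A \<gamma> (p k) (p (Suc k))" using step[of k] Suc.prems by auto
    have un: "{0..p (Suc k)} = {0..p k} \<union> {p k..p (Suc k)}" using IH(1) k(1) by auto
    have "continuous_on {0..p (Suc k)} \<gamma>"
      unfolding un by (rule continuous_on_closed_Un[OF _ _ IH(2) C1_curve_continuous[OF k(2)]]) auto
    moreover have "speed \<gamma> integrable_on {0..p (Suc k)}"
      by (rule Henstock_Kurzweil_Integration.integrable_combine[OF _ _ IH(3) speed_integrable_C1[OF k(2,1)]])
        (use IH(1) k(1) in auto)
    moreover have "\<exists>a b. t \<in> {a<..<b} \<and> C1_curve A \<gamma> a b" if "t \<in> {0..p (Suc k)} - p ` {..Suc k}" for t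
    proof (cases "t \<le> p k")
      case True
      then show ?thesis using IH(4) that by (auto simp: atMost_Suc)
    next
      case False
      then have "t \<in> {p k<..<p (Suc k)}" using that by (auto simp: order_less_le)
      then show ?thesis using k(2) by blast
    qed
    ultimately show ?case using IH(1) k(1) by auto
  qed
  from this[of m] show ?thesis using that[of "p ` {..m}"] p by auto
qed

lemma speed_nonneg:
  assumes "C1_curve A \<gamma> a b" "t \<in> {a<..<b}"
  shows "0 \<le> speed \<gamma> t"
proof -
  obtain c where c: "c \<in> A" "\<gamma> t \<in> fst c" by (rule ex_chart)
  show ?thesis unfolding speed_eq_cnorm[OF assms c] using c by (intro cnorm_nonneg) auto
qed

lemma curve_length_ge_chart_distance:
  assumes \<gamma>: "piecewise_C1_curve A \<gamma>" and c: "c \<in> A" and \<tau>: "0 \<le> \<tau>" "\<tau> \<le> 1"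
    and inK: "\<And>t. t \<in> {0..\<tau>} \<Longrightarrow> \<gamma> t \<in> fst c \<and> snd c (\<gamma> t) \<in> K"
    and m: "\<And>x a. x \<in> K \<Longrightarrow> m * norm a \<le> cnorm c x a" "0 < m"
  shows "m * norm (snd c (\<gamma> \<tau>) - snd c (\<gamma> 0)) \<le> curve_length A h \<gamma>"
proof -
  obtain P where P: "finite P" "continuous_on {0..1} \<gamma>" "speed \<gamma> integrable_on {0..1}"
    "\<And>t. t \<in> {0..1} - P \<Longrightarrow> \<exists>a b. t \<in> {a<..<b} \<and> C1_curve A \<gamma> a b"
    using piecewise_C1_curveE[OF \<gamma>] by blast
  \<comment> \<open>At the break points the velocity, and with it the sign of the speed, is uncontrolled; both are reset to 0 there.\<close>
  define v where "v = (\<lambda>t. if t \<in> P then 0 else velocity A \<gamma> t c)"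
  define g where "g = (\<lambda>t. if t \<in> P then 0 else speed \<gamma> t)"
  have g0: "0 \<le> g t" if "t \<in> {0..1}" for t
    using speed_nonneg P(4)[of t] that by (auto simp: g_def)
  have g1: "g integrable_on {0..1}"
    by (rule integrable_spike_finite[OF P(1) _ P(3)]) (auto simp: g_def)
  have len: "curve_length A h \<gamma> = integral {0..1} g"
    unfolding curve_length_def by (rule integral_spike[OF negligible_finite[OF P(1)]]) (auto simp: g_def)
  have g\<tau>: "g integrable_on {0..\<tau>}"
    using integrable_on_subinterval[OF g1, of 0 \<tau>] \<tau> by auto
  have "continuous_on {0..\<tau>} (\<lambda>t. snd c (\<gamma> t))"
    by (rule continuous_on_compose2[OF continuous_chart[OF c] continuous_on_subset[OF P(2)]])
      (use inK \<tau> in auto)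
  then have v: "(v has_integral (snd c (\<gamma> \<tau>) - snd c (\<gamma> 0))) {0..\<tau>}"
  proof (rule fundamental_theorem_of_calculus_interior_strong[OF P(1) \<tau>(1), rotated])
    fix t assume t: "t \<in> {0<..<\<tau>} - P"
    then obtain a b where "t \<in> {a<..<b}" "C1_curve A \<gamma> a b" using P(4)[of t] \<tau> by auto
    then show "((\<lambda>t. snd c (\<gamma> t)) has_vector_derivative v t) (at t)"
      using C1_curve_velocity(2)[of \<gamma> a b t c] c inK[of t] t by (simp add: v_def)
  qed
  have "norm (integral {0..\<tau>} v) \<le> integral {0..\<tau>} (\<lambda>t. g t / m)"
  proof (rule Henstock_Kurzweil_Integration.integral_norm_bound_integral)
    show "v integrable_on {0..\<tau>}" using v by blast
    show "(\<lambda>t. g t / m) integrable_on {0..\<tau>}" using g\<tau> by (rule integrable_on_divide)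
    fix t assume t: "t \<in> {0..\<tau>}"
    show "norm (v t) \<le> g t / m"
    proof (cases "t \<in> P")
      case False
      then obtain a b where "t \<in> {a<..<b}" "C1_curve A \<gamma> a b" using P(4)[of t] \<tau> t by auto
      then have "speed \<gamma> t = cnorm c (snd c (\<gamma> t)) (velocity A \<gamma> t c)"
        using speed_eq_cnorm c inK[OF t] by blast
      then show ?thesis using m(1)[of "snd c (\<gamma> t)" "velocity A \<gamma> t c"] inK[OF t] m(2) False
        by (simp add: v_def g_def field_simps)
    qed (simp add: v_def g_def)
  qed
  also have "\<dots> = integral {0..\<tau>} g / m" by simp
  also have "\<dots> \<le> integral {0..1} g / m"
    using \<tau> g0 m(2) by (intro divide_right_mono integral_subset_le g\<tau> g1) auto
  finally show ?thesis using integral_unique[OF v] m(2) unfolding len by (simp add: field_simps)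
qed

text \<open>The first time at which the curve meets the sphere is an exit time: before it, connectedness keeps the curve
in the open ball. Compactness of the closed ball is what makes its image closed in the manifold.\<close>

lemma curve_exits_ball:
  fixes \<gamma> :: "real \<Rightarrow> 'a"
  assumes \<gamma>: "continuous_on {0..1} \<gamma>" and c: "c \<in> A" and r: "0 < r" "cball x0 r \<subseteq> im c"
    and start: "\<gamma> 0 = chart_inv c x0"
  shows "(\<forall>t\<in>{0..1}. \<gamma> t \<in> chart_inv c ` ball x0 r) \<or>
    (\<exists>\<tau>\<in>{0..1}. (\<forall>t\<in>{0..\<tau>}. \<gamma> t \<in> chart_inv c ` cball x0 r) \<and> \<gamma> \<tau> \<in> chart_inv c ` sphere x0 r)"
proof -
  let ?B = "chart_inv c ` ball x0 r" and ?C = "chart_inv c ` cball x0 r" and ?S = "chart_inv c ` sphere x0 r"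
  have sub: "ball x0 r \<subseteq> im c" "sphere x0 r \<subseteq> im c" using r(2) by auto
  have B: "open ?B" by (rule open_chart_inv_image[OF c sub(1) open_ball])
  have C: "closed ?C" by (intro compact_imp_closed compact_chart_inv_image[OF c r(2)] compact_cball)
  have S: "closed ?S" by (intro compact_imp_closed compact_chart_inv_image[OF c sub(2)] compact_sphere)
  have CBS: "?C = ?B \<union> ?S" by (simp add: sphere_def ball_def cball_def image_Un[symmetric] Un_def le_less)
      (auto intro!: arg_cong[where f = "image (chart_inv c)"])
  have start_in: "\<gamma> 0 \<in> ?B" using start r(1) by auto
  have stays: "\<gamma> t \<in> ?B" if I: "is_interval I" "I \<subseteq> {0..1}" "0 \<in> I" "t \<in> I" and avoid: "\<gamma> ` I \<inter> ?S = {}" for I :: "real set" and t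
  proof (rule ccontr)
    assume "\<gamma> t \<notin> ?B"
    then have "\<gamma> t \<notin> ?C" using avoid that(4) CBS by auto
    have "connected (\<gamma> ` I)"
      using I by (intro connected_continuous_image continuous_on_subset[OF \<gamma>]) (auto simp: is_interval_connected)
    moreover have "\<gamma> ` I \<subseteq> ?B \<union> - ?C" using avoid CBS by blast
    moreover have "?B \<inter> - ?C \<inter> \<gamma> ` I = {}" using CBS by blast
    ultimately have "?B \<inter> \<gamma> ` I = {} \<or> - ?C \<inter> \<gamma> ` I = {}"
      using B C by (intro connectedD) auto
    then show False using start_in I(3,4) \<open>\<gamma> t \<notin> ?C\<close> by blast
  qed
  define E where "E = {0..1} \<inter> \<gamma> -` ?S"
  show ?thesis
  proof (cases "E = {}")
    case True
    then have "\<gamma> t \<in> ?B" if "t \<in> {0..1}" for t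
      by (intro stays[of "{0..1}"]) (use that in \<open>auto simp: E_def is_interval_cc\<close>)
    then show ?thesis by blast
  next
    case False
    have "closed E" unfolding E_def by (rule continuous_closed_preimage[OF \<gamma> _ S]) simp
    moreover have "bounded E" unfolding E_def by (rule bounded_subset[of "{0..1}"]) auto
    ultimately have "compact E" using compact_eq_bounded_closed by blast
    then obtain \<tau> where \<tau>: "\<tau> \<in> E" "\<And>t. t \<in> E \<Longrightarrow> \<tau> \<le> t"
      using compact_attains_inf[of E] False by blast
    have \<tau>01: "\<tau> \<in> {0..1}" "\<gamma> \<tau> \<in> ?S" using \<tau>(1) by (auto simp: E_def)
    have "\<gamma> t \<in> ?C" if "t \<in> {0..\<tau>}" for t
    proof (cases "t = \<tau>")
      case True
      then show ?thesis using \<tau>01 CBS by blast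
    next
      case False
      have "\<gamma> t \<in> ?B"
      proof (rule stays[of "{0..<\<tau>}"])
        show "\<gamma> ` {0..<\<tau>} \<inter> ?S = {}" using \<tau>(2) \<tau>01(1) by (force simp: E_def)
      qed (use False that \<tau>01 in \<open>auto simp: is_interval_co\<close>)
      then show ?thesis using CBS by blast
    qed
    then show ?thesis using \<tau>01 by blast
  qed
qed

text \<open>A curve from the centre to \<open>w\<close> either stays in the coordinate ball, and then its length is at least \<open>m\<close> times
the chord, or it reaches the sphere, and then its length is at least \<open>m * r\<close>. If the distance is
below \<open>m * r\<close>, some curve is of the first kind, which puts \<open>w\<close> into the ball; the bound then holds for every curve.\<close>

proposition hermitian_dist_controls_chart:
  assumes c: "c \<in> A" and r: "0 < r" "cball x0 r \<subseteq> im c"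
    and m: "0 < m" "\<And>x a. x \<in> cball x0 r \<Longrightarrow> m * norm a \<le> cnorm c x a"
    and d: "hermitian_dist A h (chart_inv c x0) w < m * r"
  shows "w \<in> fst c" "snd c w \<in> ball x0 r" "m * norm (snd c w - x0) \<le> hermitian_dist A h (chart_inv c x0) w"
proof -
  let ?z = "chart_inv c x0"
  let ?L = "{curve_length A h \<gamma> | \<gamma>. piecewise_C1_curve A \<gamma> \<and> \<gamma> 0 = ?z \<and> \<gamma> 1 = w}"
  have ne: "?L \<noteq> {}" using ex_piecewise_C1_curve[of ?z w] by blast
  have x0: "x0 \<in> im c" using r by auto
  have C: "\<gamma> t \<in> fst c \<and> snd c (\<gamma> t) \<in> cball x0 r" if "\<gamma> t \<in> chart_inv c ` cball x0 r" for \<gamma> :: "real \<Rightarrow> 'a" and t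
    using that r(2) chart_inv_in[OF c] chart_inv_right[OF c] by auto
  have alt: "(w \<in> chart_inv c ` ball x0 r \<and> m * norm (snd c w - x0) \<le> curve_length A h \<gamma>) \<or>
      m * r \<le> curve_length A h \<gamma>"
    if \<gamma>: "piecewise_C1_curve A \<gamma>" "\<gamma> 0 = ?z" "\<gamma> 1 = w" for \<gamma>
  proof -
    have "continuous_on {0..1} \<gamma>" using piecewise_C1_curveE[OF \<gamma>(1)] by blast
    from curve_exits_ball[OF this c r \<gamma>(2)] show ?thesis
    proof
      assume B: "\<forall>t\<in>{0..1}. \<gamma> t \<in> chart_inv c ` ball x0 r"
      then have "w \<in> chart_inv c ` ball x0 r" using \<gamma>(3) by force
      moreover have "\<gamma> t \<in> fst c \<and> snd c (\<gamma> t) \<in> cball x0 r" if "t \<in> {0..1}" for t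
        using B that by (intro C) (use ball_subset_cball in blast)
      then have "m * norm (snd c (\<gamma> 1) - snd c (\<gamma> 0)) \<le> curve_length A h \<gamma>"
        by (intro curve_length_ge_chart_distance[OF \<gamma>(1) c, of 1 "cball x0 r"] m) simp_all
      ultimately show ?thesis using \<gamma> chart_inv_right[OF c x0] by simp
    next
      assume "\<exists>\<tau>\<in>{0..1}. (\<forall>t\<in>{0..\<tau>}. \<gamma> t \<in> chart_inv c ` cball x0 r) \<and> \<gamma> \<tau> \<in> chart_inv c ` sphere x0 r"
      then obtain \<tau> where \<tau>: "\<tau> \<in> {0..1}" "\<forall>t\<in>{0..\<tau>}. \<gamma> t \<in> chart_inv c ` cball x0 r"
        "\<gamma> \<tau> \<in> chart_inv c ` sphere x0 r" by blast
      obtain y where y: "y \<in> sphere x0 r" "\<gamma> \<tau> = chart_inv c y" using \<tau>(3) by blast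
      then have "snd c (\<gamma> \<tau>) = y" using chart_inv_right[OF c, of y] r(2) by auto
      moreover have "m * norm (snd c (\<gamma> \<tau>) - snd c (\<gamma> 0)) \<le> curve_length A h \<gamma>"
        by (intro curve_length_ge_chart_distance[OF \<gamma>(1) c, of \<tau> "cball x0 r"] m C) (use \<tau> in auto)
      ultimately show ?thesis using \<gamma>(2) chart_inv_right[OF c x0] y(1)
        by (simp add: dist_norm norm_minus_commute)
    qed
  qed
  obtain l where l: "l \<in> ?L" "l < m * r" using cInf_lessD[OF ne] d unfolding hermitian_dist_def by blast
  then have w: "w \<in> chart_inv c ` ball x0 r" using alt by fastforce
  then obtain y where y: "w = chart_inv c y" "y \<in> ball x0 r" by blast
  then have "y \<in> im c" using r(2) ball_subset_cball by blast
  then show "w \<in> fst c" and wb: "snd c w \<in> ball x0 r"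
    using y chart_inv_in[OF c] chart_inv_right[OF c] by auto
  show "m * norm (snd c w - x0) \<le> hermitian_dist A h ?z w"
    unfolding hermitian_dist_def
  proof (rule cInf_greatest[OF ne])
    fix l assume "l \<in> ?L"
    moreover have "m * norm (snd c w - x0) \<le> m * r"
      using wb m(1) by (intro mult_left_mono) (auto simp: dist_norm norm_minus_commute)
    ultimately show "m * norm (snd c w - x0) \<le> l" using alt by fastforce
  qed
qed

end


section \<open>The Kobayashi distance decreases under holomorphic self-maps\<close>

lemma poincare_dist_nonneg:
  assumes "\<zeta> \<in> ball 0 1" "\<omega> \<in> ball 0 1"
  shows "0 \<le> poincare_dist \<zeta> \<omega>"
proof -
  define x where "x = cmod ((\<zeta> - \<omega>) / (1 - cnj \<omega> * \<zeta>))"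
  have "x = cmod (Moebius_function 0 \<omega> \<zeta>)" by (simp add: x_def Moebius_function_def)
  then have "x < 1" using Moebius_function_norm_lt_1[of \<omega> \<zeta> 0] assms by simp
  moreover have "0 \<le> x" by (simp add: x_def)
  ultimately have "1 \<le> (1 + x) / (1 - x)" by (simp add: field_simps)
  then show ?thesis unfolding poincare_dist_def x_def[symmetric] artanh_def by simp
qed

context complex_mfd
begin

lemma holomorphic_disc_compose:
  assumes f: "holomorphic_self_map A f" and g: "holomorphic_disc A g"
  shows "holomorphic_disc A (\<lambda>\<zeta>. f (g \<zeta>))"
  unfolding holomorphic_disc_def
proof (intro conjI ballI allI)
  have contg: "continuous_on (ball 0 1) g" using g by (simp add: holomorphic_disc_def)
  have "continuous_on UNIV f" using f by (simp add: holomorphic_self_map_def)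
  then show contfg: "continuous_on (ball 0 1) (\<lambda>\<zeta>. f (g \<zeta>))"
    using contg by (rule continuous_on_compose2) simp
  fix c' i assume c': "c' \<in> A"
  show "(\<lambda>\<zeta>. snd c' (f (g \<zeta>)) $ i) holomorphic_on (ball 0 1 \<inter> (\<lambda>\<zeta>. f (g \<zeta>)) -` fst c')"
    unfolding holomorphic_on_def
  proof
    fix \<zeta> assume \<zeta>: "\<zeta> \<in> ball 0 1 \<inter> (\<lambda>\<zeta>. f (g \<zeta>)) -` fst c'"
    obtain c where c: "c \<in> A" "g \<zeta> \<in> fst c" by (rule ex_chart)
    let ?F = "\<lambda>x. snd c' (f (chart_inv c x))"
    let ?U = "ball 0 1 \<inter> g -` fst c"
    have "open (g -` fst c \<inter> ball 0 1)"
      using continuous_on_open_vimage[OF open_ball, THEN iffD1, OF contg] open_chart[OF c(1)] by blast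
    then have U: "open ?U" by (simp add: Int_commute)
    have \<zeta>U: "\<zeta> \<in> ?U" using \<zeta> c by simp
    have "\<exists>d. ((\<lambda>\<zeta>. snd c (g \<zeta>) $ j) has_field_derivative d) (at \<zeta>)" for j
    proof -
      have "(\<lambda>\<zeta>. snd c (g \<zeta>) $ j) holomorphic_on ?U" using g c(1) unfolding holomorphic_disc_def by blast
      then show ?thesis using \<zeta>U unfolding holomorphic_on_open[OF U] by blast
    qed
    then obtain d where d: "\<And>j. ((\<lambda>\<zeta>. snd c (g \<zeta>) $ j) has_field_derivative d j) (at \<zeta>)" by metis
    have "((\<lambda>\<zeta>. \<Sum>j\<in>UNIV. (snd c (g \<zeta>) $ j) *s axis j (1::complex)) has_derivative
        (\<lambda>a. \<Sum>j\<in>UNIV. (d j * a) *s axis j 1)) (at \<zeta>)"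
      by (intro has_derivative_sum bounded_linear.has_derivative[OF bounded_linear_vector_scalar_mult_left]
          d[unfolded has_field_derivative_def])
    then have u: "((\<lambda>\<zeta>. snd c (g \<zeta>)) has_derivative (\<lambda>a. a *s (\<chi> j. d j))) (at \<zeta>)"
      using basis_expansion[of "(a::complex) *s (\<chi> j. d j)" for a]
      by (simp add: basis_expansion mult.commute)
    have "snd c (g \<zeta>) \<in> snd c ` (fst c \<inter> f -` fst c')" using \<zeta> c by auto
    moreover have "holomorphic_vec_on ?F (snd c ` (fst c \<inter> f -` fst c'))"
      using f c(1) c' unfolding holomorphic_self_map_def by blast
    ultimately obtain D where D: "(?F has_derivative D) (at (snd c (g \<zeta>)))" "\<And>a v. D (a *s v) = a *s D v"
      using holomorphic_vec_onE by blast
    have "((\<lambda>\<zeta>. ?F (snd c (g \<zeta>)) $ i) has_field_derivative (D (\<chi> j. d j) $ i)) (at \<zeta>)"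
      by (rule holomorphic_vec_on_has_field_derivative[OF D u])
    then have "((\<lambda>\<zeta>. snd c' (f (g \<zeta>)) $ i) has_field_derivative (D (\<chi> j. d j) $ i)) (at \<zeta>)"
      by (rule has_field_derivative_transform_within_open[OF _ U \<zeta>U]) (use chart_inv_left[OF c(1)] in auto)
    then show "(\<lambda>\<zeta>. snd c' (f (g \<zeta>)) $ i) field_differentiable
        at \<zeta> within ball 0 1 \<inter> (\<lambda>\<zeta>. f (g \<zeta>)) -` fst c'"
      using field_differentiable_at_within field_differentiable_def by blast
  qed
qed

lemma holomorphic_disc_chart_line:
  assumes c: "c \<in> A" and L: "\<And>\<zeta>. \<zeta> \<in> ball 0 1 \<Longrightarrow> x + \<zeta> *s v \<in> im c"
  shows "holomorphic_disc A (\<lambda>\<zeta>. chart_inv c (x + \<zeta> *s v))"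
  unfolding holomorphic_disc_def
proof (intro conjI ballI allI)
  have "continuous_on (ball 0 1) (\<lambda>\<zeta>. x + \<zeta> *s v)"
    by (rule has_derivative_continuous_on) (rule has_derivative_complex_line)
  then show "continuous_on (ball 0 1) (\<lambda>\<zeta>. chart_inv c (x + \<zeta> *s v))"
    by (rule continuous_on_compose2[OF continuous_chart_inv[OF c]]) (use L in blast)
  fix c' i assume c': "c' \<in> A"
  show "(\<lambda>\<zeta>. snd c' (chart_inv c (x + \<zeta> *s v)) $ i) holomorphic_on
      (ball 0 1 \<inter> (\<lambda>\<zeta>. chart_inv c (x + \<zeta> *s v)) -` fst c')"
    unfolding holomorphic_on_def
  proof
    fix \<zeta> assume "\<zeta> \<in> ball 0 1 \<inter> (\<lambda>\<zeta>. chart_inv c (x + \<zeta> *s v)) -` fst c'"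
    then have "x + \<zeta> *s v \<in> snd c ` (fst c \<inter> fst c')"
      using L[of \<zeta>] chart_inv_in[OF c] chart_inv_right[OF c]
      by (intro image_eqI[of _ _ "chart_inv c (x + \<zeta> *s v)"]) auto
    then obtain D where D: "(transition c c' has_derivative D) (at (x + \<zeta> *s v))" "\<And>a v. D (a *s v) = a *s D v"
      using holomorphic_vec_onE[OF transition_holomorphic[OF c c']] by blast
    have "((\<lambda>\<zeta>. transition c c' (x + \<zeta> *s v) $ i) has_field_derivative (D v $ i)) (at \<zeta>)"
      by (rule holomorphic_vec_on_has_field_derivative[OF D has_derivative_complex_line])
    then show "(\<lambda>\<zeta>. snd c' (chart_inv c (x + \<zeta> *s v)) $ i) field_differentiable
        at \<zeta> within ball 0 1 \<inter> (\<lambda>\<zeta>. chart_inv c (x + \<zeta> *s v)) -` fst c'"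
      unfolding transition_def using field_differentiable_at_within field_differentiable_def by blast
  qed
qed

definition disc_chain :: "nat \<Rightarrow> (nat \<Rightarrow> complex) \<Rightarrow> (nat \<Rightarrow> complex) \<Rightarrow> 'a \<Rightarrow> 'a \<Rightarrow> bool"
  where "disc_chain m \<zeta> \<omega> z w \<longleftrightarrow> (\<exists>p f. p 0 = z \<and> p m = w \<and>
    (\<forall>i<m. holomorphic_disc A (f i) \<and> \<zeta> i \<in> ball 0 1 \<and> \<omega> i \<in> ball 0 1 \<and>
      f i (\<zeta> i) = p i \<and> f i (\<omega> i) = p (Suc i)))"

lemma kobayashi_dist_eq:
  "kobayashi_dist A z w = Inf {(\<Sum>i<m. poincare_dist (\<zeta> i) (\<omega> i)) | m \<zeta> \<omega>. disc_chain m \<zeta> \<omega> z w}"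
  unfolding kobayashi_dist_def disc_chain_def ..

lemma disc_chain_Suc:
  assumes "disc_chain m \<zeta> \<omega> z w" and g: "holomorphic_disc A g" "a \<in> ball 0 1" "b \<in> ball 0 1"
    "g a = w" "g b = w'"
  shows "disc_chain (Suc m) (\<zeta>(m := a)) (fun_upd \<omega> m b) z w'"
proof -
  obtain p f where p: "p 0 = z" "p m = w"
    and f: "\<And>i. i < m \<Longrightarrow> holomorphic_disc A (f i) \<and> \<zeta> i \<in> ball 0 1 \<and> \<omega> i \<in> ball 0 1 \<and>
      f i (\<zeta> i) = p i \<and> f i (\<omega> i) = p (Suc i)"
    using assms(1) unfolding disc_chain_def by blast
  show ?thesis
    unfolding disc_chain_def
  proof (intro exI[of _ "p(Suc m := w')"] exI[of _ "f(m := g)"] conjI allI impI)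
    fix i assume i: "i < Suc m"
    show "holomorphic_disc A ((f(m := g)) i)"
      "(\<zeta>(m := a)) i \<in> ball 0 1" "fun_upd \<omega> m b i \<in> ball 0 1"
      "(f(m := g)) i ((\<zeta>(m := a)) i) = (p(Suc m := w')) i"
      "(f(m := g)) i (fun_upd \<omega> m b i) = (p(Suc m := w')) (Suc i)"
      using f[of i] g p i by (cases "i = m"; simp)+
  qed (use p in auto)
qed

text \<open>Two points of a coordinate ball are joined through its centre: a point \<open>y\<close> of the ball lies on the affine disc around
the centre \<open>x0\<close>, at parameter \<open>\<rho>\<close>. The choice of \<open>\<rho>\<close> strictly between \<open>norm (y - x0) / r\<close> and 1 keeps
the disc in the ball and also covers \<open>y = x0\<close>.\<close>

lemma ex_disc_chain: "\<exists>m \<zeta> \<omega>. disc_chain m \<zeta> \<omega> z w"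
proof (rule connected_mfd_induct[of "\<lambda>w. \<exists>m \<zeta> \<omega>. disc_chain m \<zeta> \<omega> z w"])
  show "\<exists>m \<zeta> \<omega>. disc_chain m \<zeta> \<omega> z z"
    unfolding disc_chain_def by (intro exI[of _ 0] exI[of _ "\<lambda>i. z"]) auto
next
  fix c x0 r y1 y2
  assume c: "c \<in> A" "0 < r" "ball x0 r \<subseteq> im c" and y1: "y1 \<in> ball x0 r" and y2: "y2 \<in> ball x0 r"
    and ch: "\<exists>m \<zeta> \<omega>. disc_chain m \<zeta> \<omega> z (chart_inv c y1)"
  have disc: "\<exists>g a b. holomorphic_disc A g \<and> a \<in> ball 0 1 \<and> b \<in> ball 0 1 \<and>
      g a = chart_inv c x0 \<and> g b = chart_inv c y" if y: "y \<in> ball x0 r" for y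
  proof -
    define \<rho> where "\<rho> = (norm (y - x0) / r + 1) / 2"
    have n: "norm (y - x0) < r" using y by (simp add: dist_norm norm_minus_commute)
    have \<rho>: "0 < \<rho>" "\<rho> < 1" "norm (y - x0) \<le> \<rho> * r"
    proof -
      have "0 \<le> norm (y - x0) / r" "norm (y - x0) / r < 1" using n c(2) by (simp_all add: divide_less_eq)
      then show "0 < \<rho>" "\<rho> < 1" unfolding \<rho>_def by (simp_all add: add_nonneg_pos)
      show "norm (y - x0) \<le> \<rho> * r" using n c(2) by (simp add: \<rho>_def field_simps)
    qed
    let ?v = "complex_of_real (1 / \<rho>) *s (y - x0)"
    have v: "norm ?v \<le> r"
      unfolding norm_vector_scalar_mult norm_of_real using \<rho> by (simp add: field_simps)
    have "x0 + \<zeta> *s ?v \<in> im c" if "\<zeta> \<in> ball 0 1" for \<zeta>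
    proof -
      have "cmod \<zeta> * norm ?v < r"
      proof (cases "norm ?v = 0")
        case True
        show ?thesis unfolding True using c(2) by simp
      next
        case False
        then have "cmod \<zeta> * norm ?v < 1 * norm ?v" using that by (intro mult_strict_right_mono) auto
        then show ?thesis using v by linarith
      qed
      moreover have "dist x0 (x0 + u) = norm u" for u by (simp add: dist_norm)
      ultimately have "x0 + \<zeta> *s ?v \<in> ball x0 r" unfolding mem_ball norm_vector_scalar_mult[symmetric] by simp
      then show ?thesis using c(3) by blast
    qed
    then have "holomorphic_disc A (\<lambda>\<zeta>. chart_inv c (x0 + \<zeta> *s ?v))"
      by (rule holomorphic_disc_chart_line[OF c(1)])
    moreover have "x0 + complex_of_real \<rho> *s ?v = y"
      using \<rho>(1) by (simp add: vec_eq_iff)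
    ultimately show ?thesis
      using \<rho> by (intro exI[of _ "\<lambda>\<zeta>. chart_inv c (x0 + \<zeta> *s ?v)"] exI[of _ 0] exI[of _ "complex_of_real \<rho>"])
        (simp add: vec_eq_iff)
  qed
  obtain m \<zeta> \<omega> where "disc_chain m \<zeta> \<omega> z (chart_inv c y1)" using ch by blast
  then obtain m \<zeta> \<omega> where "disc_chain m \<zeta> \<omega> z (chart_inv c x0)" using disc[OF y1] disc_chain_Suc by metis
  then show "\<exists>m \<zeta> \<omega>. disc_chain m \<zeta> \<omega> z (chart_inv c y2)" using disc[OF y2] disc_chain_Suc by metis
qed

lemma disc_chain_image:
  assumes f: "holomorphic_self_map A f" and ch: "disc_chain m \<zeta> \<omega> z w"
  shows "disc_chain m \<zeta> \<omega> (f z) (f w)"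
proof -
  obtain p g where "p 0 = z" "p m = w"
    and "\<forall>i<m. holomorphic_disc A (g i) \<and> \<zeta> i \<in> ball 0 1 \<and> \<omega> i \<in> ball 0 1 \<and>
      g i (\<zeta> i) = p i \<and> g i (\<omega> i) = p (Suc i)"
    using ch unfolding disc_chain_def by blast
  then show ?thesis
    unfolding disc_chain_def using holomorphic_disc_compose[OF f]
    by (intro exI[of _ "\<lambda>i. f (p i)"] exI[of _ "\<lambda>i \<zeta>. f (g i \<zeta>)"]) auto
qed

text \<open>A self-map carries chains of discs to chains of discs with the same parameters, so the infimum for the image
points ranges over a larger set.\<close>

proposition kobayashi_dist_contraction:
  assumes f: "holomorphic_self_map A f"
  shows "kobayashi_dist A (f z) (f w) \<le> kobayashi_dist A z w"
  unfolding kobayashi_dist_eq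
proof (rule cInf_superset_mono)
  show "{(\<Sum>i<m. poincare_dist (\<zeta> i) (\<omega> i)) | m \<zeta> \<omega>. disc_chain m \<zeta> \<omega> z w} \<noteq> {}"
    using ex_disc_chain[of z w] by blast
  show "bdd_below {(\<Sum>i<m. poincare_dist (\<zeta> i) (\<omega> i)) | m \<zeta> \<omega>. disc_chain m \<zeta> \<omega> (f z) (f w)}"
    by (rule bdd_belowI[of _ 0]) (auto simp: disc_chain_def intro!: sum_nonneg poincare_dist_nonneg)
  show "{(\<Sum>i<m. poincare_dist (\<zeta> i) (\<omega> i)) | m \<zeta> \<omega>. disc_chain m \<zeta> \<omega> z w} \<subseteq>
      {(\<Sum>i<m. poincare_dist (\<zeta> i) (\<omega> i)) | m \<zeta> \<omega>. disc_chain m \<zeta> \<omega> (f z) (f w)}"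
    using disc_chain_image[OF f] by blast
qed

end


section \<open>Trajectories of an evolution family\<close>

lemma AE_lebesgue_on_iff:
  "S \<in> sets lebesgue \<Longrightarrow> (AE t in lebesgue_on S. P t) \<longleftrightarrow> (AE t in lebesgue. t \<in> S \<longrightarrow> P t)"
  by (rule AE_restrict_space_iff) simp

lemma AE_lebesgue_negligible: "negligible N \<Longrightarrow> AE t in lebesgue. t \<notin> N"
  unfolding negligible_iff_null_sets by (rule AE_not_in)

context complex_mfd
begin

text \<open>Differentiability in one chart suffices; the other charts are handled by the transition maps. Together with a
countable subatlas this keeps the exceptional null sets countable in number.\<close>

lemma has_velocity_of_chart:
  assumes c: "c \<in> A" "\<gamma> t \<in> fst c" and S: "t \<in> S"
    and ev: "eventually (\<lambda>\<tau>. \<gamma> \<tau> \<in> fst c) (at t within S)"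
    and der: "((\<lambda>\<tau>. snd c (\<gamma> \<tau>)) has_vector_derivative a) (at t within S)"
  shows "has_velocity A \<gamma> (tvector_of_coords A c (\<gamma> t) a) t S"
  unfolding has_velocity_def
proof (intro ballI impI)
  fix c' assume c': "c' \<in> A" "\<gamma> t \<in> fst c'"
  show "((\<lambda>\<tau>. snd c' (\<gamma> \<tau>)) has_vector_derivative tvector_of_coords A c (\<gamma> t) a c') (at t within S)"
    using velocity_change_of_chart[of c c' \<gamma> t S a] c c' S ev der by (simp add: tvector_of_coords_eq)
qed

lemma has_velocity_subset: "has_velocity A \<gamma> v t S \<Longrightarrow> T \<subseteq> S \<Longrightarrow> has_velocity A \<gamma> v t T"
  unfolding has_velocity_def using has_vector_derivative_within_subset by blast

lemma countable_subatlas: "\<exists>A0\<subseteq>A. countable A0 \<and> (\<Union>c\<in>A0. fst c) = UNIV"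
proof -
  have "\<And>S. S \<in> fst ` A \<Longrightarrow> open S" using open_chart by auto
  then obtain F where F: "F \<subseteq> fst ` A" "countable F" "\<Union>F = \<Union>(fst ` A)"
    using Lindelof[of "fst ` A"] by metis
  have "\<Union>(fst ` A) = UNIV" using ex_chart by blast
  obtain A0 where "A0 \<subseteq> A" "countable A0" "F = fst ` A0"
    using F(1,2) by (metis countable_subset_image)
  then show ?thesis using F(3) \<open>\<Union>(fst ` A) = UNIV\<close> by auto
qed

end

context hermitian_mfd
begin

text \<open>The comparison of distances with constants that are uniform for centres in a smaller ball.\<close>

lemma chart_control:
  assumes c: "c \<in> A" and z: "z \<in> fst c"
  obtains r m where "0 < r" "0 < m" "cball (snd c z) (2 * r) \<subseteq> im c"
    "\<And>x w. x \<in> cball (snd c z) r \<Longrightarrow> hermitian_dist A h (chart_inv c x) w < m * r \<Longrightarrow>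
      w \<in> fst c \<and> m * norm (snd c w - x) \<le> hermitian_dist A h (chart_inv c x) w"
proof -
  obtain r0 where r0: "r0 > 0" "cball (snd c z) r0 \<subseteq> im c"
    using open_im[OF c] z open_contains_cball by blast
  define r where "r = r0 / 2"
  have r: "0 < r" "cball (snd c z) (2 * r) \<subseteq> im c" using r0 by (auto simp: r_def)
  obtain m where m: "0 < m" "\<And>x a. x \<in> cball (snd c z) (2 * r) \<Longrightarrow> m * norm a \<le> cnorm c x a"
    by (rule cnorm_bounds[OF c compact_cball r(2)]) blast
  show ?thesis
  proof (rule that[OF r(1) m(1) r(2)])
    fix x w assume x: "x \<in> cball (snd c z) r" and d: "hermitian_dist A h (chart_inv c x) w < m * r"
    have sub: "cball x r \<subseteq> cball (snd c z) (2 * r)"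
    proof
      fix y assume "y \<in> cball x r"
      then show "y \<in> cball (snd c z) (2 * r)" using x dist_triangle[of "snd c z" y x] by simp
    qed
    show "w \<in> fst c \<and> m * norm (snd c w - x) \<le> hermitian_dist A h (chart_inv c x) w"
      using hermitian_dist_controls_chart[OF c r(1) order_trans[OF sub r(2)] m(1) _ d] m(2) sub by blast
  qed
qed

end

locale evolution_mfd = hermitian_mfd A h
  for A :: "('a::{t2_space, second_countable_topology}, 'n::finite) chart set" and h +
  fixes \<phi> :: "real \<Rightarrow> real \<Rightarrow> 'a \<Rightarrow> 'a"
  assumes evo: "evolution_family A h \<phi>"
begin

lemma evo_id: "0 \<le> s \<Longrightarrow> \<phi> s s z = z"
  using evo by (simp add: evolution_family_def)

lemma evo_comp: "0 \<le> s \<Longrightarrow> s \<le> u \<Longrightarrow> u \<le> t \<Longrightarrow> \<phi> u t (\<phi> s u z) = \<phi> s t z"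
  using evo unfolding evolution_family_def by (metis comp_apply)

lemma evo_hol: "0 \<le> s \<Longrightarrow> s \<le> t \<Longrightarrow> holomorphic_self_map A (\<phi> s t)"
  using evo by (simp add: evolution_family_def)

lemma evo_Lipschitz:
  assumes "0 < T" "compact K"
  obtains C where "0 < C" "\<And>s t t' z. 0 \<le> s \<Longrightarrow> s \<le> t \<Longrightarrow> t \<le> T \<Longrightarrow> s \<le> t' \<Longrightarrow> t' \<le> T \<Longrightarrow> z \<in> K \<Longrightarrow>
    hermitian_dist A h (\<phi> s t z) (\<phi> s t' z) \<le> C * \<bar>t - t'\<bar>"
proof -
  have "\<exists>C>0. \<forall>s\<ge>0. \<forall>t\<in>{s..T}. \<forall>t'\<in>{s..T}. \<forall>z\<in>K.
          hermitian_dist A h (\<phi> s t z) (\<phi> s t' z) \<le> C * \<bar>t - t'\<bar>"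
    using evo assms unfolding evolution_family_def by blast
  then obtain C where C: "C > 0" "\<forall>s\<ge>0. \<forall>t\<in>{s..T}. \<forall>t'\<in>{s..T}. \<forall>z\<in>K.
      hermitian_dist A h (\<phi> s t z) (\<phi> s t' z) \<le> C * \<bar>t - t'\<bar>"
    by (elim exE conjE) (rule that)
  show ?thesis
  proof (rule that[OF C(1)])
    fix s t t' z assume "0 \<le> s" "s \<le> t" "t \<le> T" "s \<le> t'" "t' \<le> T" "z \<in> K"
    then show "hermitian_dist A h (\<phi> s t z) (\<phi> s t' z) \<le> C * \<bar>t - t'\<bar>"
      using C(2)[rule_format, of s t t' z] by simp
  qed
qed

text \<open>The Lipschitz condition first confines the trajectory to a small coordinate ball for a short time, and
inside that ball it becomes a Lipschitz bound for the coordinates.\<close>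

lemma trajectory_Lipschitz:
  assumes s: "0 \<le> s" "s \<le> t0" and c: "c \<in> A" "\<phi> s t0 z \<in> fst c"
  obtains \<delta> L where "0 < \<delta>" "\<And>\<tau>. s \<le> \<tau> \<Longrightarrow> \<bar>\<tau> - t0\<bar> \<le> \<delta> \<Longrightarrow> \<phi> s \<tau> z \<in> fst c"
    "\<And>\<tau> \<tau>'. s \<le> \<tau> \<Longrightarrow> \<bar>\<tau> - t0\<bar> \<le> \<delta> \<Longrightarrow> s \<le> \<tau>' \<Longrightarrow> \<bar>\<tau>' - t0\<bar> \<le> \<delta> \<Longrightarrow>
      norm (snd c (\<phi> s \<tau> z) - snd c (\<phi> s \<tau>' z)) \<le> L * \<bar>\<tau> - \<tau>'\<bar>"
proof -
  obtain r m where rm: "0 < r" "0 < m"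
    and ctl: "\<And>x w. x \<in> cball (snd c (\<phi> s t0 z)) r \<Longrightarrow> hermitian_dist A h (chart_inv c x) w < m * r \<Longrightarrow>
      w \<in> fst c \<and> m * norm (snd c w - x) \<le> hermitian_dist A h (chart_inv c x) w"
    by (rule chart_control[OF c]) (rule that)
  have "0 < t0 + 1" using s by simp
  then obtain C where C: "0 < C" "\<And>t t'. s \<le> t \<Longrightarrow> t \<le> t0 + 1 \<Longrightarrow> s \<le> t' \<Longrightarrow> t' \<le> t0 + 1 \<Longrightarrow>
      hermitian_dist A h (\<phi> s t z) (\<phi> s t' z) \<le> C * \<bar>t - t'\<bar>"
    by (rule evo_Lipschitz[OF _ compact_sing, of "t0 + 1" z]) (rule that, use s in auto)
  \<comment> \<open>Two times within \<open>\<delta>\<close> of \<open>t0\<close> are at most \<open>2 * \<delta>\<close> apart, and 3 leaves room for strictness.\<close>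
  define \<delta> where "\<delta> = min 1 (m * r / (3 * C))"
  have \<delta>: "0 < \<delta>" "\<delta> \<le> 1" "C * (2 * \<delta>) < m * r"
  proof -
    show "0 < \<delta>" "\<delta> \<le> 1" using rm C by (auto simp: \<delta>_def)
    have "C * (2 * \<delta>) \<le> C * (2 * (m * r / (3 * C)))" using C(1) by (intro mult_left_mono) (auto simp: \<delta>_def)
    also have "\<dots> < m * r" using C(1) rm by (simp add: field_simps)
    finally show "C * (2 * \<delta>) < m * r" .
  qed
  have step: "\<phi> s \<tau>' z \<in> fst c \<and> norm (snd c (\<phi> s \<tau> z) - snd c (\<phi> s \<tau>' z)) \<le> C / m * \<bar>\<tau> - \<tau>'\<bar>"
    if \<tau>: "s \<le> \<tau>" "\<bar>\<tau> - t0\<bar> \<le> \<delta>" "s \<le> \<tau>'" "\<bar>\<tau>' - t0\<bar> \<le> \<delta>"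
      and in_c: "\<phi> s \<tau> z \<in> fst c" "snd c (\<phi> s \<tau> z) \<in> cball (snd c (\<phi> s t0 z)) r" for \<tau> \<tau>'
  proof -
    have d: "hermitian_dist A h (\<phi> s \<tau> z) (\<phi> s \<tau>' z) \<le> C * \<bar>\<tau> - \<tau>'\<bar>"
      using \<tau> \<delta>(2) by (intro C(2)) auto
    also have "C * \<bar>\<tau> - \<tau>'\<bar> \<le> C * (2 * \<delta>)" using \<tau> C(1) by (intro mult_left_mono) auto
    also note \<delta>(3)
    finally have "\<phi> s \<tau>' z \<in> fst c \<and> m * norm (snd c (\<phi> s \<tau>' z) - snd c (\<phi> s \<tau> z)) \<le>
        hermitian_dist A h (\<phi> s \<tau> z) (\<phi> s \<tau>' z)"
      using ctl[OF in_c(2), of "\<phi> s \<tau>' z"] chart_inv_left[OF c(1) in_c(1)] by simp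
    then show ?thesis using d rm(2) by (simp add: norm_minus_commute field_simps)
  qed
  have near: "\<phi> s \<tau> z \<in> fst c \<and> snd c (\<phi> s \<tau> z) \<in> cball (snd c (\<phi> s t0 z)) r"
    if "s \<le> \<tau>" "\<bar>\<tau> - t0\<bar> \<le> \<delta>" for \<tau>
  proof -
    have 1: "\<phi> s \<tau> z \<in> fst c \<and> norm (snd c (\<phi> s t0 z) - snd c (\<phi> s \<tau> z)) \<le> C / m * \<bar>t0 - \<tau>\<bar>"
      using that s \<delta>(1) rm(1) c by (intro step) auto
    have "C / m * \<bar>t0 - \<tau>\<bar> \<le> C / m * (2 * \<delta>)" using that \<delta>(1) C(1) rm(2) by (intro mult_left_mono) auto
    also have "\<dots> \<le> r" using \<delta>(3) rm(2) by (simp add: field_simps)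
    finally show ?thesis using 1 by (simp add: dist_norm)
  qed
  show ?thesis
  proof (rule that[OF \<delta>(1)])
    fix \<tau> \<tau>' assume "s \<le> \<tau>" "\<bar>\<tau> - t0\<bar> \<le> \<delta>" "s \<le> \<tau>'" "\<bar>\<tau>' - t0\<bar> \<le> \<delta>"
    then show "norm (snd c (\<phi> s \<tau> z) - snd c (\<phi> s \<tau>' z)) \<le> C / m * \<bar>\<tau> - \<tau>'\<bar>"
      using step[of \<tau> \<tau>'] near[of \<tau>] by simp
  qed (use near in simp)
qed

lemma trajectory_eventually_in_chart:
  assumes s: "0 \<le> s" "s \<le> t0" and c: "c \<in> A" "\<phi> s t0 z \<in> fst c"
  shows "eventually (\<lambda>\<tau>. \<phi> s \<tau> z \<in> fst c) (at t0 within {s..})"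
proof -
  obtain \<delta> where "0 < \<delta>" "\<And>\<tau>. s \<le> \<tau> \<Longrightarrow> \<bar>\<tau> - t0\<bar> \<le> \<delta> \<Longrightarrow> \<phi> s \<tau> z \<in> fst c"
    by (rule trajectory_Lipschitz[OF assms]) (rule that)
  then show ?thesis
    unfolding eventually_at by (intro exI[of _ \<delta>]) (auto simp: dist_real_def)
qed

lemma trajectory_differentiable_ae:
  assumes s: "0 \<le> s"
  shows "negligible {t. s < t \<and> \<not> (\<exists>v. has_velocity A (\<lambda>\<tau>. \<phi> s \<tau> z) v t UNIV)}" (is "negligible ?N")
proof -
  obtain A0 where A0: "A0 \<subseteq> A" "countable A0" "(\<Union>c\<in>A0. fst c) = UNIV"
    using countable_subatlas by blast
  let ?f = "\<lambda>c \<tau>. snd c (\<phi> s \<tau> z)"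
  let ?M = "\<lambda>c. {t. locally_Lipschitz_at (?f c) t \<and> \<not> ?f c differentiable (at t)}"
  have neg: "negligible (\<Union>c\<in>A0. ?M c)"
    by (rule negligible_countable_UN[OF A0(2) negligible_not_differentiable_of_locally_Lipschitz])
  have "t \<in> (\<Union>c\<in>A0. ?M c)" if t: "s < t" and nd: "\<not> (\<exists>v. has_velocity A (\<lambda>\<tau>. \<phi> s \<tau> z) v t UNIV)" for t
  proof -
    obtain c where c: "c \<in> A0" "\<phi> s t z \<in> fst c" using A0(3) by blast
    then have cA: "c \<in> A" using A0(1) by blast
    obtain \<delta> L where \<delta>: "0 < \<delta>" "\<And>\<tau>. s \<le> \<tau> \<Longrightarrow> \<bar>\<tau> - t\<bar> \<le> \<delta> \<Longrightarrow> \<phi> s \<tau> z \<in> fst c"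
      "\<And>\<tau> \<tau>'. s \<le> \<tau> \<Longrightarrow> \<bar>\<tau> - t\<bar> \<le> \<delta> \<Longrightarrow> s \<le> \<tau>' \<Longrightarrow> \<bar>\<tau>' - t\<bar> \<le> \<delta> \<Longrightarrow> norm (?f c \<tau> - ?f c \<tau>') \<le> L * \<bar>\<tau> - \<tau>'\<bar>"
      by (rule trajectory_Lipschitz[OF s less_imp_le[OF t] cA c(2)]) (rule that)
    have "locally_Lipschitz_at (?f c) t"
      unfolding locally_Lipschitz_at_def
      by (rule exI[of _ "min \<delta> (t - s)"], intro conjI exI[of _ L] ballI \<delta>(3)) (use \<delta>(1) t in auto)
    moreover have "\<not> ?f c differentiable (at t)"
    proof
      assume "?f c differentiable (at t)"
      then obtain a where a: "(?f c has_vector_derivative a) (at t)"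
        using vector_derivative_works by blast
      have "eventually (\<lambda>\<tau>. \<phi> s \<tau> z \<in> fst c) (at t)"
        unfolding eventually_at using \<delta>(1,2) t
        by (intro exI[of _ "min \<delta> (t - s)"]) (auto simp: dist_real_def)
      from has_velocity_of_chart[OF cA c(2) UNIV_I this a] nd show False by blast
    qed
    ultimately show ?thesis using c(1) by blast
  qed
  then show ?thesis by (intro negligible_subset[OF neg]) blast
qed

text \<open>A coordinate ball of radius \<open>r\<close> that stays within twice that radius, in the same chart, when flowed for a duration
below \<open>\<delta>\<close> up to time \<open>T\<close>, together with a common Lipschitz constant \<open>L\<close> in time.\<close>

definition flow_box :: "('a, 'n) chart \<Rightarrow> 'a \<Rightarrow> real \<Rightarrow> real \<Rightarrow> real \<Rightarrow> real \<Rightarrow> bool"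
  where "flow_box c z T r \<delta> L \<longleftrightarrow> 0 < r \<and> 0 < \<delta> \<and> 0 < L \<and> cball (snd c z) (2 * r) \<subseteq> im c \<and>
    (\<forall>s t. \<forall>x\<in>ball (snd c z) r. 0 \<le> s \<and> s \<le> t \<and> t \<le> T \<and> t - s < \<delta> \<longrightarrow>
      \<phi> s t (chart_inv c x) \<in> fst c \<and> snd c (\<phi> s t (chart_inv c x)) \<in> cball (snd c z) (2 * r)) \<and>
    (\<forall>s t t'. \<forall>x\<in>ball (snd c z) r.
      0 \<le> s \<and> s \<le> t \<and> t \<le> T \<and> t - s < \<delta> \<and> s \<le> t' \<and> t' \<le> T \<and> t' - s < \<delta> \<longrightarrow>
      norm (snd c (\<phi> s t (chart_inv c x)) - snd c (\<phi> s t' (chart_inv c x))) \<le> L * \<bar>t - t'\<bar>)"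

lemma flow_boxD:
  assumes "flow_box c z T r \<delta> L"
  shows flow_box_pos: "0 < r" "0 < \<delta>" "0 < L"
    and flow_box_im: "cball (snd c z) (2 * r) \<subseteq> im c" "ball (snd c z) r \<subseteq> im c"
    and flow_box_stay: "\<And>s t x. 0 \<le> s \<Longrightarrow> s \<le> t \<Longrightarrow> t \<le> T \<Longrightarrow> t - s < \<delta> \<Longrightarrow> x \<in> ball (snd c z) r \<Longrightarrow>
      \<phi> s t (chart_inv c x) \<in> fst c \<and> snd c (\<phi> s t (chart_inv c x)) \<in> cball (snd c z) (2 * r)"
    and flow_box_Lipschitz: "\<And>s t t' x. 0 \<le> s \<Longrightarrow> s \<le> t \<Longrightarrow> t \<le> T \<Longrightarrow> t - s < \<delta> \<Longrightarrow> s \<le> t' \<Longrightarrow> t' \<le> T \<Longrightarrow>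
      t' - s < \<delta> \<Longrightarrow> x \<in> ball (snd c z) r \<Longrightarrow>
      norm (snd c (\<phi> s t (chart_inv c x)) - snd c (\<phi> s t' (chart_inv c x))) \<le> L * \<bar>t - t'\<bar>"
proof -
  show r: "0 < r" and "0 < \<delta>" "0 < L" and sub: "cball (snd c z) (2 * r) \<subseteq> im c"
    using assms unfolding flow_box_def by simp_all
  show "ball (snd c z) r \<subseteq> im c" by (rule order_trans[OF _ sub]) (use r in auto)
qed (use assms in \<open>simp_all add: flow_box_def\<close>)

lemma ex_flow_box:
  assumes c: "c \<in> A" and z: "z \<in> fst c" and T: "0 < T"
  obtains r \<delta> L where "flow_box c z T r \<delta> L"
proof -
  let ?p = "snd c z"
  obtain r0 m where rm: "0 < r0" "0 < m" "cball ?p (2 * r0) \<subseteq> im c"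
    and ctl: "\<And>x w. x \<in> cball ?p r0 \<Longrightarrow> hermitian_dist A h (chart_inv c x) w < m * r0 \<Longrightarrow>
      w \<in> fst c \<and> m * norm (snd c w - x) \<le> hermitian_dist A h (chart_inv c x) w"
    by (rule chart_control[OF c z]) (rule that)
  define r where "r = r0 / 2"
  have r: "0 < r" "2 * r = r0" using rm by (auto simp: r_def)
  have sub: "cball ?p r0 \<subseteq> im c"
    by (rule order_trans[OF subset_cball rm(3)]) (use rm(1) in simp)
  have "compact (chart_inv c ` cball ?p r0)" by (rule compact_chart_inv_image[OF c sub compact_cball])
  then obtain C where C: "0 < C"
    and lip: "\<And>s t t' z. 0 \<le> s \<Longrightarrow> s \<le> t \<Longrightarrow> t \<le> T \<Longrightarrow> s \<le> t' \<Longrightarrow> t' \<le> T \<Longrightarrow> z \<in> chart_inv c ` cball ?p r0 \<Longrightarrow>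
      hermitian_dist A h (\<phi> s t z) (\<phi> s t' z) \<le> C * \<bar>t - t'\<bar>"
    by (rule evo_Lipschitz[OF T]) (rule that)
  define \<delta> where "\<delta> = m * r / C"
  have \<delta>: "0 < \<delta>" "C * \<delta> = m * r" using C rm r by (auto simp: \<delta>_def)
  have one: "\<phi> s t' (chart_inv c x) \<in> fst c \<and>
      norm (snd c (\<phi> s t (chart_inv c x)) - snd c (\<phi> s t' (chart_inv c x))) \<le> C / m * \<bar>t - t'\<bar>"
    if t: "0 \<le> s" "s \<le> t" "t \<le> T" "s \<le> t'" "t' \<le> T" "\<bar>t - t'\<bar> < \<delta>" and x: "x \<in> ball ?p r"
      and in_c: "\<phi> s t (chart_inv c x) \<in> fst c" "snd c (\<phi> s t (chart_inv c x)) \<in> cball ?p r0" for s t t' x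
  proof -
    have "chart_inv c x \<in> chart_inv c ` cball ?p r0" using x r by auto
    then have d: "hermitian_dist A h (\<phi> s t (chart_inv c x)) (\<phi> s t' (chart_inv c x)) \<le> C * \<bar>t - t'\<bar>"
      using lip t by blast
    also have "C * \<bar>t - t'\<bar> \<le> C * \<delta>" using t(6) C by (intro mult_left_mono) auto
    also have "\<dots> < m * r0" using \<delta>(2) rm r by simp
    finally have "\<phi> s t' (chart_inv c x) \<in> fst c \<and>
        m * norm (snd c (\<phi> s t' (chart_inv c x)) - snd c (\<phi> s t (chart_inv c x))) \<le>
        hermitian_dist A h (\<phi> s t (chart_inv c x)) (\<phi> s t' (chart_inv c x))"
      using ctl[OF in_c(2), of "\<phi> s t' (chart_inv c x)"] chart_inv_left[OF c in_c(1)] by simp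
    then show ?thesis using d rm(2) by (simp add: norm_minus_commute field_simps)
  qed
  have two: "\<phi> s t (chart_inv c x) \<in> fst c \<and> snd c (\<phi> s t (chart_inv c x)) \<in> cball ?p r0"
    if t: "0 \<le> s" "s \<le> t" "t \<le> T" "t - s < \<delta>" and x: "x \<in> ball ?p r" for s t x
  proof -
    have xim: "x \<in> im c" using x sub r by (auto intro!: subsetD[OF sub])
    have eq: "\<phi> s s (chart_inv c x) = chart_inv c x" by (rule evo_id[OF t(1)])
    have inv: "chart_inv c x \<in> fst c" "snd c (chart_inv c x) = x"
      using chart_inv_in[OF c xim] chart_inv_right[OF c xim] by auto
    have 1: "\<phi> s t (chart_inv c x) \<in> fst c \<and> norm (x - snd c (\<phi> s t (chart_inv c x))) \<le> C / m * \<bar>s - t\<bar>"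
      using one[of s s t x] t x inv r unfolding eq by auto
    have "C / m * \<bar>s - t\<bar> \<le> C / m * \<delta>" using t C rm by (intro mult_left_mono) auto
    also have "\<dots> = r" using \<delta>(2) rm by (simp add: field_simps)
    finally have "dist x (snd c (\<phi> s t (chart_inv c x))) \<le> r" using 1 by (simp add: dist_norm)
    then have "dist ?p (snd c (\<phi> s t (chart_inv c x))) \<le> r0"
      using x r dist_triangle[of ?p "snd c (\<phi> s t (chart_inv c x))" x] by simp
    with 1 show ?thesis by simp
  qed
  have "norm (snd c (\<phi> s t (chart_inv c x)) - snd c (\<phi> s t' (chart_inv c x))) \<le> C / m * \<bar>t - t'\<bar>"
    if "0 \<le> s" "s \<le> t" "t \<le> T" "t - s < \<delta>" "s \<le> t'" "t' \<le> T" "t' - s < \<delta>" "x \<in> ball ?p r" for s t t' x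
    using one[of s t t' x] two[of s t x] that by auto
  moreover have "0 < C / m" using C rm by simp
  ultimately have "flow_box c z T r \<delta> (C / m)"
    unfolding flow_box_def r(2) using r(1) \<delta>(1) sub two by (intro conjI allI ballI impI) auto
  then show ?thesis by (rule that)
qed

lemma flow_holomorphic_in_chart:
  assumes c: "c \<in> A" and st: "0 \<le> s" "s \<le> t" and B: "B \<subseteq> im c"
    and stay: "\<And>x. x \<in> B \<Longrightarrow> \<phi> s t (chart_inv c x) \<in> fst c"
  shows "holomorphic_vec_on (\<lambda>x. snd c (\<phi> s t (chart_inv c x))) B"
proof (rule holomorphic_vec_on_subset)
  show "holomorphic_vec_on (\<lambda>x. snd c (\<phi> s t (chart_inv c x))) (snd c ` (fst c \<inter> \<phi> s t -` fst c))"
    using evo_hol[OF st] c unfolding holomorphic_self_map_def by blast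
  show "B \<subseteq> snd c ` (fst c \<inter> \<phi> s t -` fst c)"
  proof
    fix x assume x: "x \<in> B"
    then have "x \<in> im c" using B by blast
    then show "x \<in> snd c ` (fst c \<inter> \<phi> s t -` fst c)"
      using stay[OF x] chart_inv_in[OF c] chart_inv_right[OF c] by (intro image_eqI[of _ _ "chart_inv c x"]) auto
  qed
qed

text \<open>A choice made once and for all, because the exceptional times depend on it.\<close>

definition dense_points :: "'a set"
  where "dense_points = (SOME D. countable D \<and> (\<forall>U. open U \<longrightarrow> U \<noteq> {} \<longrightarrow> (\<exists>d\<in>D. d \<in> U)))"

lemma countable_dense_points: "countable dense_points"
  and dense_points: "open U \<Longrightarrow> U \<noteq> {} \<Longrightarrow> \<exists>d\<in>dense_points. d \<in> U"
  using someI_ex[OF countable_dense_exists, where 'a1 = 'a] unfolding dense_points_def by blast+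

text \<open>A dense point \<open>d\<close> in \<open>U\<close> moves at most a distance \<open>L * (t - s)\<close> in a chart, so it is still in \<open>U\<close> at time \<open>t\<close> if it
starts late enough.\<close>

lemma trajectory_points_dense:
  assumes t: "0 < t" and U: "open U" "U \<noteq> {}"
  shows "\<exists>s d. s \<in> \<rat> \<and> 0 \<le> s \<and> s < t \<and> d \<in> dense_points \<and> \<phi> s t d \<in> U"
proof -
  obtain d where d: "d \<in> dense_points" "d \<in> U" using dense_points[OF U] by blast
  obtain c r0 where c: "c \<in> A" "d \<in> fst c" "0 < r0" "cball (snd c d) r0 \<subseteq> im c" "chart_inv c ` cball (snd c d) r0 \<subseteq> U"
    by (rule ex_chart_cball[OF U(1) d(2)]) (rule that)
  obtain r \<delta> L where box: "flow_box c d t r \<delta> L" by (rule ex_flow_box[OF c(1,2) t]) (rule that)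
  note f = flow_box_pos[OF box] and stay = flow_box_stay[OF box] and lip = flow_box_Lipschitz[OF box]
  define \<eta> where "\<eta> = min \<delta> (r0 / L)"
  have \<eta>: "0 < \<eta>" using f c(3) by (simp add: \<eta>_def)
  obtain s where s: "s \<in> \<rat>" "max 0 (t - \<eta>) < s" "s < t"
    using Rats_dense_in_real[of "max 0 (t - \<eta>)" t] t \<eta> by auto
  have s': "0 \<le> s" "s \<le> t" "t - s < \<delta>" "L * (t - s) \<le> r0"
  proof -
    show "0 \<le> s" "s \<le> t" "t - s < \<delta>" using s by (auto simp: \<eta>_def)
    have "L * (t - s) \<le> L * (r0 / L)" using s f by (intro mult_left_mono) (auto simp: \<eta>_def)
    then show "L * (t - s) \<le> r0" using f by simp
  qed
  have inv: "chart_inv c (snd c d) = d" by (rule chart_inv_left[OF c(1,2)])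
  have p: "snd c d \<in> ball (snd c d) r" using f by simp
  have in_c: "\<phi> s t d \<in> fst c" using stay[OF s'(1,2) order_refl s'(3) p] inv by simp
  have "norm (snd c (\<phi> s t d) - snd c (\<phi> s s d)) \<le> L * \<bar>t - s\<bar>"
    using lip[OF s'(1,2) order_refl s'(3) order_refl s'(2) _ p] f inv by simp
  then have "snd c (\<phi> s t d) \<in> cball (snd c d) r0"
    using s' by (simp add: evo_id dist_norm norm_minus_commute)
  then have "chart_inv c (snd c (\<phi> s t d)) \<in> U" using c(5) by blast
  then have "\<phi> s t d \<in> U" using chart_inv_left[OF c(1) in_c] by simp
  then show ?thesis using s s' d by blast
qed

definition good_time :: "real \<Rightarrow> bool"
  where "good_time t \<longleftrightarrow> 0 < t \<and> (\<forall>s\<in>\<rat>. 0 \<le> s \<longrightarrow> s < t \<longrightarrow>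
    (\<forall>d\<in>dense_points. \<exists>v. has_velocity A (\<lambda>\<tau>. \<phi> s \<tau> d) v t UNIV))"

lemma negligible_bad_times: "negligible {t. 0 \<le> t \<and> \<not> good_time t}"
proof -
  let ?N = "\<lambda>(s, d). {t. s < t \<and> \<not> (\<exists>v. has_velocity A (\<lambda>\<tau>. \<phi> s \<tau> d) v t UNIV)}"
  have "negligible (\<Union>j\<in>(\<rat> \<inter> {0..}) \<times> dense_points. ?N j)"
    using trajectory_differentiable_ae
    by (intro negligible_countable_UN countable_SIGMA countable_Int1 countable_rat countable_dense_points) auto
  then have "negligible (insert 0 (\<Union>j\<in>(\<rat> \<inter> {0..}) \<times> dense_points. ?N j))"
    by simp
  then show ?thesis
    by (rule negligible_subset) (force simp: good_time_def order_less_le)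
qed

lemma right_velocity_unique:
  assumes "has_velocity A \<gamma> v t {t..}" "has_velocity A \<gamma> w t {t..}" "c \<in> A" "\<gamma> t \<in> fst c"
  shows "v c = w c"
proof -
  have "at t within {t..} \<noteq> bot" by (simp add: at_within_Ici_at_right)
  then show ?thesis
    using vector_derivative_unique_within[of t "{t..}"] assms unfolding has_velocity_def by blast
qed

text \<open>By the composition law, a trajectory started at \<open>s\<close> and the one restarted from its position at time \<open>t\<close>
coincide after \<open>t\<close>.\<close>

lemma velocity_restart:
  assumes s: "0 \<le> s" "s \<le> t" and v: "has_velocity A (\<lambda>\<tau>. \<phi> s \<tau> z) v t S" and S: "{t..} \<subseteq> S"
  shows "has_velocity A (\<lambda>\<tau>. \<phi> t \<tau> (\<phi> s t z)) v t {t..}"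
  unfolding has_velocity_def
proof (intro ballI impI)
  have t0: "0 \<le> t" using s by simp
  fix c assume c: "c \<in> A" "\<phi> t t (\<phi> s t z) \<in> fst c"
  then have "((\<lambda>\<tau>. snd c (\<phi> s \<tau> z)) has_vector_derivative v c) (at t within {t..})"
    using has_velocity_subset[OF v S] evo_id[OF t0] unfolding has_velocity_def by simp
  then show "((\<lambda>\<tau>. snd c (\<phi> t \<tau> (\<phi> s t z))) has_vector_derivative v c) (at t within {t..})"
    by (rule has_vector_derivative_transform[rotated 2]) (use evo_comp s in auto)
qed

section \<open>The generator as a limit of difference quotients\<close>

abbreviation quot :: "('a, 'n) chart \<Rightarrow> real \<Rightarrow> real \<Rightarrow> (complex, 'n) vec \<Rightarrow> (complex, 'n) vec"
  where "quot c t \<tau> x \<equiv> (1 / \<tau>) *\<^sub>R (snd c (\<phi> t (t + \<tau>) (chart_inv c x)) - x)"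

lemma right_derivative_iff_quot:
  assumes "0 \<le> t" "c \<in> A" "x \<in> im c"
  shows "((\<lambda>\<tau>. snd c (\<phi> t \<tau> (chart_inv c x))) has_vector_derivative a) (at t within {t..}) \<longleftrightarrow>
    ((\<lambda>\<tau>. quot c t \<tau> x) \<longlongrightarrow> a) (at_right 0)"
  unfolding has_vector_derivative_right_iff using assms by (simp add: evo_id chart_inv_right)

text \<open>At a good time the quotients converge at the positions of the countably many selected trajectories, which are
dense; \<open>L\<close> bounds them on the whole ball. Vitali's theorem does the rest.\<close>

proposition quot_converges:
  assumes t: "good_time t" "t < T" and c: "c \<in> A" and z: "z \<in> fst c"
    and box: "flow_box c z T r \<delta> L"
  obtains g where "\<And>x. x \<in> ball (snd c z) (r / 2) \<Longrightarrow> ((\<lambda>\<tau>. quot c t \<tau> x) \<longlongrightarrow> g x) (at_right 0)"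
    "\<And>x. x \<in> ball (snd c z) (r / 2) \<Longrightarrow> norm (g x) \<le> L"
    "holomorphic_vec_on g (ball (snd c z) (r / 4))"
proof -
  let ?p = "snd c z"
  have t0: "0 < t" using t by (simp add: good_time_def)
  note f = flow_box_pos[OF box] and sub = flow_box_im(2)[OF box]
    and stay = flow_box_stay[OF box] and lip = flow_box_Lipschitz[OF box]
  \<comment> \<open>The durations for which the whole ball flows inside the chart up to time \<open>T\<close>.\<close>
  define \<delta>' where "\<delta>' = min \<delta> (T - t)"
  have \<delta>': "0 < \<delta>'" using f t by (simp add: \<delta>'_def)
  have bound: "norm (quot c t \<tau> x) \<le> L" if "0 < \<tau>" "\<tau> < \<delta>'" "x \<in> ball ?p r" for \<tau> x
  proof -
    have "norm (snd c (\<phi> t (t + \<tau>) (chart_inv c x)) - snd c (\<phi> t t (chart_inv c x))) \<le> L * \<bar>t + \<tau> - t\<bar>"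
      using that t0 by (intro lip) (auto simp: \<delta>'_def f)
    moreover have "snd c (\<phi> t t (chart_inv c x)) = x"
      using evo_id t0 chart_inv_right[OF c] sub that(3) by auto
    ultimately have "norm (snd c (\<phi> t (t + \<tau>) (chart_inv c x)) - x) \<le> L * \<tau>" using that(1) by simp
    then show ?thesis
      using that(1) unfolding norm_scaleR by (simp add: divide_le_eq)
  qed
  obtain g where g: "\<And>x. x \<in> ball ?p (r / 2) \<Longrightarrow> ((\<lambda>\<tau>. quot c t \<tau> x) \<longlongrightarrow> g x) (at_right 0)"
    "holomorphic_vec_on g (ball ?p (r / 4))"
  proof (rule Vitali_right_limit[of r \<delta>' "\<lambda>\<tau> x. quot c t \<tau> x" ?p L])
    show "holomorphic_vec_on (quot c t \<tau>) (ball ?p r)" if "0 < \<tau>" "\<tau> < \<delta>'" for \<tau>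
      using that t0 stay
      by (intro holomorphic_vec_on_scaleR holomorphic_vec_on_diff holomorphic_vec_on_id
          flow_holomorphic_in_chart c sub) (auto simp: \<delta>'_def)
    fix x and e :: real assume x: "x \<in> ball ?p r" and e: "0 < e"
    let ?V = "ball x e \<inter> ball ?p r"
    have V: "?V \<subseteq> im c" "open ?V" "x \<in> ?V" using sub x e by auto
    obtain s d where s: "s \<in> \<rat>" "0 \<le> s" "s < t" and d: "d \<in> dense_points" and in_V: "\<phi> s t d \<in> chart_inv c ` ?V"
      using trajectory_points_dense[OF t0 open_chart_inv_image[OF c V(1,2)]] V(3) by blast
    obtain v where v: "has_velocity A (\<lambda>\<tau>. \<phi> s \<tau> d) v t UNIV"
      using t(1) s d unfolding good_time_def by blast
    obtain y where y: "y \<in> ?V" "\<phi> s t d = chart_inv c y" using in_V by blast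
    have yim: "y \<in> im c" using y V by blast
    have "has_velocity A (\<lambda>\<tau>. \<phi> t \<tau> (chart_inv c y)) v t {t..}"
      using velocity_restart[OF s(2) less_imp_le[OF s(3)] v] y by simp
    then have "((\<lambda>\<tau>. snd c (\<phi> t \<tau> (chart_inv c y))) has_vector_derivative v c) (at t within {t..})"
      unfolding has_velocity_def using c evo_id t0 chart_inv_in[OF c yim] by auto
    then have "((\<lambda>\<tau>. quot c t \<tau> y) \<longlongrightarrow> v c) (at_right 0)"
      using right_derivative_iff_quot[OF less_imp_le[OF t0] c yim] by blast
    then show "\<exists>d l. dist x d < e \<and> ((\<lambda>\<tau>. quot c t \<tau> d) \<longlongrightarrow> l) (at_right 0)"
      using y by auto
  qed (use f \<delta>' bound in auto)
  have "norm (g x) \<le> L" if x: "x \<in> ball ?p (r / 2)" for x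
  proof (rule tendsto_upperbound[OF tendsto_norm[OF g(1)[OF x]]])
    have "eventually (\<lambda>\<tau>. 0 < \<tau> \<and> \<tau> < \<delta>') (at_right 0)"
      using \<delta>' eventually_at_right_field by blast
    then show "eventually (\<lambda>\<tau>. norm (quot c t \<tau> x) \<le> L) (at_right 0)"
      by eventually_elim (use bound x f(1) in auto)
  qed simp
  with g that show ?thesis by blast
qed

text \<open>At the bad times, which form a null set, the field is set to 0, which is tangent and holomorphic.\<close>

definition generator :: "'a \<Rightarrow> real \<Rightarrow> ('a, 'n) tvector"
  where "generator z t = (\<lambda>c. if good_time t \<and> c \<in> A \<and> z \<in> fst c
    then vector_derivative (\<lambda>\<tau>. snd c (\<phi> t \<tau> z)) (at t within {t..}) else 0)"

lemma generator_bad: "\<not> good_time t \<Longrightarrow> generator z t = (\<lambda>c. 0)"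
  by (simp add: generator_def)

lemma generator_velocity:
  assumes t: "good_time t"
  shows "has_velocity A (\<lambda>\<tau>. \<phi> t \<tau> z) (generator z t) t {t..}"
    and generator_in_tangent_space': "generator z t \<in> tangent_space A z"
proof -
  have t0: "0 \<le> t" using t by (simp add: good_time_def)
  have eq: "\<phi> t t z = z" by (rule evo_id[OF t0])
  obtain c where c: "c \<in> A" "z \<in> fst c" by (rule ex_chart)
  have T: "0 < t + 1" using t0 by simp
  obtain r \<delta> L where box: "flow_box c z (t + 1) r \<delta> L" by (rule ex_flow_box[OF c T]) (rule that)
  obtain g where g: "\<And>x. x \<in> ball (snd c z) (r / 2) \<Longrightarrow> ((\<lambda>\<tau>. quot c t \<tau> x) \<longlongrightarrow> g x) (at_right 0)"
    by (rule quot_converges[OF t(1) _ c box]) (simp, rule that)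
  have "((\<lambda>\<tau>. quot c t \<tau> (snd c z)) \<longlongrightarrow> g (snd c z)) (at_right 0)"
    using g flow_box_pos(1)[OF box] by simp
  then have "((\<lambda>\<tau>. snd c (\<phi> t \<tau> z)) has_vector_derivative g (snd c z)) (at t within {t..})"
    using right_derivative_iff_quot[OF t0 c(1), of "snd c z"] chart_inv_left[OF c] c(2) by simp
  then have vel: "has_velocity A (\<lambda>\<tau>. \<phi> t \<tau> z) (tvector_of_coords A c z (g (snd c z))) t {t..}"
    using has_velocity_of_chart[of c "\<lambda>\<tau>. \<phi> t \<tau> z" t "{t..}" "g (snd c z)"] c eq
      trajectory_eventually_in_chart[OF t0 order_refl c(1), of z] by simp
  have nb: "at t within {t..} \<noteq> bot" by (simp add: at_within_Ici_at_right)
  have "generator z t c' = tvector_of_coords A c z (g (snd c z)) c'" for c'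
  proof (cases "c' \<in> A \<and> z \<in> fst c'")
    case True
    then have "((\<lambda>\<tau>. snd c' (\<phi> t \<tau> z)) has_vector_derivative tvector_of_coords A c z (g (snd c z)) c') (at t within {t..})"
      using vel unfolding has_velocity_def eq by blast
    then show ?thesis using True t unfolding generator_def by (simp add: vector_derivative_within[OF nb])
  next
    case False
    then show ?thesis by (auto simp: generator_def tvector_of_coords_eq)
  qed
  then have "generator z t = tvector_of_coords A c z (g (snd c z))" by (rule ext)
  then show "has_velocity A (\<lambda>\<tau>. \<phi> t \<tau> z) (generator z t) t {t..}" "generator z t \<in> tangent_space A z"
    using vel tvector_of_coords_in_tangent_space[OF c] by auto
qed

lemma generator_in_tangent_space: "generator z t \<in> tangent_space A z"
  using generator_in_tangent_space' generator_bad zero_in_tangent_space by (cases "good_time t") auto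

lemma generator_quot:
  assumes t: "good_time t" and c: "c \<in> A" and x: "x \<in> im c"
  shows "((\<lambda>\<tau>. quot c t \<tau> x) \<longlongrightarrow> generator (chart_inv c x) t c) (at_right 0)"
proof -
  have t0: "0 \<le> t" using t by (simp add: good_time_def)
  show ?thesis
    using generator_velocity(1)[OF t, of "chart_inv c x"] c chart_inv_in[OF c x]
    unfolding right_derivative_iff_quot[OF t0 c x, symmetric] has_velocity_def by (simp add: evo_id[OF t0])
qed

end


context evolution_mfd
begin

lemma generator_local:
  assumes c: "c \<in> A" and z: "z \<in> fst c" and T: "0 < T"
  obtains r L where "0 < r" "0 < L" "cball (snd c z) (2 * r) \<subseteq> im c"
    "\<And>t x. good_time t \<Longrightarrow> t < T \<Longrightarrow> x \<in> ball (snd c z) (r / 2) \<Longrightarrow>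
      norm (generator (chart_inv c x) t c) \<le> L"
    "\<And>t. good_time t \<Longrightarrow> t < T \<Longrightarrow>
      holomorphic_vec_on (\<lambda>x. generator (chart_inv c x) t c) (ball (snd c z) (r / 4))"
proof -
  let ?p = "snd c z"
  obtain r \<delta> L where box: "flow_box c z T r \<delta> L" by (rule ex_flow_box[OF c z T]) (rule that)
  note f = flow_box_pos[OF box] flow_box_im(1)[OF box]
  have sub: "ball ?p (r / 2) \<subseteq> im c" by (rule order_trans[OF _ f(4)]) (use f(1) in auto)
  have main: "(\<forall>x\<in>ball ?p (r / 2). norm (generator (chart_inv c x) t c) \<le> L) \<and>
      holomorphic_vec_on (\<lambda>x. generator (chart_inv c x) t c) (ball ?p (r / 4))" if t: "good_time t" "t < T" for t
  proof -
    obtain g where g: "\<And>x. x \<in> ball ?p (r / 2) \<Longrightarrow> ((\<lambda>\<tau>. quot c t \<tau> x) \<longlongrightarrow> g x) (at_right 0)"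
      "\<And>x. x \<in> ball ?p (r / 2) \<Longrightarrow> norm (g x) \<le> L" "holomorphic_vec_on g (ball ?p (r / 4))"
      by (rule quot_converges[OF t c z box]) (rule that)
    have eq: "g x = generator (chart_inv c x) t c" if x: "x \<in> ball ?p (r / 2)" for x
      using tendsto_unique[OF _ g(1)[OF x] generator_quot[OF t(1) c subsetD[OF sub x]]] by simp
    have "holomorphic_vec_on (\<lambda>x. generator (chart_inv c x) t c) (ball ?p (r / 4))"
      by (rule holomorphic_vec_on_cong_open[OF g(3) open_ball eq]) (use f(1) in auto)
    then show ?thesis using g(2) eq by simp
  qed
  show ?thesis by (rule that[OF f(1,3,4)]) (use main in blast)+
qed

lemma generator_holomorphic:
  assumes c: "c \<in> A"
  shows "holomorphic_vec_on (\<lambda>x. generator (chart_inv c x) t c) (im c)"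
proof (cases "good_time t")
  case False
  then show ?thesis by (simp add: generator_bad holomorphic_vec_on_const)
next
  case True
  then have T: "0 < t + 1" by (simp add: good_time_def)
  show ?thesis
    unfolding holomorphic_vec_on_def
  proof
    fix x assume x: "x \<in> im c"
    obtain r where r: "0 < r" "\<And>t'. good_time t' \<Longrightarrow> t' < t + 1 \<Longrightarrow>
        holomorphic_vec_on (\<lambda>x. generator (chart_inv c x) t' c) (ball (snd c (chart_inv c x)) (r / 4))"
      by (rule generator_local[OF c chart_inv_in[OF c x] T]) (rule that)
    have "holomorphic_vec_on (\<lambda>x. generator (chart_inv c x) t c) (ball x (r / 4))"
      using r(2)[OF True] chart_inv_right[OF c x] by simp
    then show "\<exists>D. ((\<lambda>x. generator (chart_inv c x) t c) has_derivative D) (at x) \<and> (\<forall>a v. D (a *s v) = a *s D v)"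
      using r(1) unfolding holomorphic_vec_on_def by simp
  qed
qed

text \<open>A finite cover of the compact set by flow boxes. The sum of the local bounds replaces their maximum, to avoid
treating the empty cover separately.\<close>

lemma generator_bounded:
  assumes K: "compact K" and T: "0 < T"
  obtains B where "0 \<le> B" "\<And>t z. t \<le> T \<Longrightarrow> z \<in> K \<Longrightarrow> tnorm h z (generator z t) \<le> B"
proof -
  have loc: "\<exists>U B. open U \<and> z \<in> U \<and> 0 \<le> B \<and> (\<forall>w\<in>U. \<forall>t\<le>T. tnorm h w (generator w t) \<le> B)" for z
  proof -
    obtain c where c: "c \<in> A" "z \<in> fst c" by (rule ex_chart)
    have T1: "0 < T + 1" using T by simp
    obtain r L where r: "0 < r" "0 < L" "cball (snd c z) (2 * r) \<subseteq> im c"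
      and L: "\<And>t x. good_time t \<Longrightarrow> t < T + 1 \<Longrightarrow> x \<in> ball (snd c z) (r / 2) \<Longrightarrow>
        norm (generator (chart_inv c x) t c) \<le> L"
      by (rule generator_local[OF c T1]) (rule that)
    obtain M where M: "0 < M" "\<And>x a. x \<in> cball (snd c z) (2 * r) \<Longrightarrow> cnorm c x a \<le> M * norm a"
      by (rule cnorm_bounds[OF c(1) compact_cball r(3)]) (rule that)
    have sub: "ball (snd c z) (r / 2) \<subseteq> cball (snd c z) (2 * r)" using r(1) by auto
    let ?U = "chart_inv c ` ball (snd c z) (r / 2)"
    have "open ?U" by (rule open_chart_inv_image[OF c(1) order_trans[OF sub r(3)] open_ball])
    moreover have "z \<in> ?U" using r(1) chart_inv_left[OF c] by (intro image_eqI[of _ _ "snd c z"]) auto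
    moreover have "tnorm h w (generator w t) \<le> M * L" if w: "w \<in> ?U" and t: "t \<le> T" for w t
    proof -
      obtain x where x: "x \<in> ball (snd c z) (r / 2)" "w = chart_inv c x" using w by blast
      have xim: "x \<in> im c" using x sub r(3) by blast
      have "norm (generator w t c) \<le> L"
        using L[OF _ _ x(1), of t] t r(2) x(2) by (cases "good_time t") (auto simp: generator_bad)
      have "tnorm h w (generator w t) = cnorm c x (generator w t c)"
        using tnorm_eq_cnorm[OF generator_in_tangent_space c(1), of w t] x(2)
          chart_inv_in[OF c(1) xim] chart_inv_right[OF c(1) xim] by simp
      also have "\<dots> \<le> M * norm (generator w t c)" using M(2) x(1) sub by blast
      also have "\<dots> \<le> M * L" using M(1) \<open>norm (generator w t c) \<le> L\<close> by simp
      finally show ?thesis .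
    qed
    moreover have "0 \<le> M * L" using M(1) r(2) by simp
    ultimately show ?thesis by blast
  qed
  then obtain U B where UB: "\<And>z. open (U z) \<and> z \<in> U z \<and> 0 \<le> (B z :: real) \<and>
      (\<forall>w\<in>U z. \<forall>t\<le>T. tnorm h w (generator w t) \<le> B z)" by metis
  obtain F where F: "F \<subseteq> K" "finite F" "K \<subseteq> (\<Union>z\<in>F. U z)"
    using compactE_image[OF K, of K U] UB by blast
  show ?thesis
  proof (rule that[of "\<Sum>z\<in>F. B z"])
    show "0 \<le> (\<Sum>z\<in>F. B z)" using UB by (simp add: sum_nonneg)
    fix t z assume t: "t \<le> T" and z: "z \<in> K"
    then obtain y where y: "y \<in> F" "z \<in> U y" using F(3) by blast
    then have "tnorm h z (generator z t) \<le> B y" using UB t by blast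
    also have "B y \<le> (\<Sum>z\<in>F. B z)" using UB by (intro member_le_sum y F(2)) auto
    finally show "tnorm h z (generator z t) \<le> (\<Sum>z\<in>F. B z)" .
  qed
qed

text \<open>Needed for measurability in \<open>t\<close> of the quotients. For \<open>s < u\<close> compare the positions at \<open>s + k\<close> and at \<open>u + k\<close> through
the trajectory started at \<open>s\<close> and followed until \<open>u + k\<close>: its first difference is controlled by the Lipschitz
bound in time, its second one by the spatial Lipschitz bound which the holomorphic map
\<open>\<phi> u (u + k)\<close> has by Cauchy's inequality.\<close>

lemma flow_time_shift_continuous:
  assumes c: "c \<in> A" and z: "z \<in> fst c" and T: "0 \<le> T"
  obtains h0 where "0 < h0" "\<And>k. 0 < k \<Longrightarrow> k < h0 \<Longrightarrow> continuous_on {0..T} (\<lambda>t. snd c (\<phi> t (t + k) z))"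
proof -
  let ?p = "snd c z"
  have T1: "0 < T + 1" using T by simp
  obtain r \<delta> L where box: "flow_box c z (T + 1) r \<delta> L" by (rule ex_flow_box[OF c z T1]) (rule that)
  note f = flow_box_pos[OF box] and sub = flow_box_im(2)[OF box]
    and stay = flow_box_stay[OF box] and lip = flow_box_Lipschitz[OF box]
  have p: "?p \<in> ball ?p r" "chart_inv c ?p = z" using f(1) chart_inv_left[OF c z] by auto
  \<comment> \<open>The spatial Lipschitz constant on half the ball of a map that deviates by at most \<open>2 * r\<close> from the centre.\<close>
  define K where "K = 2 * real CARD('n) * (2 * r) / (r / 2)"
  have K: "0 \<le> K" using f(1) by (simp add: K_def)
  define \<eta> where "\<eta> = min (\<delta> / 2) (r / (2 * L))"
  have \<eta>: "0 < \<eta>" "\<eta> \<le> \<delta> / 2" "L * \<eta> \<le> r / 2"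
  proof -
    show "0 < \<eta>" "\<eta> \<le> \<delta> / 2" using f by (auto simp: \<eta>_def)
    have "L * \<eta> \<le> L * (r / (2 * L))" using f by (intro mult_left_mono) (auto simp: \<eta>_def)
    then show "L * \<eta> \<le> r / 2" using f by simp
  qed
  have main: "norm (snd c (\<phi> s (s + k) z) - snd c (\<phi> u (u + k) z)) \<le> (L + K * L) * (u - s)"
    if k: "0 < k" "k < min (\<delta> / 2) 1" and su: "0 \<le> s" "s \<le> u" "u \<le> T" "u - s < \<eta>" for k s u
  proof -
    have 1: "norm (snd c (\<phi> s (s + k) z) - snd c (\<phi> s (u + k) z)) \<le> L * (u - s)"
      using lip[of s "s + k" "u + k" ?p] k su \<eta> p by simp
    define y where "y = snd c (\<phi> s u z)"
    have in_c: "\<phi> s u z \<in> fst c" using stay[of s u ?p] su \<eta> f(2) p k by simp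
    have y: "chart_inv c y = \<phi> s u z" unfolding y_def by (rule chart_inv_left[OF c in_c])
    have yp: "norm (y - ?p) \<le> L * (u - s)"
      using lip[of s u s ?p] su \<eta> f(2) p k by (simp add: y_def evo_id)
    also have "\<dots> < L * \<eta>" using su f(3) by simp
    finally have yb: "y \<in> ball ?p (r / 2)" using \<eta> by (simp add: dist_norm norm_minus_commute)
    \<comment> \<open>Subtracting the centre makes the bound independent of where the chart places it.\<close>
    let ?F = "\<lambda>x. snd c (\<phi> u (u + k) (chart_inv c x)) - ?p"
    have u0: "0 \<le> u" using su by simp
    have "norm (?F y - ?F ?p) \<le> K * norm (y - ?p)"
      unfolding K_def
    proof (rule holomorphic_vec_Lipschitz[of ?F ?p "r / 2" "2 * r"])
      have "holomorphic_vec_on ?F (ball ?p r)"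
        by (intro holomorphic_vec_on_diff holomorphic_vec_on_const flow_holomorphic_in_chart[OF c u0 _ sub])
          (use stay[of u "u + k"] u0 k su in auto)
      then show "holomorphic_vec_on ?F (ball ?p (2 * (r / 2)))" by simp
      fix x assume "x \<in> ball ?p (2 * (r / 2))"
      then have "snd c (\<phi> u (u + k) (chart_inv c x)) \<in> cball ?p (2 * r)"
        using stay[of u "u + k" x] u0 k su by simp
      then show "norm (?F x) \<le> 2 * r" by (simp add: dist_norm norm_minus_commute)
    qed (use f(1) yb in auto)
    then have "norm (?F y - ?F ?p) \<le> K * (L * (u - s))"
      using mult_left_mono[OF yp K] by linarith
    moreover have "\<phi> u (u + k) (\<phi> s u z) = \<phi> s (u + k) z" using su k by (intro evo_comp) auto
    ultimately have 2: "norm (snd c (\<phi> s (u + k) z) - snd c (\<phi> u (u + k) z)) \<le> K * (L * (u - s))"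
      using y p by simp
    have "norm (snd c (\<phi> s (s + k) z) - snd c (\<phi> u (u + k) z)) \<le>
        norm (snd c (\<phi> s (s + k) z) - snd c (\<phi> s (u + k) z)) + norm (snd c (\<phi> s (u + k) z) - snd c (\<phi> u (u + k) z))"
      using norm_triangle_ineq[of "snd c (\<phi> s (s + k) z) - snd c (\<phi> s (u + k) z)"
          "snd c (\<phi> s (u + k) z) - snd c (\<phi> u (u + k) z)"] by simp
    also have "\<dots> \<le> L * (u - s) + K * (L * (u - s))" by (rule add_mono[OF 1 2])
    finally show ?thesis by (simp add: algebra_simps)
  qed
  have "continuous_on {0..T} (\<lambda>t. snd c (\<phi> t (t + k) z))" if k: "0 < k" "k < min (\<delta> / 2) 1" for k
    unfolding continuous_on_iff
  proof (intro ballI allI impI)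
    fix s e :: real assume s: "s \<in> {0..T}" and e: "0 < e"
    let ?M = "L + K * L"
    have M: "0 < ?M" using f(3) K by (simp add: add_pos_nonneg)
    have "dist (snd c (\<phi> u (u + k) z)) (snd c (\<phi> s (s + k) z)) < e"
      if u: "u \<in> {0..T}" "dist u s < min \<eta> (e / ?M)" for u
    proof -
      have "norm (snd c (\<phi> s (s + k) z) - snd c (\<phi> u (u + k) z)) \<le> ?M * \<bar>u - s\<bar>"
      proof (cases "s \<le> u")
        case True
        then show ?thesis using main[OF k, of s u] u s by (simp add: dist_real_def)
      next
        case False
        then show ?thesis using main[OF k, of u s] u s by (simp add: dist_real_def norm_minus_commute)
      qed
      also have "?M * \<bar>u - s\<bar> < ?M * (e / ?M)"
        using u(2) M by (intro mult_strict_left_mono) (auto simp: dist_real_def)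
      also have "\<dots> = e" using M by simp
      finally show ?thesis by (simp add: dist_norm norm_minus_commute)
    qed
    then show "\<exists>d>0. \<forall>u\<in>{0..T}. dist u s < d \<longrightarrow> dist (snd c (\<phi> u (u + k) z)) (snd c (\<phi> s (s + k) z)) < e"
      using \<eta>(1) e M by (intro exI[of _ "min \<eta> (e / ?M)"]) auto
  qed
  then show ?thesis using that[of "min (\<delta> / 2) 1"] f(2) by simp
qed

lemma good_times_measurable: "{t. 0 \<le> t \<and> good_time t} \<in> sets lebesgue"
proof -
  have "{t. 0 \<le> t \<and> good_time t} = {0..} - {t. 0 \<le> t \<and> \<not> good_time t}" by auto
  moreover have "{t. 0 \<le> t \<and> \<not> good_time t} \<in> sets lebesgue"
    using negligible_bad_times negligible_imp_sets by blast
  ultimately show ?thesis by auto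
qed

text \<open>A pointwise limit of functions that are continuous on compact time intervals, cut off to the
measurable set of good times.\<close>

lemma generator_measurable:
  assumes c: "c \<in> A" and z: "z \<in> fst c"
  shows "(\<lambda>t. generator z t c) \<in> borel_measurable (lebesgue_on {0..})"
proof -
  have local: "(\<lambda>t. generator z t c) \<in> borel_measurable (lebesgue_on {0..real N})" for N
  proof -
    obtain h0 where h0: "0 < h0"
      "\<And>k. 0 < k \<Longrightarrow> k < h0 \<Longrightarrow> continuous_on {0..real N} (\<lambda>t. snd c (\<phi> t (t + k) z))"
      by (rule flow_time_shift_continuous[OF c z, of "real N"]) (simp, rule that)
    define k where "k = (\<lambda>i. h0 / (real i + 2))"
    have k: "0 < k i" "k i < h0" for i using h0(1) by (auto simp: k_def field_simps add_pos_nonneg)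
    have klim: "filterlim k (at_right 0) sequentially"
    proof -
      have "k \<longlonglongrightarrow> 0" unfolding k_def by real_asymp
      then show ?thesis
        unfolding filterlim_at using k less_imp_neq[OF k(1)] by (auto intro!: always_eventually)
    qed
    let ?good = "{t. 0 \<le> t \<and> good_time t}"
    let ?F = "\<lambda>i t. indicat_real ?good t *\<^sub>R ((1 / k i) *\<^sub>R (snd c (\<phi> t (t + k i) z) - snd c z))"
    show ?thesis
    proof (rule borel_measurable_LIMSEQ_metric)
      fix i
      have "(\<lambda>t. (1 / k i) *\<^sub>R (snd c (\<phi> t (t + k i) z) - snd c z)) \<in> borel_measurable (lebesgue_on {0..real N})"
        by (rule continuous_imp_measurable_on_sets_lebesgue) (auto intro!: continuous_intros h0(2) k)
      moreover have "indicat_real ?good \<in> borel_measurable (lebesgue_on {0..real N})"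
        by (rule measurable_restrict_space1) (use good_times_measurable in simp)
      ultimately show "?F i \<in> borel_measurable (lebesgue_on {0..real N})"
        by (rule borel_measurable_scaleR[rotated])
    next
      fix t assume "t \<in> space (lebesgue_on {0..real N})"
      then have t: "0 \<le> t" by simp
      show "(\<lambda>i. ?F i t) \<longlonglongrightarrow> generator z t c"
      proof (cases "good_time t")
        case True
        have x: "snd c z \<in> im c" using z by simp
        have "((\<lambda>\<tau>. (1 / \<tau>) *\<^sub>R (snd c (\<phi> t (t + \<tau>) z) - snd c z)) \<longlongrightarrow> generator z t c) (at_right 0)"
          using generator_quot[OF True c x] unfolding chart_inv_left[OF c z] .
        from filterlim_compose[OF this klim] show ?thesis using True t by simp
      next
        case False
        then show ?thesis by (simp add: generator_bad)
      qed
    qed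
  qed
  have "(\<lambda>t. if t \<in> {0..} then generator z t c else 0) \<in> borel_measurable lebesgue"
  proof (rule borel_measurable_LIMSEQ_metric)
    fix N
    show "(\<lambda>t. if t \<in> {0..real N} then generator z t c else 0) \<in> borel_measurable lebesgue"
      using local[of N] by (subst (asm) measurable_restrict_space_iff[where c = 0]) auto
  next
    fix t :: real
    obtain N0 where N0: "t \<le> real N0" using real_arch_simple by blast
    have "eventually (\<lambda>N. (if t \<in> {0..real N} then generator z t c else 0) =
        (if t \<in> {0..} then generator z t c else 0)) sequentially"
      using eventually_ge_at_top[of N0]
    proof eventually_elim
      case (elim N)
      then have "t \<le> real N" using N0 by (meson of_nat_le_iff order_trans)
      then show ?case by simp
    qed
    then show "(\<lambda>N. if t \<in> {0..real N} then generator z t c else 0) \<longlonglongrightarrow>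
        (if t \<in> {0..} then generator z t c else 0)"
      by (rule tendsto_eventually)
  qed
  then show ?thesis by (subst measurable_restrict_space_iff[where c = 0]) auto
qed

lemma generator_weak_vector_field: "weak_holomorphic_vector_field_of_order A h \<infinity> generator"
  unfolding weak_holomorphic_vector_field_of_order_def
proof (intro conjI allI impI ballI)
  fix K :: "'a set" and T :: real assume KT: "compact K \<and> 0 < T"
  then obtain B where B: "0 \<le> B" "\<And>t z. t \<le> T \<Longrightarrow> z \<in> K \<Longrightarrow> tnorm h z (generator z t) \<le> B"
    using generator_bounded by metis
  show "\<exists>C. Ld_nonneg \<infinity> {0..T} C \<and> (AE t in lebesgue_on {0..T}. \<forall>z\<in>K. tnorm h z (generator z t) \<le> C t)"
  proof (intro exI conjI)
    show "Ld_nonneg \<infinity> {0..T} (\<lambda>_. B)" using B(1) by (auto simp: Ld_nonneg_def)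
    show "AE t in lebesgue_on {0..T}. \<forall>z\<in>K. tnorm h z (generator z t) \<le> B"
      by (rule AE_I2) (use B(2) in simp)
  qed
qed (simp_all add: generator_in_tangent_space generator_measurable generator_holomorphic)

text \<open>At a good time at which the trajectory is differentiable, its velocity is the right derivative of the
restarted trajectory, which is the generator.\<close>

lemma generator_loewner_ode: "satisfies_loewner_ode A \<phi> generator"
  unfolding satisfies_loewner_ode_def
proof (intro allI impI)
  fix s :: real and z :: 'a assume s: "0 \<le> s"
  have "{s..} \<in> sets lebesgue" by simp
  show "AE t in lebesgue_on {s..}. has_velocity A (\<lambda>\<tau>. \<phi> s \<tau> z) (generator (\<phi> s t z) t) t {s..}"
    unfolding AE_lebesgue_on_iff[OF \<open>{s..} \<in> sets lebesgue\<close>]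
    using AE_lebesgue_negligible[OF negligible_bad_times] AE_lebesgue_negligible[OF negligible_sing[of s]]
      AE_lebesgue_negligible[OF trajectory_differentiable_ae[OF s, of z]]
  proof eventually_elim
    case (elim t)
    show ?case
    proof
      assume "t \<in> {s..}"
      then have st: "s < t" "s \<le> t" "0 \<le> t" using elim(2) s by auto
      have good: "good_time t" using elim(1) st by simp
      obtain v where v: "has_velocity A (\<lambda>\<tau>. \<phi> s \<tau> z) v t UNIV" using elim(3) st by auto
      have r: "has_velocity A (\<lambda>\<tau>. \<phi> t \<tau> (\<phi> s t z)) v t {t..}"
        by (rule velocity_restart[OF s st(2) v]) simp
      have "v c = generator (\<phi> s t z) t c" if "c \<in> A" "\<phi> s t z \<in> fst c" for c
        using right_velocity_unique[OF r generator_velocity(1)[OF good]] that evo_id[OF st(3)] by simp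
      then show "has_velocity A (\<lambda>\<tau>. \<phi> s \<tau> z) (generator (\<phi> s t z) t) t {s..}"
        using has_velocity_subset[OF v, of "{s..}"] unfolding has_velocity_def by simp
    qed
  qed
qed

section \<open>The Herglotz inequality and uniqueness\<close>

text \<open>The distance of the two moving points is largest at the start, by contraction, and the chain rule identifies its right
derivative with the differential of the distance along the generator.\<close>

lemma generator_decreases_kobayashi:
  assumes C1: "C1_off_diagonal A (kobayashi_dist A)" and t: "good_time t" and zw: "z \<noteq> w"
  shows "differential2 A (kobayashi_dist A) z w (generator z t) (generator w t) \<le> 0"
proof -
  have t0: "0 \<le> t" using t by (simp add: good_time_def)
  define c where "c = chart_at A z"
  define c' where "c' = chart_at A w"
  have c: "c \<in> A" "z \<in> fst c"
    using someI_ex[of "\<lambda>c. c \<in> A \<and> z \<in> fst c"] ex_chart[of z] unfolding c_def chart_at_def by blast+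
  have c': "c' \<in> A" "w \<in> fst c'"
    using someI_ex[of "\<lambda>c. c \<in> A \<and> w \<in> fst c"] ex_chart[of w] unfolding c'_def chart_at_def by blast+
  let ?F = "in_charts c c' (kobayashi_dist A)"
  let ?P = "\<lambda>\<tau>. (snd c (\<phi> t \<tau> z), snd c' (\<phi> t \<tau> w))"
  let ?D = "frechet_derivative ?F (at (snd c z, snd c' w))"
  let ?uv = "(generator z t c, generator w t c')"
  have "(snd c z, snd c' w) \<in> {(x, y). x \<in> im c \<and> y \<in> im c' \<and> chart_inv c x \<noteq> chart_inv c' y}"
    using c c' zw by (simp add: chart_inv_left)
  then have "?F differentiable (at (snd c z, snd c' w))"
    using C1[unfolded C1_off_diagonal_def One_nat_def C_k_on.simps, rule_format, OF c(1) c'(1), THEN conjunct1]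
    by (rule bspec[rotated])
  then have D: "(?F has_derivative ?D) (at (?P t))"
    unfolding frechet_derivative_works by (simp only: evo_id[OF t0])
  have "((\<lambda>\<tau>. snd c (\<phi> t \<tau> z)) has_vector_derivative generator z t c) (at t within {t..})"
    "((\<lambda>\<tau>. snd c' (\<phi> t \<tau> w)) has_vector_derivative generator w t c') (at t within {t..})"
    using generator_velocity(1)[OF t] c c' unfolding has_velocity_def by (simp_all add: evo_id[OF t0])
  then have "(?P has_derivative (\<lambda>x. (x *\<^sub>R generator z t c, x *\<^sub>R generator w t c'))) (at t within {t..})"
    unfolding has_vector_derivative_def by (rule has_derivative_Pair)
  from has_derivative_compose[OF this D]
  have "((\<lambda>\<tau>. ?F (?P \<tau>)) has_derivative (\<lambda>x. ?D (x *\<^sub>R ?uv))) (at t within {t..})" by simp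
  moreover have "?D (x *\<^sub>R ?uv) = x *\<^sub>R ?D ?uv" for x
    using linear_scale[OF bounded_linear.linear[OF has_derivative_bounded_linear[OF D]]] .
  ultimately have "((\<lambda>\<tau>. ?F (?P \<tau>)) has_vector_derivative ?D ?uv) (at t within {t..})"
    unfolding has_vector_derivative_def by simp
  then have lim: "((\<lambda>\<tau>. (1 / \<tau>) *\<^sub>R (?F (?P (t + \<tau>)) - ?F (?P t))) \<longlongrightarrow> ?D ?uv) (at_right 0)"
    by (rule has_vector_derivative_right_iff[THEN iffD1])
  have ev: "eventually (\<lambda>\<tau>. \<phi> t (t + \<tau>) y \<in> fst b) (at_right 0)" if b: "b \<in> A" "y \<in> fst b" for b y
  proof -
    obtain \<delta> where \<delta>: "0 < \<delta>" "\<And>\<tau>. t \<le> \<tau> \<Longrightarrow> \<bar>\<tau> - t\<bar> \<le> \<delta> \<Longrightarrow> \<phi> t \<tau> y \<in> fst b"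
      by (rule trajectory_Lipschitz[OF t0 order_refl b(1), of y]) (simp add: evo_id[OF t0] b, rule that)
    have "eventually (\<lambda>\<tau>. 0 < \<tau> \<and> \<tau> < \<delta>) (at_right 0)"
      using \<delta>(1) eventually_at_right_field by blast
    then show ?thesis by eventually_elim (use \<delta>(2) in simp)
  qed
  have "?D ?uv \<le> 0"
  proof (rule tendsto_upperbound[OF lim])
    show "eventually (\<lambda>\<tau>. (1 / \<tau>) *\<^sub>R (?F (?P (t + \<tau>)) - ?F (?P t)) \<le> 0) (at_right 0)"
      using ev[OF c] ev[OF c'] eventually_at_right_less[of 0]
    proof eventually_elim
      case (elim \<tau>)
      have "?F (?P (t + \<tau>)) = kobayashi_dist A (\<phi> t (t + \<tau>) z) (\<phi> t (t + \<tau>) w)"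
        using elim c(1) c'(1) by (simp add: in_charts_def chart_inv_left)
      also have "\<dots> \<le> kobayashi_dist A z w"
        using elim(3) t0 by (intro kobayashi_dist_contraction evo_hol) auto
      also have "\<dots> = ?F (?P t)"
        using c c' by (simp add: in_charts_def chart_inv_left evo_id[OF t0])
      finally show ?case using elim(3) by (simp add: mult_le_0_iff divide_le_0_iff)
    qed
  qed simp
  then show ?thesis unfolding differential2_def Let_def c_def[symmetric] c'_def[symmetric] .
qed

lemma generator_herglotz:
  assumes "C1_off_diagonal A (kobayashi_dist A)"
  shows "herglotz_vector_field A h generator"
  unfolding herglotz_vector_field_def
proof (intro conjI generator_weak_vector_field)
  have S: "{0::real..} \<in> sets lebesgue" by simp
  show "AE t in lebesgue_on {0..}. \<forall>z w. z \<noteq> w \<longrightarrow>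
      differential2 A (kobayashi_dist A) z w (generator z t) (generator w t) \<le> 0"
    unfolding AE_lebesgue_on_iff[OF S] using AE_lebesgue_negligible[OF negligible_bad_times]
    by eventually_elim (use generator_decreases_kobayashi[OF assms] in auto)
qed

text \<open>Restricting the equation for \<open>H\<close> to countably many trajectories leaves one null set of times. Outside it \<open>H\<close>
and the generator agree at the positions of these trajectories; the set where they differ is open in
a chart and would contain such a position.\<close>

lemma generator_unique:
  assumes H: "weak_holomorphic_vector_field A h H" and ode: "satisfies_loewner_ode A \<phi> H"
  shows "AE t in lebesgue_on {0..}. \<forall>z. generator z t = H z t"
proof -
  have S: "{s::real..} \<in> sets lebesgue" for s by simp
  obtain d where d: "weak_holomorphic_vector_field_of_order A h d H"
    using H unfolding weak_holomorphic_vector_field_def by (elim exE) (rule that)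
  have H_tan: "\<forall>z. \<forall>t\<ge>0. H z t \<in> tangent_space A z"
    and H_hol: "\<forall>t\<ge>0. \<forall>c\<in>A. holomorphic_vec_on (\<lambda>x. H (chart_inv c x) t c) (im c)"
    using d unfolding weak_holomorphic_vector_field_of_order_def by - (elim conjE, assumption)+
  have cnt: "countable ((\<rat> \<inter> {0..}) \<times> dense_points)"
    by (intro countable_SIGMA countable_Int1 countable_rat countable_dense_points)
  have "AE t in lebesgue. \<forall>j\<in>(\<rat> \<inter> {0..}) \<times> dense_points. t \<in> {fst j..} \<longrightarrow>
      has_velocity A (\<lambda>\<tau>. \<phi> (fst j) \<tau> (snd j)) (H (\<phi> (fst j) t (snd j)) t) t {fst j..}"
    unfolding AE_ball_countable[OF cnt] AE_lebesgue_on_iff[OF S, symmetric]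
  proof
    fix j :: "real \<times> 'a" assume "j \<in> (\<rat> \<inter> {0..}) \<times> dense_points"
    then have "0 \<le> fst j" by auto
    then show "AE t in lebesgue_on {fst j..}.
        has_velocity A (\<lambda>\<tau>. \<phi> (fst j) \<tau> (snd j)) (H (\<phi> (fst j) t (snd j)) t) t {fst j..}"
      using ode unfolding satisfies_loewner_ode_def by blast
  qed
  then show ?thesis
    unfolding AE_lebesgue_on_iff[OF S] using AE_lebesgue_negligible[OF negligible_bad_times]
  proof eventually_elim
    case (elim t)
    show ?case
    proof (intro impI allI)
      fix z assume "t \<in> {0..}"
      then have t0: "0 \<le> t" and good: "good_time t" using elim(2) by auto
      then have tpos: "0 < t" by (simp add: good_time_def)
      have agree: "generator (\<phi> s t d) t c = H (\<phi> s t d) t c"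
        if sd: "s \<in> \<rat>" "0 \<le> s" "s < t" "d \<in> dense_points" and c: "c \<in> A" "\<phi> s t d \<in> fst c" for s d c
      proof -
        have "has_velocity A (\<lambda>\<tau>. \<phi> s \<tau> d) (H (\<phi> s t d) t) t {s..}"
          using elim(1) sd by (auto dest: bspec[of _ _ "(s, d)"])
        then have "has_velocity A (\<lambda>\<tau>. \<phi> t \<tau> (\<phi> s t d)) (H (\<phi> s t d) t) t {t..}"
          by (rule velocity_restart[OF sd(2) less_imp_le[OF sd(3)]]) (use sd(3) in auto)
        from right_velocity_unique[OF generator_velocity(1)[OF good] this c(1)]
        show ?thesis using c(2) by (simp add: evo_id[OF t0])
      qed
      have "generator z t c = H z t c" if c: "c \<in> A" "z \<in> fst c" for c
      proof (rule ccontr)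
        assume neq: "generator z t c \<noteq> H z t c"
        let ?d = "\<lambda>x. generator (chart_inv c x) t c - H (chart_inv c x) t c"
        let ?V = "?d -` (- {0}) \<inter> im c"
        have "continuous_on (im c) ?d"
          by (intro continuous_on_diff holomorphic_vec_on_imp_continuous_on generator_holomorphic
              H_hol[rule_format] c t0)
        then have V: "open ?V"
          using continuous_on_open_vimage[OF open_im[OF c(1)]] by blast
        have "snd c z \<in> ?V" using neq c chart_inv_left[OF c] by simp
        then obtain s d where sd: "s \<in> \<rat>" "0 \<le> s" "s < t" "d \<in> dense_points" "\<phi> s t d \<in> chart_inv c ` ?V"
          using trajectory_points_dense[OF tpos open_chart_inv_image[OF c(1) _ V]] by blast
        then obtain x where x: "x \<in> ?V" "\<phi> s t d = chart_inv c x" by blast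
        then have "\<phi> s t d \<in> fst c" using chart_inv_in[OF c(1)] by simp
        then have "?d x = 0" using agree[OF sd(1-4) c(1)] x(2) by simp
        then show False using x(1) by simp
      qed
      moreover have "generator z t c = 0 \<and> H z t c = 0" if "\<not> (c \<in> A \<and> z \<in> fst c)" for c
        using generator_in_tangent_space[of z t] H_tan[rule_format, OF t0, of z] that unfolding tangent_space_iff by blast
      ultimately show "generator z t = H z t" by (metis ext)
    qed
  qed
qed

end

theorem proposition4p1:
  fixes A :: "('a::{t2_space, second_countable_topology}, 'n::finite) chart set"
    and h :: "'a \<Rightarrow> ('a, 'n) tvector \<Rightarrow> ('a, 'n) tvector \<Rightarrow> complex"
    and \<phi> :: "real \<Rightarrow> real \<Rightarrow> 'a \<Rightarrow> 'a"
  assumes "complex_manifold A"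
    and "hermitian_metric A h"
    and "taut A h"
    and "C1_off_diagonal A (kobayashi_dist A)"
    and "evolution_family A h \<phi>"
  shows "\<exists>G. herglotz_vector_field A h G \<and> satisfies_loewner_ode A \<phi> G \<and>
    (\<forall>H. weak_holomorphic_vector_field A h H \<and> satisfies_loewner_ode A \<phi> H \<longrightarrow>
       (AE t in lebesgue_on {0..}. \<forall>z. G z t = H z t))"
proof -
  interpret evolution_mfd A h \<phi>
    by unfold_locales (use assms in auto)
  show ?thesis
    using generator_herglotz[OF assms(4)] generator_loewner_ode generator_unique by blast
qed

end
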